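(* There exist constants $c,d\geq 1$ such that the following holds. For any $k=k(n)\geq c\cdot\log n$, there is a polynomial-time computable function $f_k\colon\{0,1\}^n\to\{0,1\}$ such that, for every comparator circuit $C$ on $n$ variables with at most \[ \frac{n^{1.5}}{d\cdot k\cdot\sqrt{\log n}} \] gates, we have \[ \Pr_{x\in\{0,1\}^n}[f_k(x)=C(x)]\leq \frac12+\frac{1}{2^{\Omega(k)}}, \] where the $\Omega(\cdot)$ hides an absolute constant independent of $n$, $k$ and $C$.
   Context: A comparator circuit on $n$ variables consists of a set of wires, each labelled by an input literal ($x_i$ or $\neg x_i$), a sequence of gates, each of which is an ordered pair of distinct wires $(w_i,w_j)$, and a designated output wire. On input $a\in\{0,1\}^n$, each wire labelled by a literal is initialised with the value of that literal on $a$, and the gates are applied in order: a gate $(w_i,w_j)$ replaces the current values $(u,v)$ of $(w_i,w_j)$ by $(u\wedge v,\,u\vee v)$. The value of the output wire at the end is the output $C(a)$. The size of the circuit is its number of gates. Logarithms are base 2. *)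

theory Defs
  imports "HOL-Probability.Probability"
begin

section \<open>Comparator circuits\<close>

text \<open>The variables are \<open>0, \<dots>, n - 1\<close>, and an input in \<open>{0,1}\<^sup>n\<close> is a list of \<open>n\<close> Booleans.\<close>

datatype literal = Pos nat | Neg nat

fun lit_var :: "literal \<Rightarrow> nat" where
  "lit_var (Pos i) = i"
| "lit_var (Neg i) = i"

fun lit_val :: "bool list \<Rightarrow> literal \<Rightarrow> bool" where
  "lit_val a (Pos i) = a ! i"
| "lit_val a (Neg i) = (\<not> a ! i)"

text \<open>The wires are the positions of the list of labels, so that several wires may carry
  the same literal.\<close>

record comparator_circuit =
  labels :: "literal list"
  gates :: "(nat \<times> nat) list"
  out_wire :: nat

definition comparator_circuit_on :: "nat \<Rightarrow> comparator_circuit \<Rightarrow> bool" where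
  "comparator_circuit_on n C \<longleftrightarrow>
     (\<forall>l\<in>set (labels C). lit_var l < n) \<and>
     (\<forall>(i, j)\<in>set (gates C). i < length (labels C) \<and> j < length (labels C) \<and> i \<noteq> j) \<and>
     out_wire C < length (labels C)"

fun apply_gate :: "nat \<times> nat \<Rightarrow> (nat \<Rightarrow> bool) \<Rightarrow> (nat \<Rightarrow> bool)" where
  "apply_gate (i, j) v = v(i := v i \<and> v j, j := v i \<or> v j)"

definition circuit_output :: "comparator_circuit \<Rightarrow> bool list \<Rightarrow> bool" where
  "circuit_output C a =
     fold apply_gate (gates C) (\<lambda>w. lit_val a (labels C ! w)) (out_wire C)"

definition circuit_size :: "comparator_circuit \<Rightarrow> nat" where
  "circuit_size C = length (gates C)"

section \<open>Polynomial time\<close>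

text \<open>Deterministic Turing machines with finitely many two-way infinite tapes. States and
  symbols are the natural numbers below \<open>num_states\<close> and \<open>num_symbols\<close>. State 0 is the initial
  state, state 1 halts and accepts, state 2 halts and rejects. Symbol 0 is the blank, symbols
  1 and 2 encode the input bits. The values of \<open>delta\<close> outside the finite domain fixed by
  \<open>turing_machine\<close> are irrelevant.\<close>

datatype direction = Move_Left | Move_Right | Stay

fun offset :: "direction \<Rightarrow> int" where
  "offset Move_Left = -1"
| "offset Move_Right = 1"
| "offset Stay = 0"

record tm =
  num_tapes :: nat
  num_states :: nat
  num_symbols :: nat
  delta :: "nat \<Rightarrow> nat list \<Rightarrow> nat \<times> (nat \<times> direction) list"

definition turing_machine :: "tm \<Rightarrow> bool" where
  "turing_machine M \<longleftrightarrow>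
     num_tapes M \<ge> 1 \<and> num_states M \<ge> 3 \<and> num_symbols M \<ge> 3 \<and>
     (\<forall>q ss. q < num_states M \<and> length ss = num_tapes M \<and> (\<forall>s\<in>set ss. s < num_symbols M) \<longrightarrow>
        (case delta M q ss of (q', acts) \<Rightarrow>
           q' < num_states M \<and> length acts = num_tapes M \<and>
           (\<forall>(s, d)\<in>set acts. s < num_symbols M)))"

text \<open>A tape is its content together with the position of its head.\<close>

type_synonym tape = "(int \<Rightarrow> nat) \<times> int"

fun read_tape :: "tape \<Rightarrow> nat" where
  "read_tape (t, h) = t h"

fun act_on_tape :: "tape \<Rightarrow> nat \<times> direction \<Rightarrow> tape" where
  "act_on_tape (t, h) (s, d) = (t(h := s), h + offset d)"

fun tm_step :: "tm \<Rightarrow> nat \<times> tape list \<Rightarrow> nat \<times> tape list" where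
  "tm_step M (q, ts) =
     (if q = 1 \<or> q = 2 then (q, ts)
      else case delta M q (map read_tape ts) of (q', acts) \<Rightarrow> (q', map2 act_on_tape ts acts))"

definition input_tape :: "bool list \<Rightarrow> tape" where
  "input_tape x =
     (\<lambda>p. if 0 \<le> p \<and> p < int (length x) then (if x ! nat p then 2 else 1) else 0, 0)"

definition initial_config :: "tm \<Rightarrow> bool list \<Rightarrow> nat \<times> tape list" where
  "initial_config M x = (0, input_tape x # replicate (num_tapes M - 1) (\<lambda>_. 0, 0))"

definition decides_within :: "tm \<Rightarrow> (bool list \<Rightarrow> bool) \<Rightarrow> (nat \<Rightarrow> nat) \<Rightarrow> bool" where
  "decides_within M f T \<longleftrightarrow>
     (\<forall>x. \<exists>t\<le>T (length x).
        fst ((tm_step M ^^ t) (initial_config M x)) = (if f x then 1 else 2))"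

text \<open>A function on all bit strings stands for the family of its restrictions to \<open>{0,1}\<^sup>n\<close>.\<close>

definition poly_time_computable :: "(bool list \<Rightarrow> bool) \<Rightarrow> bool" where
  "poly_time_computable f \<longleftrightarrow>
     (\<exists>M e. turing_machine M \<and> decides_within M f (\<lambda>n. n ^ e + e))"

section \<open>Agreement on a random input\<close>

definition cube :: "nat \<Rightarrow> bool list set" where
  "cube n = {x. length x = n}"

definition agreement :: "nat \<Rightarrow> (bool list \<Rightarrow> bool) \<Rightarrow> (bool list \<Rightarrow> bool) \<Rightarrow> real" where
  "agreement n f g = measure_pmf.prob (pmf_of_set (cube n)) {x. f x = g x}"

end

theory Submission
  imports Defs "HOL-Number_Theory.Cong" "HOL-Library.Discrete_Functions"
begin

text \<open>
  Since \<open>k\<close> is arbitrary, possibly not computable, one hard function has to work for all \<open>k\<close> at once.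
  The input is split into a key \<open>y\<close> of \<open>n / 4\<close> bits, blocks \<open>z\<^sub>1, \<dots>, z\<^sub>b\<close> of \<open>r = O(log n)\<close> bits, and a
  rest. The function is the parity of the rest plus \<open>\<Sum>\<^sub>j h\<^sub>y(z\<^sub>j)\<close>, where \<open>h\<^sub>y(z)\<close> is the parity of
  \<open>y mod p\<^sub>z\<close> for distinct primes \<open>2\<^sup>r \<le> p\<^sub>z < 4\<^sup>r\<close>. By the Chinese remainder theorem, \<open>\<Omega>(n / r)\<close> distinct
  values of \<open>h\<^sub>y\<close> are almost independent and almost unbiased.

  A circuit with fewer than about \<open>n / 4\<close> gates misses a variable of the rest, and then the agreement is
  exactly \<open>1/2\<close>. Otherwise \<open>k = O(\<surd>n)\<close>; choose the \<open>m \<approx> k / r\<close> blocks that label the fewest wires and fix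
  all other variables. Only \<open>a = O(k s / n)\<close> of the wires remain non-constant, and a comparator
  circuit with \<open>a\<close> such wires needs at most \<open>a\<^sup>2\<close> gates, because a gate between comparable wires is
  useless and any other gate destroys an incomparable pair. So the restricted circuit is
  one of \<open>2\<close> to the \<open>O(a\<^sup>2 log n)\<close> functions, fixed before the restriction. For a fixed function, the \<open>2q\<close>-th
  moment over \<open>y\<close> of the correlation on the chosen blocks is \<open>2\<close> to the \<open>-\<Omega>(q m r)\<close>, where \<open>q m r = \<Theta>(n)\<close>.
  A union bound and Jensen's inequality bound the correlation by \<open>2\<close> to the \<open>-\<Omega>(m r)\<close>.
\<close>

section \<open>Counter programs on Turing machines\<close>

text \<open>The size bound comes from comparing two exponents. A moment of order 2q involves
  products of at most 2qm hash values, and these are nearly unbiased only while the product of their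
  primes stays well below 2^(n/4). This caps q m r at a constant fraction of n, and q m r is the
  gain. The union bound loses about a^2 log n. With a = O(k s / n) the gain wins as long as k s / n
  is below a small multiple of sqrt (n / log n), that is, for s up to order n^1.5 / (k sqrt (log
  n)). Taking the root of order 2q divides the gain by q, which leaves m r = \<Theta>(k).

  The obstacle is that the key is one of the fixed variables, so the restricted circuit may be
  adapted to the hash function. The union bound is possible because the list of candidate functions
  depends only on the circuit and the chosen positions: each candidate by itself is independent of
  the key.

  Blocks of logarithmic length serve both sides. Their values range over a polynomial domain, so the
  hash can be computed by unary counting, yet the domain is so large that the at most n block values
  in a moment seldom collide.\<close>

declare tm_step.simps [simp del]

datatype cond = Always | In_Range | Bit_Set

fun holds :: "cond \<Rightarrow> bool list \<Rightarrow> nat \<Rightarrow> bool" where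
  "holds Always x h = True"
| "holds In_Range x h = (h < length x)"
| "holds Bit_Set x h = (h < length x \<and> x ! h)"

text \<open>Register 0 is also the position of the input head; the test of a conditional increment
  on the cell there is the only access to the input.\<close>

datatype com = Incr cond nat | Decr nat | Seq com com | While nat com

text \<open>The cost is the exact number of compiled instructions executed: each round of a loop
  pays for one \<open>Jump_Zero\<close> and one \<open>Goto\<close>, the exit for one
  \<open>Jump_Zero\<close>. The simulation can therefore be step for step.\<close>

inductive exec :: "bool list \<Rightarrow> com \<Rightarrow> (nat \<Rightarrow> nat) \<Rightarrow> nat \<Rightarrow> (nat \<Rightarrow> nat) \<Rightarrow> bool" for x where
  Incr: "exec x (Incr c i) s 1 (if holds c x (s 0) then s(i := s i + 1) else s)"
| Decr: "exec x (Decr i) s 1 (s(i := s i - 1))"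
| Seq: "exec x a s t s' \<Longrightarrow> exec x b s' t' s'' \<Longrightarrow> exec x (Seq a b) s (t + t') s''"
| While_end: "s i = 0 \<Longrightarrow> exec x (While i a) s 1 s"
| While_step: "s i \<noteq> 0 \<Longrightarrow> exec x a s t s' \<Longrightarrow> exec x (While i a) s' t' s'' \<Longrightarrow>
    exec x (While i a) s (t + t' + 2) s''"

datatype instr = Incr_I cond nat | Decr_I nat | Jump_Zero nat nat | Goto nat

fun code_size :: "com \<Rightarrow> nat" where
  "code_size (Incr c i) = 1"
| "code_size (Decr i) = 1"
| "code_size (Seq a b) = code_size a + code_size b"
| "code_size (While i a) = code_size a + 2"

fun compile :: "com \<Rightarrow> nat \<Rightarrow> instr list" where
  "compile (Incr c i) p = [Incr_I c i]"
| "compile (Decr i) p = [Decr_I i]"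
| "compile (Seq a b) p = compile a p @ compile b (p + code_size a)"
| "compile (While i a) p = Jump_Zero i (p + code_size a + 2) # compile a (p + 1) @ [Goto p]"

lemma length_compile [simp]: "length (compile c p) = code_size c"
  by (induction c arbitrary: p) auto

fun max_reg :: "com \<Rightarrow> nat" where
  "max_reg (Incr c i) = i"
| "max_reg (Decr i) = i"
| "max_reg (Seq a b) = max (max_reg a) (max_reg b)"
| "max_reg (While i a) = max i (max_reg a)"

text \<open>The bound is not strict: a jump to the address just past the whole program leads to the
  state that tests the result register.\<close>

fun targets_le :: "nat \<Rightarrow> instr \<Rightarrow> bool" where
  "targets_le l (Jump_Zero i a) = (a \<le> l)"
| "targets_le l (Goto a) = (a \<le> l)"
| "targets_le l _ = True"

lemma targets_le_mono: "targets_le l i \<Longrightarrow> l \<le> l' \<Longrightarrow> targets_le l' i"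
  by (cases i) auto

lemma targets_compile: "i \<in> set (compile c p) \<Longrightarrow> targets_le (p + code_size c) i"
proof (induction c arbitrary: p)
  case (Seq a b)
  then show ?case
    using targets_le_mono[of "p + code_size a" i "p + code_size a + code_size b"]
    by (fastforce simp: add.assoc)
next
  case (While j a)
  then show ?case
    using targets_le_mono[of "p + 1 + code_size a" i "p + code_size a + 2"] by fastforce
qed auto

section \<open>Simulation of registers by head positions\<close>

fun sym_holds :: "cond \<Rightarrow> nat \<Rightarrow> bool" where
  "sym_holds Always c = True"
| "sym_holds In_Range c = (c mod 3 \<noteq> 0)"
| "sym_holds Bit_Set c = (c mod 3 = 2)"

text \<open>Registers are head positions. In its first step the machine adds 3 to the symbol in
  cell 0 of every tape; afterwards no tape content changes, and a symbol \<open>\<ge> 3\<close> signals that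
  the register is zero. The instruction at address \<open>p\<close> is executed in state \<open>p + 3\<close>.\<close>

definition counter_tm :: "nat \<Rightarrow> nat \<Rightarrow> instr list \<Rightarrow> tm" where
  "counter_tm K r P = \<lparr>num_tapes = K, num_states = length P + 4, num_symbols = 6,
     delta = (\<lambda>q ss.
       if q = 0 then (3, map (\<lambda>c. (if c < 3 then c + 3 else c, Stay)) ss)
       else if q - 3 < length P then
         (case P ! (q - 3) of
           Incr_I c i \<Rightarrow>
             (q + 1, map (\<lambda>j. (ss ! j, if j = i \<and> sym_holds c (ss ! 0) then Move_Right else Stay)) [0..<K])
         | Decr_I i \<Rightarrow>
             (q + 1, map (\<lambda>j. (ss ! j, if j = i \<and> ss ! j < 3 then Move_Left else Stay)) [0..<K])
         | Jump_Zero i a \<Rightarrow>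
             (if ss ! i \<ge> 3 then a + 3 else q + 1, map (\<lambda>j. (ss ! j, Stay)) [0..<K])
         | Goto a \<Rightarrow> (a + 3, map (\<lambda>j. (ss ! j, Stay)) [0..<K]))
       else (if ss ! r \<ge> 3 then 2 else 1, map (\<lambda>j. (ss ! j, Stay)) [0..<K]))\<rparr>"

lemma turing_machine_counter_tm:
  assumes "K \<ge> 1" and targets: "\<forall>i\<in>set P. targets_le (length P) i"
  shows "turing_machine (counter_tm K r P)"
proof -
  have "case delta (counter_tm K r P) q ss of (q', acts) \<Rightarrow>
           q' < length P + 4 \<and> length acts = K \<and> (\<forall>(s, d)\<in>set acts. s < 6)"
    if "q < length P + 4" "length ss = K" "\<forall>s\<in>set ss. s < 6" for q ss
  proof (cases "q \<noteq> 0 \<and> q - 3 < length P")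
    case True
    then have "targets_le (length P) (P ! (q - 3))"
      using targets by auto
    then show ?thesis
      using that True by (cases "P ! (q - 3)") (auto simp: counter_tm_def)
  qed (use that in \<open>auto simp: counter_tm_def\<close>)
  then show ?thesis
    unfolding turing_machine_def using \<open>K \<ge> 1\<close> by (simp add: counter_tm_def)
qed

definition content :: "bool list \<Rightarrow> nat \<Rightarrow> int \<Rightarrow> nat" where
  "content x j p = (if j = 0 then fst (input_tape x) p else 0) + (if p = 0 then 3 else 0)"

definition tapes :: "nat \<Rightarrow> bool list \<Rightarrow> (nat \<Rightarrow> nat) \<Rightarrow> tape list" where
  "tapes K x s = map (\<lambda>j. (content x j, int (s j))) [0..<K]"

lemma length_tapes [simp]: "length (tapes K x s) = K"
  by (simp add: tapes_def)

lemma nth_tapes [simp]: "j < K \<Longrightarrow> tapes K x s ! j = (content x j, int (s j))"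
  by (simp add: tapes_def)

lemma content_ge_3_iff: "content x j (int h) \<ge> 3 \<longleftrightarrow> h = 0"
  by (auto simp: content_def input_tape_def)

lemma content_0_ge_3: "content x j 0 \<ge> 3"
  by (simp add: content_def)

lemma content_less_3_iff: "content x j (int h) < 3 \<longleftrightarrow> h > 0"
  using content_ge_3_iff[of x j h] by auto

lemma sym_holds_content: "sym_holds c (content x 0 (int h)) = holds c x h"
  by (cases c) (auto simp: content_def input_tape_def)

text \<open>After the marking step every symbol read is written back, so a step is determined by the
  new state and the head moves \<open>D\<close>.\<close>

lemma tm_step_tapes:
  assumes "K > 0" and "q \<ge> 3"
    and "delta M q (map (\<lambda>j. content x j (int (s j))) [0..<K]) =
           (q', map (\<lambda>j. (content x j (int (s j)), D j)) [0..<K])"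
    and "\<And>j. j < K \<Longrightarrow> int (s j) + offset (D j) = int (s' j)"
  shows "tm_step M (q, tapes K x s) = (q', tapes K x s')"
proof -
  have "map read_tape (tapes K x s) = map (\<lambda>j. content x j (int (s j))) [0..<K]"
    by (simp add: tapes_def)
  then have "tm_step M (q, tapes K x s) =
      (q', map2 act_on_tape (tapes K x s) (map (\<lambda>j. (content x j (int (s j)), D j)) [0..<K]))"
    using assms by (simp add: tm_step.simps)
  also have "map2 act_on_tape (tapes K x s) (map (\<lambda>j. (content x j (int (s j)), D j)) [0..<K])
      = tapes K x s'"
    by (rule nth_equalityI) (use assms in auto)
  finally show ?thesis .
qed

definition code_at :: "instr list \<Rightarrow> nat \<Rightarrow> instr list \<Rightarrow> bool" where
  "code_at P p cs \<longleftrightarrow> (\<forall>i<length cs. p + i < length P \<and> P ! (p + i) = cs ! i)"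

lemma code_at_Cons [simp]:
  "code_at P p (c # cs) \<longleftrightarrow> p < length P \<and> P ! p = c \<and> code_at P (p + 1) cs"
proof
  assume *: "code_at P p (c # cs)"
  have "p + 1 + i < length P \<and> P ! (p + 1 + i) = cs ! i" if "i < length cs" for i
    using *[unfolded code_at_def, rule_format, of "Suc i"] that by simp
  then show "p < length P \<and> P ! p = c \<and> code_at P (p + 1) cs"
    using *[unfolded code_at_def, rule_format, of 0] by (simp add: code_at_def)
next
  assume *: "p < length P \<and> P ! p = c \<and> code_at P (p + 1) cs"
  show "code_at P p (c # cs)"
    unfolding code_at_def
  proof (intro allI impI)
    fix i assume "i < length (c # cs)"
    then show "p + i < length P \<and> P ! (p + i) = (c # cs) ! i"
      using * by (cases i) (auto simp: code_at_def)
  qed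
qed

lemma code_at_append [simp]:
  "code_at P p (cs @ ds) \<longleftrightarrow> code_at P p cs \<and> code_at P (p + length cs) ds"
  by (induction cs arbitrary: p) (auto simp: code_at_def[of P _ "[]"])

lemma funpow_step: "(f :: 'a \<Rightarrow> 'a) a = b \<Longrightarrow> (f ^^ 1) a = b"
  by simp

lemma funpow_trans:
  "(f ^^ m) a = b \<Longrightarrow> (f ^^ n) b = c \<Longrightarrow> (f ^^ (m + n)) a = c"
  by (simp add: funpow_add add.commute[of m n])

lemma compile_correct:
  assumes "exec x c s t s'" and "max_reg c < K" and "code_at P p (compile c p)"
  shows "(tm_step (counter_tm K r P) ^^ t) (p + 3, tapes K x s) = (p + code_size c + 3, tapes K x s')"
  using assms
proof (induction arbitrary: p)
  case (Incr c i s)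
  then have p: "p < length P" "P ! p = Incr_I c i" and "i < K" by simp_all
  have "tm_step (counter_tm K r P) (p + 3, tapes K x s) =
      (p + 3 + 1, tapes K x (if holds c x (s 0) then s(i := s i + 1) else s))"
    by (rule tm_step_tapes[where D = "\<lambda>j. if j = i \<and> holds c x (s 0) then Move_Right else Stay"])
      (use p \<open>i < K\<close> in \<open>auto simp: counter_tm_def sym_holds_content\<close>)
  then show ?case by simp
next
  case (Decr i s)
  then have p: "p < length P" "P ! p = Decr_I i" and "i < K" by simp_all
  have "tm_step (counter_tm K r P) (p + 3, tapes K x s) =
      (p + 3 + 1, tapes K x (s(i := s i - 1)))"
    by (rule tm_step_tapes[where D = "\<lambda>j. if j = i \<and> s j > 0 then Move_Left else Stay"])
      (use p \<open>i < K\<close> in \<open>auto simp: counter_tm_def content_less_3_iff of_nat_diff\<close>)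
  then show ?case by (simp add: fun_upd_def)
next
  case (Seq a s t s' b t' s'')
  have "(tm_step (counter_tm K r P) ^^ t) (p + 3, tapes K x s) = (p + code_size a + 3, tapes K x s')"
    using Seq by simp
  moreover have "(tm_step (counter_tm K r P) ^^ t') (p + code_size a + 3, tapes K x s') =
      (p + code_size a + code_size b + 3, tapes K x s'')"
    using Seq.IH(2)[of "p + code_size a"] Seq.prems by simp
  ultimately show ?case
    by (metis (no_types, lifting) add.assoc code_size.simps(3) funpow_trans)
next
  case (While_end s i a)
  then have p: "p < length P" "P ! p = Jump_Zero i (p + code_size a + 2)" and "i < K" by simp_all
  have "tm_step (counter_tm K r P) (p + 3, tapes K x s) = (p + code_size a + 2 + 3, tapes K x s)"
    by (rule tm_step_tapes[where D = "\<lambda>j. Stay"])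
      (use p \<open>i < K\<close> While_end in \<open>auto simp: counter_tm_def content_0_ge_3\<close>)
  then show ?case by simp
next
  case (While_step s i a t s' t' s'')
  then have p: "p < length P" "P ! p = Jump_Zero i (p + code_size a + 2)" and "i < K"
    and p': "p + 1 + code_size a < length P" "P ! (p + 1 + code_size a) = Goto p" by simp_all
  have 1: "(tm_step (counter_tm K r P) ^^ 1) (p + 3, tapes K x s) = (p + 1 + 3, tapes K x s)"
    by (rule funpow_step, rule tm_step_tapes[where D = "\<lambda>j. Stay"])
      (use p \<open>i < K\<close> While_step in \<open>auto simp: counter_tm_def content_ge_3_iff content_less_3_iff\<close>)
  have 2: "(tm_step (counter_tm K r P) ^^ t) (p + 1 + 3, tapes K x s) = (p + 1 + code_size a + 3, tapes K x s')"
    using While_step.IH(1)[of "p + 1"] While_step.prems by simp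
  have 3: "(tm_step (counter_tm K r P) ^^ 1) (p + 1 + code_size a + 3, tapes K x s') = (p + 3, tapes K x s')"
    by (rule funpow_step, rule tm_step_tapes[where D = "\<lambda>j. Stay"])
      (use p' \<open>i < K\<close> in \<open>auto simp: counter_tm_def\<close>)
  have 4: "(tm_step (counter_tm K r P) ^^ t') (p + 3, tapes K x s') = (p + code_size (While i a) + 3, tapes K x s'')"
    using While_step.IH(2) While_step.prems by simp
  have "1 + (t + (1 + t')) = t + t' + 2" by simp
  then show ?case
    using funpow_trans[OF 1 funpow_trans[OF 2 funpow_trans[OF 3 4]]] by simp
qed

text \<open>An instruction raises a register by at most one. Hence a time bound is also a bound on
  the computed values, which composition of programs relies on.\<close>

lemma exec_reg_le: "exec x c s t s' \<Longrightarrow> s' i \<le> s i + t"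
proof (induction arbitrary: i rule: exec.induct)
  case (Seq a s t s' b t' s'')
  then show ?case using le_trans[OF Seq.IH(2)[of i]] by (metis add.assoc add_le_mono1)
next
  case (While_step s i' a t s' t' s'')
  have "s'' i \<le> s' i + t'" "s' i \<le> s i + t" using While_step.IH by auto
  then show ?case by simp
qed auto

lemma poly_time_computableI:
  assumes "r \<noteq> 0"
    and run: "\<And>x. \<exists>t s'. t \<le> (2 + length x) ^ e \<and> exec x c (\<lambda>_. 0) t s' \<and> (f x \<longleftrightarrow> s' r \<noteq> 0)"
  shows "poly_time_computable f"
proof -
  define P where "P = compile c 0"
  define K where "K = max r (max_reg c) + 1"
  define M where "M = counter_tm K r P"
  have tm: "turing_machine M"
    unfolding M_def
    by (rule turing_machine_counter_tm) (use targets_compile[of _ c 0] in \<open>auto simp: K_def P_def\<close>)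
  have steps: "\<exists>t\<le>(2 + length x) ^ e + 2.
        fst ((tm_step M ^^ t) (initial_config M x)) = (if f x then 1 else 2)" for x
  proof -
    obtain t s' where t: "t \<le> (2 + length x) ^ e" "exec x c (\<lambda>_. 0) t s'" "f x \<longleftrightarrow> s' r \<noteq> 0"
      using run by blast
    have K: "K > 0" "max_reg c < K" "r < K" by (auto simp: K_def)
    have rd: "map read_tape (input_tape x # replicate (K - 1) (\<lambda>_. 0, 0)) =
        (fst (input_tape x) 0) # replicate (K - 1) 0"
      by (simp add: input_tape_def)
    have "tm_step M (initial_config M x) =
      (3, map2 act_on_tape (input_tape x # replicate (K - 1) (\<lambda>_. 0, 0))
        (map (\<lambda>c. (if c < 3 then c + 3 else c, Stay)) ((fst (input_tape x) 0) # replicate (K - 1) 0)))"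
      unfolding initial_config_def M_def using rd by (simp add: counter_tm_def tm_step.simps)
    also have "map2 act_on_tape (input_tape x # replicate (K - 1) (\<lambda>_. 0, 0))
        (map (\<lambda>c. (if c < 3 then c + 3 else c, Stay)) ((fst (input_tape x) 0) # replicate (K - 1) 0))
        = tapes K x (\<lambda>_. 0)"
    proof (rule nth_equalityI, goal_cases)
      case (2 j)
      then show ?case using K
        by (cases j) (auto simp: content_def input_tape_def fun_eq_iff)
    qed (use K in simp)
    finally have 1: "(tm_step M ^^ 1) (initial_config M x) = (0 + 3, tapes K x (\<lambda>_. 0))"
      by simp
    have 2: "(tm_step M ^^ t) (0 + 3, tapes K x (\<lambda>_. 0)) = (0 + code_size c + 3, tapes K x s')"
      unfolding M_def
      by (rule compile_correct[OF t(2)]) (use K in \<open>auto simp: code_at_def P_def\<close>)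
    have 3: "(tm_step M ^^ 1) (0 + code_size c + 3, tapes K x s') = (if f x then 1 else 2, tapes K x s')"
      by (rule funpow_step, rule tm_step_tapes[where D = "\<lambda>j. Stay"])
        (use K t in \<open>auto simp: counter_tm_def M_def P_def content_ge_3_iff\<close>)
    have "1 + (t + 1) \<le> (2 + length x) ^ e + 2" using t by simp
    moreover have "fst ((tm_step M ^^ (1 + (t + 1))) (initial_config M x)) = (if f x then 1 else 2)"
      by (subst funpow_trans[OF 1 funpow_trans[OF 2 3]]) simp
    ultimately show ?thesis by blast
  qed
  \<comment> \<open>\<open>3 ^ e\<close> covers n \<le> 1, where a power of n is of no help; for
    larger n, 2 + n \<le> n^2 accounts for the exponent \<open>2 * e\<close>. The summand 4 covers
    the marking step and the final test.\<close>
  define E where "E = 3 ^ e + 2 * e + 4"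
  have "(2 + n) ^ e + 2 \<le> n ^ E + E" for n :: nat
  proof (cases "n \<le> 1")
    case True
    then have "(2 + n) ^ e \<le> 3 ^ e" by (intro power_mono) auto
    then show ?thesis by (simp add: E_def)
  next
    case False
    then have "2 * 2 \<le> n * 2" "n * 2 \<le> n * n" by (intro mult_le_mono; simp)+
    then have "2 + n \<le> n ^ 2" unfolding power2_eq_square by linarith
    then have "(2 + n) ^ e \<le> (n ^ 2) ^ e" by (intro power_mono) auto
    also have "\<dots> \<le> n ^ E"
      unfolding power_mult[symmetric] by (rule power_increasing) (use False in \<open>auto simp: E_def\<close>)
    finally show ?thesis by (simp add: E_def)
  qed
  then have "decides_within M f (\<lambda>n. n ^ E + E)"
    unfolding decides_within_def using steps by (meson le_trans)
  then show ?thesis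
    unfolding poly_time_computable_def using tm by blast
qed

section \<open>Functions computable in unary polynomial time\<close>

text \<open>For X \<ge> 2 every polynomial is below a single power of X, so sums and constants only
  raise the exponent. This is why the input sizes below carry the summand 2.\<close>

definition poly_bounded :: "(nat \<Rightarrow> nat) \<Rightarrow> bool" where
  "poly_bounded B \<longleftrightarrow> (\<exists>e. \<forall>X\<ge>2. B X \<le> X ^ e)"

lemma poly_bounded_const: "poly_bounded (\<lambda>_. c)"
proof -
  have "c \<le> X ^ c" if "X \<ge> 2" for X
    using less_exp[of c] power_mono[of 2 X c] that by linarith
  then show ?thesis unfolding poly_bounded_def by blast
qed

lemma poly_bounded_id: "poly_bounded (\<lambda>X. X)"
  unfolding poly_bounded_def by (intro exI[of _ 1]) simp

lemma poly_bounded_mult: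
  assumes "poly_bounded A" "poly_bounded B"
  shows "poly_bounded (\<lambda>X. A X * B X)"
proof -
  obtain a b where "\<forall>X\<ge>2. A X \<le> X ^ a" "\<forall>X\<ge>2. B X \<le> X ^ b"
    using assms unfolding poly_bounded_def by blast
  then have "\<forall>X\<ge>2. A X * B X \<le> X ^ (a + b)"
    by (simp add: power_add mult_le_mono)
  then show ?thesis unfolding poly_bounded_def by blast
qed

lemma poly_bounded_add:
  assumes "poly_bounded A" "poly_bounded B"
  shows "poly_bounded (\<lambda>X. A X + B X)"
proof -
  obtain a b where ab: "\<And>X. X \<ge> 2 \<Longrightarrow> A X \<le> X ^ a" "\<And>X. X \<ge> 2 \<Longrightarrow> B X \<le> X ^ b"
    using assms unfolding poly_bounded_def by blast
  have "A X + B X \<le> X ^ (a + b + 1)" if X: "X \<ge> 2" for X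
  proof -
    have "X ^ a \<le> X ^ (a + b)" "X ^ b \<le> X ^ (a + b)"
      by (intro power_increasing; use X in simp)+
    then have "A X + B X \<le> 2 * X ^ (a + b)" using ab[OF X] by linarith
    also have "\<dots> \<le> X * X ^ (a + b)" using X by (intro mult_right_mono) auto
    finally show ?thesis by simp
  qed
  then show ?thesis unfolding poly_bounded_def by blast
qed

lemma poly_bounded_power:
  assumes "poly_bounded A" shows "poly_bounded (\<lambda>X. A X ^ k)"
  by (induction k) (auto intro: poly_bounded_const poly_bounded_mult assms)

lemmas poly_bounded_intros =
  poly_bounded_const poly_bounded_id poly_bounded_mult poly_bounded_add poly_bounded_power

section \<open>Time-bounded runs and simple loops\<close>

definition runs :: "bool list \<Rightarrow> com \<Rightarrow> (nat \<Rightarrow> nat) \<Rightarrow> nat \<Rightarrow> (nat \<Rightarrow> nat) \<Rightarrow> bool" where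
  "runs x c s T s' \<longleftrightarrow> (\<exists>t\<le>T. exec x c s t s')"

lemma runsI: "exec x c s t s' \<Longrightarrow> t \<le> T \<Longrightarrow> runs x c s T s'"
  unfolding runs_def by blast

lemma runs_Incr: "holds c x (s 0) \<Longrightarrow> runs x (Incr c i) s 1 (s(i := s i + 1))"
  using runsI[OF exec.Incr[of x c i s] le_refl] by (simp only: if_True)

lemma runs_Incr_not: "\<not> holds c x (s 0) \<Longrightarrow> runs x (Incr c i) s 1 s"
  using runsI[OF exec.Incr[of x c i s] le_refl] by (simp only: if_False)

lemma runs_Decr: "runs x (Decr i) s 1 (s(i := s i - 1))"
  by (rule runsI[OF exec.Decr le_refl])

lemma runs_Seq:
  assumes "runs x a s T s'" "runs x b s' T' s''"
  shows "runs x (Seq a b) s (T + T') s''"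
proof -
  obtain t t' where "t \<le> T" "exec x a s t s'" "t' \<le> T'" "exec x b s' t' s''"
    using assms unfolding runs_def by blast
  then show ?thesis using runsI[OF exec.Seq] by (meson add_mono)
qed

lemma runs_While_end: "s i = 0 \<Longrightarrow> runs x (While i a) s 1 s"
  by (rule runsI[OF exec.While_end le_refl])

lemma runs_While_step:
  assumes "s i \<noteq> 0" "runs x a s T s'" "runs x (While i a) s' T' s''"
  shows "runs x (While i a) s (T + T' + 2) s''"
proof -
  obtain t t' where "t \<le> T" "exec x a s t s'" "t' \<le> T'" "exec x (While i a) s' t' s''"
    using assms unfolding runs_def by blast
  then show ?thesis using runsI[OF exec.While_step, of s i x a t s' t' s'' "T + T' + 2"] assms(1) by simp
qed

lemma runs_cong: "runs x c s T s' \<Longrightarrow> s' = s'' \<Longrightarrow> T \<le> T' \<Longrightarrow> runs x c s T' s''"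
  unfolding runs_def by (meson le_trans)

text \<open>\<open>S j\<close> is the state after j rounds. Supplying the whole trajectory reduces a
  loop to the verification of one round; the induction is on the number of rounds that
  remain.\<close>

lemma runs_While_iterate:
  assumes "\<And>j. j < m \<Longrightarrow> S j i \<noteq> 0 \<and> runs x a (S j) T (S (Suc j))" and "S m i = 0"
  shows "runs x (While i a) (S 0) (m * (T + 2) + 1) (S m)"
proof -
  have "runs x (While i a) (S (m - j)) (j * (T + 2) + 1) (S m)" if "j \<le> m" for j
    using that
  proof (induction j)
    case 0
    then show ?case using runs_While_end[of "S m" i] assms(2) by simp
  next
    case (Suc j)
    have **: "Suc (m - Suc j) = m - j" using Suc by simp
    have *: "runs x a (S (m - Suc j)) T (S (m - j))" "S (m - Suc j) i \<noteq> 0"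
      using assms(1)[of "m - Suc j"] Suc ** by auto
    have "j \<le> m" using Suc by simp
    show ?case
      by (rule runs_cong[OF runs_While_step[OF *(2,1) Suc.IH[OF \<open>j \<le> m\<close>]]]) auto
  qed
  from this[of m] show ?thesis by simp
qed

lemma runs_clear: "runs x (While i (Decr i)) s (3 * s i + 1) (s(i := 0))"
proof -
  have "runs x (While i (Decr i)) (s(i := s i - 0)) (s i * (1 + 2) + 1) (s(i := s i - s i))"
    by (rule runs_While_iterate[where S = "\<lambda>j. s(i := s i - j)"])
      (auto intro!: runs_cong[OF runs_Decr] simp: fun_eq_iff)
  moreover have "s(i := s i - 0) = s" by simp
  ultimately have "runs x (While i (Decr i)) s (s i * (1 + 2) + 1) (s(i := s i - s i))"
    by (simp only:)
  then show ?thesis by (rule runs_cong) auto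
qed

definition move :: "nat \<Rightarrow> nat \<Rightarrow> com" where
  "move i j = While i (Seq (Decr i) (Incr Always j))"

lemma runs_move:
  assumes "i \<noteq> j" shows "runs x (move i j) s (4 * s i + 1) (s(i := 0, j := s j + s i))"
proof -
  let ?S = "\<lambda>k. s(i := s i - k, j := s j + k)"
  have "runs x (move i j) (?S 0) (s i * (2 + 2) + 1) (?S (s i))"
    unfolding move_def
  proof (rule runs_While_iterate[where S = ?S])
    fix k assume "k < s i"
    have "runs x (Seq (Decr i) (Incr Always j)) (?S k) (1 + 1) (?S (Suc k))"
      by (rule runs_cong[OF runs_Seq[OF runs_Decr runs_Incr]]) (use assms in \<open>auto simp: fun_eq_iff\<close>)
    then show "?S k i \<noteq> 0 \<and> runs x (Seq (Decr i) (Incr Always j)) (?S k) 2 (?S (Suc k))"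
      using \<open>k < s i\<close> assms by (simp add: numeral_2_eq_2)
  qed (use assms in simp)
  moreover have "?S 0 = s" using assms by auto
  ultimately have "runs x (move i j) s (s i * (2 + 2) + 1) (?S (s i))"
    by (simp only:)
  then show ?thesis by (rule runs_cong) auto
qed

text \<open>A program for \<open>F\<close> reads its arguments from the registers \<open>as\<close>, which need not be distinct, and
  writes its result to register \<open>d\<close>, which must be zero before; the registers from \<open>b\<close> on are scratch
  space, zero before and after. Register 0 is the head of the input tape, at rest on cell 0.\<close>

definition implements ::
  "com \<Rightarrow> (bool list \<Rightarrow> nat list \<Rightarrow> nat) \<Rightarrow> nat list \<Rightarrow> nat \<Rightarrow> nat \<Rightarrow> nat \<Rightarrow> bool" where
  "implements c F as d b e \<longleftrightarrow>
     (\<forall>x s. s 0 = 0 \<and> s d = 0 \<and> (\<forall>i\<ge>b. s i = 0) \<longrightarrow>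
        runs x c s ((2 + length x + sum_list (map s as)) ^ e) (s(d := F x (map s as))))"

definition regs_ok :: "nat list \<Rightarrow> nat \<Rightarrow> nat \<Rightarrow> bool" where
  "regs_ok as d b \<longleftrightarrow> d \<notin> set as \<and> 0 \<notin> set as \<and> d \<noteq> 0 \<and> (\<forall>i\<in>set as. i < b) \<and> d < b"

text \<open>The program may depend on the placement of the registers, but the exponent
  \<open>e\<close> may not: programs are relocated freely when they are combined, and their time
  bound must survive this.\<close>

definition unary_computable :: "nat \<Rightarrow> (bool list \<Rightarrow> nat list \<Rightarrow> nat) \<Rightarrow> bool" where
  "unary_computable a F \<longleftrightarrow>
     (\<exists>e. \<forall>as d b. length as = a \<and> regs_ok as d b \<longrightarrow> (\<exists>c. implements c F as d b e))"

lemma unary_computableI: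
  assumes "poly_bounded B"
    and "\<And>as d b. length as = a \<Longrightarrow> regs_ok as d b \<Longrightarrow>
      \<exists>c. \<forall>x s. s 0 = 0 \<longrightarrow> s d = 0 \<longrightarrow> (\<forall>i\<ge>b. s i = 0) \<longrightarrow>
        runs x c s (B (2 + length x + sum_list (map s as))) (s(d := F x (map s as)))"
  shows "unary_computable a F"
proof -
  obtain e where e: "\<And>X. X \<ge> 2 \<Longrightarrow> B X \<le> X ^ e"
    using assms(1) unfolding poly_bounded_def by blast
  have "\<exists>c. implements c F as d b e" if ok: "length as = a" "regs_ok as d b" for as d b
  proof -
    obtain c where c: "\<And>x s. s 0 = 0 \<Longrightarrow> s d = 0 \<Longrightarrow> (\<forall>i\<ge>b. s i = 0) \<Longrightarrow>
        runs x c s (B (2 + length x + sum_list (map s as))) (s(d := F x (map s as)))"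
      using assms(2)[OF ok] by blast
    have "implements c F as d b e"
      unfolding implements_def by (intro allI impI runs_cong[OF c]) (auto intro: e)
    then show ?thesis by blast
  qed
  then show ?thesis unfolding unary_computable_def by blast
qed

text \<open>The result register starts at 0 and ends with the value, so the running time bounds the
  value by \<open>exec_reg_le\<close>.\<close>

lemma implements_value_le:
  assumes "implements c F as d b e" and "regs_ok as d b" and "length v = length as"
    and "distinct as"
  shows "F x v \<le> (2 + length x + sum_list v) ^ e"
proof -
  \<comment> \<open>The state that holds \<open>v\<close> in the argument registers and 0 everywhere
    else.\<close>
  define s where "s = (\<lambda>i. case map_of (zip as v) i of None \<Rightarrow> 0 | Some y \<Rightarrow> y)"
  have s: "map s as = v"
    by (rule nth_equalityI) (use assms in \<open>auto simp: s_def map_of_zip_nth\<close>)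
  have "s i = 0" if "i \<notin> set as" for i
    using that assms(3) by (simp add: s_def map_of_zip_is_None[THEN iffD2] split: option.split)
  then have "s 0 = 0" "s d = 0" "\<forall>i\<ge>b. s i = 0"
    using assms(2) unfolding regs_ok_def by (auto, metis leD)
  then have "runs x c s ((2 + length x + sum_list v) ^ e) (s(d := F x v))"
    using assms(1) s unfolding implements_def by metis
  then obtain t where "t \<le> (2 + length x + sum_list v) ^ e" "exec x c s t (s(d := F x v))"
    unfolding runs_def by blast
  with exec_reg_le[OF this(2), of d] \<open>s d = 0\<close> show ?thesis by simp
qed

lemma unary_computableE:
  assumes "unary_computable a F"
  obtains e where "\<And>as d b. length as = a \<Longrightarrow> regs_ok as d b \<Longrightarrow> \<exists>c. implements c F as d b e"
    and "\<And>x v. length v = a \<Longrightarrow> F x v \<le> (2 + length x + sum_list v) ^ e"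
proof -
  obtain e where e: "\<And>as d b. length as = a \<Longrightarrow> regs_ok as d b \<Longrightarrow> \<exists>c. implements c F as d b e"
    using assms unfolding unary_computable_def by blast
  have ok: "regs_ok [2..<a + 2] 1 (a + 2)" by (auto simp: regs_ok_def)
  have len: "length [2..<a + 2] = a" by (simp del: upt_Suc)
  from e[OF len ok] obtain c where "implements c F [2..<a + 2] 1 (a + 2) e" by blast
  from implements_value_le[OF this ok] have "F x v \<le> (2 + length x + sum_list v) ^ e"
    if "length v = a" for x v using that len by (metis distinct_upt)
  with e show ?thesis by (rule that)
qed

lemma unary_computable_bound:
  assumes "unary_computable a F"
  obtains e where "\<And>x v. length v = a \<Longrightarrow> F x v \<le> (2 + length x + sum_list v) ^ e"
  using unary_computableE[OF assms] by metis

lemma unary_cong: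
  assumes "unary_computable a F" and "\<And>x v. length v = a \<Longrightarrow> F x v = G x v"
  shows "unary_computable a G"
proof -
  have "implements c F as d b e = implements c G as d b e" if "length as = a" for c as d b e
    unfolding implements_def using assms(2) that by simp
  then show ?thesis using assms(1) unfolding unary_computable_def by metis
qed

section \<open>Basic functions and bounded recursion\<close>

lemma unary_0: "unary_computable a (\<lambda>x v. 0)"
proof (rule unary_computableI[where B = "\<lambda>X. 1"])
  fix as :: "nat list" and d b
  have "runs x (Decr d) s 1 (s(d := 0))" if "s d = 0" for x s
    by (rule runs_cong[OF runs_Decr]) (use that in auto)
  then show "\<exists>c. \<forall>x s. s 0 = 0 \<longrightarrow> s d = 0 \<longrightarrow> (\<forall>i\<ge>b. s i = 0) \<longrightarrow>
        runs x c s 1 (s(d := 0))" by blast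
qed (rule poly_bounded_intros)

lemma unary_Suc:
  assumes "unary_computable a F" shows "unary_computable a (\<lambda>x v. Suc (F x v))"
proof -
  obtain e where e: "\<And>as d b. length as = a \<Longrightarrow> regs_ok as d b \<Longrightarrow> \<exists>c. implements c F as d b e"
    using unary_computableE[OF assms] by metis
  show ?thesis
  proof (rule unary_computableI[where B = "\<lambda>X. X ^ e + 1"])
    fix as d b assume "length as = a" "regs_ok as d b"
    then obtain c where c: "implements c F as d b e" using e by blast
    have "runs x (Seq c (Incr Always d)) s ((2 + length x + sum_list (map s as)) ^ e + 1)
        (s(d := Suc (F x (map s as))))" if "s 0 = 0" "s d = 0" "\<forall>i\<ge>b. s i = 0" for x s
      by (rule runs_Seq[OF _ runs_cong[OF runs_Incr]])
        (use c that in \<open>auto simp: implements_def\<close>)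
    then show "\<exists>c. \<forall>x s. s 0 = 0 \<longrightarrow> s d = 0 \<longrightarrow> (\<forall>i\<ge>b. s i = 0) \<longrightarrow>
        runs x c s ((2 + length x + sum_list (map s as)) ^ e + 1) (s(d := Suc (F x (map s as))))"
      by blast
  qed (intro poly_bounded_intros)
qed

text \<open>Reading a register empties it, so the argument is moved to the scratch register
  \<open>b\<close> and then counted back into its own register and \<open>d\<close> at once.\<close>

lemma unary_nth:
  assumes "i < a" shows "unary_computable a (\<lambda>x v. v ! i)"
proof (rule unary_computableI[where B = "\<lambda>X. 10 * X"])
  fix as d b assume as: "length as = a" "regs_ok as d b"
  define r where "r = as ! i"
  have r: "r \<in> set as" using as assms by (simp add: r_def)
  then have ne: "r \<noteq> d" "r < b" "d < b" using as by (auto simp: regs_ok_def)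
  let ?c = "Seq (move r b) (While b (Seq (Decr b) (Seq (Incr Always r) (Incr Always d))))"
  have "runs x ?c s (10 * (2 + length x + sum_list (map s as))) (s(d := map s as ! i))"
    if s: "s d = 0" "\<forall>i\<ge>b. s i = 0" for x s
  proof -
    let ?S = "\<lambda>k. s(b := s r - k, r := k, d := k)"
    have "runs x (While b (Seq (Decr b) (Seq (Incr Always r) (Incr Always d)))) (?S 0)
        (s r * (3 + 2) + 1) (?S (s r))"
    proof (rule runs_While_iterate[where S = ?S])
      fix k assume "k < s r"
      have "runs x (Seq (Decr b) (Seq (Incr Always r) (Incr Always d))) (?S k) (1 + (1 + 1)) (?S (Suc k))"
        by (rule runs_cong[OF runs_Seq[OF runs_Decr runs_Seq[OF runs_Incr runs_Incr]]])
          (use ne in \<open>auto simp: fun_eq_iff\<close>)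
      then show "?S k b \<noteq> 0 \<and> runs x (Seq (Decr b) (Seq (Incr Always r) (Incr Always d))) (?S k) 3 (?S (Suc k))"
        using \<open>k < s r\<close> ne by (simp add: numeral_3_eq_3)
    qed (use ne in simp)
    moreover have "runs x (move r b) s (4 * s r + 1) (?S 0)"
      by (rule runs_cong[OF runs_move]) (use ne s in \<open>auto simp: fun_eq_iff\<close>)
    ultimately have "runs x ?c s (4 * s r + 1 + (s r * (3 + 2) + 1)) (?S (s r))"
      by (intro runs_Seq)
    moreover have "s r \<le> sum_list (map s as)" using r by (intro member_le_sum_list) auto
    moreover have "?S (s r) = s(d := map s as ! i)"
      using ne s as assms by (auto simp: fun_eq_iff r_def)
    ultimately show ?thesis by (elim runs_cong) auto
  qed
  then show "\<exists>c. \<forall>x s. s 0 = 0 \<longrightarrow> s d = 0 \<longrightarrow> (\<forall>i\<ge>b. s i = 0) \<longrightarrow>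
      runs x c s (10 * (2 + length x + sum_list (map s as))) (s(d := map s as ! i))" by blast
qed (intro poly_bounded_intros)

text \<open>The head itself is the loop counter: register \<open>b\<close> is a flag, set afresh at
  each cell, that tells whether the head still scans an input bit. At the end the head returns to
  cell 0.\<close>

lemma unary_length: "unary_computable a (\<lambda>x v. length x)"
proof (rule unary_computableI[where B = "\<lambda>X. 10 * X"])
  fix as d b assume as: "length as = a" "regs_ok as d b"
  then have ne: "d \<noteq> 0" "d < b" by (auto simp: regs_ok_def)
  let ?l = "Seq (Decr b) (Seq (Incr Always 0) (Seq (Incr Always d) (Incr In_Range b)))"
  let ?c = "Seq (Incr In_Range b) (Seq (While b ?l) (While 0 (Decr 0)))"
  have "runs x ?c s (10 * (2 + length x + sum_list (map s as))) (s(d := length x))"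
    if s: "s 0 = 0" "s d = 0" "\<forall>i\<ge>b. s i = 0" for x s
  proof -
    let ?S = "\<lambda>k. s(b := if k < length x then 1 else 0, 0 := k, d := k)"
    have tst: "runs x (Incr In_Range b) (s(0 := k, d := k)) 1 (?S k)" for k
    proof (cases "k < length x")
      case True
      then show ?thesis
        by (intro runs_cong[OF runs_Incr]) (use s ne in \<open>auto simp: fun_eq_iff\<close>)
    next
      case False
      then show ?thesis
        by (intro runs_cong[OF runs_Incr_not]) (use s ne in \<open>auto simp: fun_eq_iff\<close>)
    qed
    have "runs x (While b ?l) (?S 0) (length x * (4 + 2) + 1) (?S (length x))"
    proof (rule runs_While_iterate[where S = ?S])
      fix k assume k: "k < length x"
      have a: "runs x (Decr b) (?S k) 1 (s(0 := k, d := k))"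
        by (rule runs_cong[OF runs_Decr]) (use ne s k in \<open>auto simp: fun_eq_iff\<close>)
      have b: "runs x (Incr Always 0) (s(0 := k, d := k)) 1 (s(0 := Suc k, d := k))"
        by (rule runs_cong[OF runs_Incr]) (use ne s k in \<open>auto simp: fun_eq_iff\<close>)
      have c: "runs x (Incr Always d) (s(0 := Suc k, d := k)) 1 (s(0 := Suc k, d := Suc k))"
        by (rule runs_cong[OF runs_Incr]) (use ne s k in \<open>auto simp: fun_eq_iff\<close>)
      have "runs x ?l (?S k) (1 + (1 + (1 + 1))) (?S (Suc k))"
        by (rule runs_Seq[OF a runs_Seq[OF b runs_Seq[OF c tst]]])
      then have "runs x ?l (?S k) 4 (?S (Suc k))" by (rule runs_cong) auto
      moreover have "?S k b \<noteq> 0" using k ne by simp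
      ultimately show "?S k b \<noteq> 0 \<and> runs x ?l (?S k) 4 (?S (Suc k))" by blast
    qed (use ne in simp)
    moreover have "runs x (While 0 (Decr 0)) (?S (length x)) (3 * length x + 1) (s(d := length x))"
      by (rule runs_cong[OF runs_clear]) (use ne s in \<open>auto simp: fun_eq_iff\<close>)
    moreover have "runs x (Incr In_Range b) s 1 (?S 0)"
    proof -
      have "s(0 := 0, d := 0) = s" using s by auto
      then show ?thesis using tst[of 0] by simp
    qed
    ultimately have "runs x ?c s (1 + ((length x * (4 + 2) + 1) + (3 * length x + 1))) (s(d := length x))"
      by (intro runs_Seq)
    then show ?thesis by (rule runs_cong) auto
  qed
  then show "\<exists>c. \<forall>x s. s 0 = 0 \<longrightarrow> s d = 0 \<longrightarrow> (\<forall>i\<ge>b. s i = 0) \<longrightarrow>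
      runs x c s (10 * (2 + length x + sum_list (map s as))) (s(d := length x))" by blast
qed (intro poly_bounded_intros)

definition bit_at :: "bool list \<Rightarrow> nat \<Rightarrow> nat" where
  "bit_at x i = (if i < length x \<and> x ! i then 1 else 0)"

text \<open>Moving the computed index into register 0 places the head on the wanted cell; one
  conditional increment reads it, and clearing register 0 brings the head home.\<close>

lemma unary_bit:
  assumes "unary_computable a F" shows "unary_computable a (\<lambda>x v. bit_at x (F x v))"
proof -
  obtain e where e: "\<And>as d b. length as = a \<Longrightarrow> regs_ok as d b \<Longrightarrow> \<exists>c. implements c F as d b e"
    and val: "\<And>x v. length v = a \<Longrightarrow> F x v \<le> (2 + length x + sum_list v) ^ e"
    using unary_computableE[OF assms] by metis
  show ?thesis
  proof (rule unary_computableI[where B = "\<lambda>X. X ^ e + (4 * X ^ e + 1 + (1 + (3 * X ^ e + 1)))"])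
    fix as d b assume as: "length as = a" and ok: "regs_ok as d b"
    then have ne: "d \<noteq> 0" "d < b" and ok': "regs_ok as b (Suc b)" by (auto simp: regs_ok_def)
    obtain c where c: "implements c F as b (Suc b) e" using e[OF as ok'] by blast
    let ?c = "Seq c (Seq (move b 0) (Seq (Incr Bit_Set d) (While 0 (Decr 0))))"
    have "runs x ?c s (X ^ e + (4 * X ^ e + 1 + (1 + (3 * X ^ e + 1)))) (s(d := bit_at x (F x (map s as))))"
      if s: "s 0 = 0" "s d = 0" "\<forall>i\<ge>b. s i = 0" and X: "X = 2 + length x + sum_list (map s as)" for x s X
    proof -
      let ?y = "F x (map s as)"
      have y: "?y \<le> X ^ e" using val as X by simp
      have 1: "runs x c s (X ^ e) (s(b := ?y))" using c s X unfolding implements_def by simp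
      have 2: "runs x (move b 0) (s(b := ?y)) (4 * X ^ e + 1) (s(0 := ?y))"
        by (rule runs_cong[OF runs_move]) (use ne s y in \<open>auto simp: fun_eq_iff\<close>)
      have 3: "runs x (Incr Bit_Set d) (s(0 := ?y)) 1 (s(0 := ?y, d := bit_at x ?y))"
      proof (cases "?y < length x \<and> x ! ?y")
        case True
        then show ?thesis
          by (intro runs_cong[OF runs_Incr]) (use s ne in \<open>auto simp: fun_eq_iff bit_at_def\<close>)
      next
        case False
        then show ?thesis
          by (intro runs_cong[OF runs_Incr_not]) (use s ne in \<open>auto simp: fun_eq_iff bit_at_def\<close>)
      qed
      have 4: "runs x (While 0 (Decr 0)) (s(0 := ?y, d := bit_at x ?y)) (3 * X ^ e + 1) (s(d := bit_at x ?y))"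
        by (rule runs_cong[OF runs_clear]) (use ne s y in \<open>auto simp: fun_eq_iff\<close>)
      show ?thesis by (rule runs_Seq[OF 1 runs_Seq[OF 2 runs_Seq[OF 3 4]]])
    qed
    then show "\<exists>c. \<forall>x s. s 0 = 0 \<longrightarrow> s d = 0 \<longrightarrow> (\<forall>i\<ge>b. s i = 0) \<longrightarrow>
        runs x c s ((2 + length x + sum_list (map s as)) ^ e +
          (4 * (2 + length x + sum_list (map s as)) ^ e + 1 +
            (1 + (3 * (2 + length x + sum_list (map s as)) ^ e + 1))))
          (s(d := bit_at x (F x (map s as))))"
      by blast
  qed (intro poly_bounded_intros)
qed

text \<open>Argument registers may repeat, so a permuted, shortened or duplicated argument list only
  changes the register names; no values are copied.\<close>

lemma unary_rename:
  assumes "unary_computable (length ks) F" and "\<And>i. i \<in> set ks \<Longrightarrow> i < a"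
  shows "unary_computable a (\<lambda>x v. F x (map ((!) v) ks))"
proof -
  obtain e where e: "\<And>as d b. length as = length ks \<Longrightarrow> regs_ok as d b \<Longrightarrow> \<exists>c. implements c F as d b e"
    using unary_computableE[OF assms(1)] by metis
  show ?thesis
  proof (rule unary_computableI[where B = "\<lambda>X. (X + length ks * X) ^ e"])
    fix as d b assume as: "length as = a" and ok: "regs_ok as d b"
    let ?as = "map ((!) as) ks"
    have "set ?as \<subseteq> set as" using assms(2) as by auto
    then have "regs_ok ?as d b" using ok unfolding regs_ok_def by blast
    then obtain c where c: "implements c F ?as d b e" using e[of ?as d b] by auto
    have "runs x c s ((X + length ks * X) ^ e) (s(d := F x (map ((!) (map s as)) ks)))"
      if s: "s 0 = 0" "s d = 0" "\<forall>i\<ge>b. s i = 0" and X: "X = 2 + length x + sum_list (map s as)" for x s X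
    proof -
      have eq: "map s ?as = map ((!) (map s as)) ks" using assms(2) as by auto
      have "sum_list (map s ?as) \<le> sum_list (map (\<lambda>_. X) ks)"
        unfolding map_map
      proof (rule sum_list_mono)
        fix i assume "i \<in> set ks"
        then have "as ! i \<in> set as" using assms(2) as by auto
        then have "s (as ! i) \<le> sum_list (map s as)" by (intro member_le_sum_list) auto
        then show "(s \<circ> (!) as) i \<le> X" using X by simp
      qed
      then have "2 + length x + sum_list (map s ?as) \<le> X + length ks * X"
        using X by (simp add: sum_list_triv)
      then have "(2 + length x + sum_list (map s ?as)) ^ e \<le> (X + length ks * X) ^ e"
        by (rule power_mono) simp
      moreover have "runs x c s ((2 + length x + sum_list (map s ?as)) ^ e) (s(d := F x (map s ?as)))"
        using c s unfolding implements_def by blast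
      ultimately show ?thesis unfolding eq by (elim runs_cong) auto
    qed
    then show "\<exists>c. \<forall>x s. s 0 = 0 \<longrightarrow> s d = 0 \<longrightarrow> (\<forall>i\<ge>b. s i = 0) \<longrightarrow>
        runs x c s ((2 + length x + sum_list (map s as) + length ks * (2 + length x + sum_list (map s as))) ^ e)
          (s(d := F x (map ((!) (map s as)) ks)))"
      by blast
  qed (intro poly_bounded_intros)
qed

text \<open>Unrestricted primitive recursion would leave polynomial time. Keeping every iterate up
  to \<open>G\<close> below a fixed power of the size keeps it inside. The separate name
  \<open>R\<close> lets this bound be proved for a closed form of the recursion.\<close>

lemma unary_rec:
  fixes R :: "bool list \<Rightarrow> nat list \<Rightarrow> nat \<Rightarrow> nat"
  assumes F: "unary_computable a F" and G: "unary_computable a G" and H: "unary_computable (a + 2) H"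
    and R_def: "\<And>x v i. length v = a \<Longrightarrow> R x v i = rec_nat (F x v) (\<lambda>i y. H x (i # y # v)) i"
    and bound: "\<And>x v i. length v = a \<Longrightarrow> i \<le> G x v \<Longrightarrow> R x v i \<le> (2 + length x + sum_list v) ^ e"
  shows "unary_computable a (\<lambda>x v. R x v (G x v))"
proof -
  have R_0: "R x v 0 = F x v" and R_Suc: "R x v (Suc i) = H x (i # R x v i # v)"
    if "length v = a" for x v i using that by (simp_all add: R_def)
  obtain f where f: "\<And>as d b. length as = a \<Longrightarrow> regs_ok as d b \<Longrightarrow> \<exists>c. implements c F as d b f"
    using unary_computableE[OF F] by metis
  obtain g where g: "\<And>as d b. length as = a \<Longrightarrow> regs_ok as d b \<Longrightarrow> \<exists>c. implements c G as d b g"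
    and G_le: "\<And>x v. length v = a \<Longrightarrow> G x v \<le> (2 + length x + sum_list v) ^ g"
    using unary_computableE[OF G] by metis
  obtain h where h: "\<And>as d b. length as = a + 2 \<Longrightarrow> regs_ok as d b \<Longrightarrow> \<exists>c. implements c H as d b h"
    using unary_computableE[OF H] by metis
  \<comment> \<open>\<open>T\<close> bounds one round: the call of \<open>H\<close> has arguments of
    total size at most \<open>X + X ^ g + X ^ e\<close> (with the old arguments, the index and the
    accumulator), and the rest replaces the accumulator. \<open>B\<close> adds the calls of
    \<open>G\<close> and \<open>F\<close> and the final cleaning.\<close>
  define T where "T = (\<lambda>X::nat. 1 + ((X + X ^ g + X ^ e) ^ h + (3 * X ^ e + 1 + (4 * X ^ e + 1 + 1))))"
  define B where "B = (\<lambda>X::nat. X ^ g + (X ^ f + (X ^ g * (T X + 2) + 1 + (3 * X ^ g + 1 + (4 * X ^ e + 1)))))"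
  show ?thesis
  proof (rule unary_computableI[where B = B])
    show "poly_bounded B" unfolding B_def T_def by (intro poly_bounded_intros)
  next
    fix as d b assume as: "length as = a" and ok: "regs_ok as d b"
    define cnt i acc tmp b' where "cnt = b" "i = Suc b" "acc = Suc (Suc b)" "tmp = Suc (Suc (Suc b))"
      "b' = Suc (Suc (Suc (Suc b)))"
    note r_defs = this
    have ne: "d \<noteq> 0" "d < b" "\<And>j. j \<in> set as \<Longrightarrow> j < b \<and> j \<noteq> d \<and> j \<noteq> 0"
      using ok unfolding regs_ok_def by metis+
    obtain cF where cF: "implements cF F as acc b' f"
      using f[OF as, of acc b'] ne by (fastforce simp: regs_ok_def r_defs)
    obtain cG where cG: "implements cG G as cnt b' g"
      using g[OF as, of cnt b'] ne by (fastforce simp: regs_ok_def r_defs)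
    obtain cH where cH: "implements cH H (i # acc # as) tmp b' h"
      using h[of "i # acc # as" tmp b'] as ne by (fastforce simp: regs_ok_def r_defs)
    let ?body = "Seq (Decr cnt) (Seq cH (Seq (While acc (Decr acc)) (Seq (move tmp acc) (Incr Always i))))"
    let ?c = "Seq cG (Seq cF (Seq (While cnt ?body) (Seq (While i (Decr i)) (move acc d))))"
    have "runs x ?c s (B X) (s(d := R x (map s as) (G x (map s as))))"
      if s: "s 0 = 0" "s d = 0" "\<forall>i\<ge>b. s i = 0" and X: "X = 2 + length x + sum_list (map s as)" for x s X
    proof -
      define v where "v = map s as"
      have v: "length v = a" by (simp add: v_def as)
      define n where "n = G x v"
      have n: "n \<le> X ^ g" using G_le[OF v, of x] X by (simp add: n_def v_def)
      have R_le: "j \<le> n \<Longrightarrow> R x v j \<le> X ^ e" for j using bound[OF v, of j x] X by (simp add: n_def v_def)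
      have s0: "s cnt = 0" "s i = 0" "s acc = 0" "s tmp = 0" "\<And>j. j \<ge> b' \<Longrightarrow> s j = 0"
        using s by (auto simp: r_defs)
      have ne': "cnt \<noteq> i" "cnt \<noteq> acc" "cnt \<noteq> tmp" "i \<noteq> acc" "i \<noteq> tmp" "acc \<noteq> tmp" "cnt \<noteq> d" "i \<noteq> d" "acc \<noteq> d"
        "tmp \<noteq> d" "cnt \<noteq> 0" "i \<noteq> 0" "acc \<noteq> 0" "tmp \<noteq> 0" "cnt < b'" "i < b'" "acc < b'" "tmp < b'"
        using ne by (auto simp: r_defs)
      have fresh: "cnt \<notin> set as" "i \<notin> set as" "acc \<notin> set as" "tmp \<notin> set as"
        using ne(3) by (auto simp: r_defs dest: less_SucI)
      have map_s: "map (s(cnt := p, i := q, acc := r)) as = v" for p q r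
        using fresh by (auto simp: v_def)
      let ?S = "\<lambda>j. s(cnt := n - j, i := j, acc := R x v j)"
      have 1: "runs x cG s (X ^ g) (s(cnt := n))"
        using cG s s0 X unfolding implements_def by (simp add: n_def v_def)
      have map_s': "map (s(cnt := n)) as = v" using fresh by (auto simp: v_def)
      have 2: "runs x cF (s(cnt := n)) (X ^ f) (?S 0)"
      proof -
        have "(s(cnt := n)) 0 = 0 \<and> (s(cnt := n)) acc = 0 \<and> (\<forall>i\<ge>b'. (s(cnt := n)) i = 0)"
          using s s0 ne' by auto
        then have "runs x cF (s(cnt := n)) ((2 + length x + sum_list v) ^ f) ((s(cnt := n))(acc := F x v))"
          using cF unfolding implements_def map_s'[symmetric] by blast
        moreover have "(s(cnt := n))(acc := F x v) = ?S 0"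
          using ne' s0 v by (auto simp: fun_eq_iff R_0)
        ultimately show ?thesis using X by (simp add: v_def)
      qed
      have 3: "runs x (While cnt ?body) (?S 0) (n * (T X + 2) + 1) (?S n)"
      proof (rule runs_While_iterate[where S = ?S])
        fix j assume j: "j < n"
        let ?s = "s(cnt := n - Suc j, i := j, acc := R x v j)"
        have a1: "runs x (Decr cnt) (?S j) 1 ?s"
          by (rule runs_cong[OF runs_Decr]) (use ne' j in \<open>auto simp: fun_eq_iff\<close>)
        have a2: "runs x cH ?s ((X + X ^ g + X ^ e) ^ h) (?s(tmp := R x v (Suc j)))"
        proof -
          have m: "map ?s (i # acc # as) = j # R x v j # v"
            using map_s[of "n - Suc j" j "R x v j"] ne' by simp
          have "?s 0 = 0 \<and> ?s tmp = 0 \<and> (\<forall>i\<ge>b'. ?s i = 0)"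
            using s s0 ne' by auto
          then have "runs x cH ?s ((2 + length x + sum_list (map ?s (i # acc # as))) ^ h)
              (?s(tmp := H x (map ?s (i # acc # as))))"
            using cH unfolding implements_def by blast
          then have "runs x cH ?s ((2 + length x + sum_list (j # R x v j # v)) ^ h) (?s(tmp := R x v (Suc j)))"
            unfolding m R_Suc[OF v] .
          then show ?thesis
            by (rule runs_cong) (use X n j R_le[of j] in \<open>auto simp: v_def intro!: power_mono\<close>)
        qed
        have a3: "runs x (While acc (Decr acc)) (?s(tmp := R x v (Suc j))) (3 * X ^ e + 1)
            (?s(tmp := R x v (Suc j), acc := 0))"
          by (rule runs_cong[OF runs_clear]) (use ne' j R_le[of j] in \<open>auto simp: fun_eq_iff\<close>)
        have a4: "runs x (move tmp acc) (?s(tmp := R x v (Suc j), acc := 0)) (4 * X ^ e + 1)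
            (?s(acc := R x v (Suc j)))"
          by (rule runs_cong[OF runs_move]) (use ne' j s0 R_le[of "Suc j"] in \<open>auto simp: fun_eq_iff\<close>)
        have a5: "runs x (Incr Always i) (?s(acc := R x v (Suc j))) 1 (?S (Suc j))"
          by (rule runs_cong[OF runs_Incr]) (use ne' in \<open>auto simp: fun_eq_iff\<close>)
        have "runs x ?body (?S j) (T X) (?S (Suc j))"
          unfolding T_def by (rule runs_Seq[OF a1 runs_Seq[OF a2 runs_Seq[OF a3 runs_Seq[OF a4 a5]]]])
        then show "?S j cnt \<noteq> 0 \<and> runs x ?body (?S j) (T X) (?S (Suc j))"
          using j ne' by simp
      qed (use ne' in simp)
      have 3: "runs x (While cnt ?body) (?S 0) (X ^ g * (T X + 2) + 1) (?S n)"
        by (rule runs_cong[OF 3]) (use n in \<open>auto intro!: add_mono mult_right_mono simp del: mult_Suc_right\<close>)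
      have 4: "runs x (While i (Decr i)) (?S n) (3 * X ^ g + 1) (s(acc := R x v n))"
        by (rule runs_cong[OF runs_clear]) (use ne' n s0 in \<open>auto simp: fun_eq_iff\<close>)
      have 5: "runs x (move acc d) (s(acc := R x v n)) (4 * X ^ e + 1) (s(d := R x v n))"
        by (rule runs_cong[OF runs_move]) (use ne' n s s0 R_le[of n] in \<open>auto simp: fun_eq_iff\<close>)
      show ?thesis unfolding B_def
        using runs_Seq[OF 1 runs_Seq[OF 2 runs_Seq[OF 3 runs_Seq[OF 4 5]]]] by (simp add: n_def v_def)
    qed
    then show "\<exists>c. \<forall>x s. s 0 = 0 \<longrightarrow> s d = 0 \<longrightarrow> (\<forall>i\<ge>b. s i = 0) \<longrightarrow>
        runs x c s (B (2 + length x + sum_list (map s as))) (s(d := R x (map s as) (G x (map s as))))"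
      by blast
  qed
qed

lemma poly_time_computable_unary:
  assumes "unary_computable 0 F"
  shows "poly_time_computable (\<lambda>x. F x [] \<noteq> 0)"
proof -
  obtain e where e: "\<And>as d b. length as = 0 \<Longrightarrow> regs_ok as d b \<Longrightarrow> \<exists>c. implements c F as d b e"
    using unary_computableE[OF assms] by metis
  have "regs_ok [] 1 2" by (simp add: regs_ok_def)
  then obtain c where c: "implements c F [] 1 2 e" using e[of "[]"] by auto
  show ?thesis
  proof (rule poly_time_computableI[where r = 1])
    fix x
    have "runs x c (\<lambda>_. 0) ((2 + length x) ^ e) ((\<lambda>_. 0)(1 := F x []))"
      using c by (simp add: implements_def)
    then obtain t where "t \<le> (2 + length x) ^ e" "exec x c (\<lambda>_. 0) t ((\<lambda>_. 0)(1 := F x []))"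
      unfolding runs_def by blast
    then show "\<exists>t s'. t \<le> (2 + length x) ^ e \<and> exec x c (\<lambda>_. 0) t s' \<and> (F x [] \<noteq> 0) = (s' 1 \<noteq> 0)"
      by (metis fun_upd_same)
  qed simp
qed

section \<open>Adapting argument lists\<close>

lemma map_nth_upt: "length v = a + k \<Longrightarrow> map ((!) v) [k..<a + k] = drop k v"
  by (rule nth_equalityI) (auto simp del: upt_Suc)

lemma unary_drop2:
  assumes "unary_computable a F" shows "unary_computable (a + 2) (\<lambda>x w. F x (drop 2 w))"
proof (rule unary_cong)
  show "unary_computable (a + 2) (\<lambda>x w. F x (map ((!) w) ([2..<a + 2])))"
    by (rule unary_rename) (use assms in \<open>auto simp del: upt_Suc\<close>)
  show "F x (map ((!) w) ([2..<a + 2])) = F x (drop 2 w)" if "length w = a + 2" for x w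
    using map_nth_upt[OF that] by (simp add: drop_Suc del: upt_Suc)
qed

lemma unary_skip:
  assumes "unary_computable (a + 1) F" shows "unary_computable (a + 2) (\<lambda>x w. F x (w ! 0 # drop 2 w))"
proof (rule unary_cong)
  show "unary_computable (a + 2) (\<lambda>x w. F x (map ((!) w) (0 # [2..<a + 2])))"
    by (rule unary_rename) (use assms in \<open>auto simp del: upt_Suc\<close>)
  show "F x (map ((!) w) (0 # [2..<a + 2])) = F x (w ! 0 # drop 2 w)" if "length w = a + 2" for x w
    using map_nth_upt[OF that] by (simp add: drop_Suc del: upt_Suc)
qed

lemma unary_tl:
  assumes "unary_computable a F" shows "unary_computable (a + 1) (\<lambda>x w. F x (tl w))"
proof (rule unary_cong)
  show "unary_computable (a + 1) (\<lambda>x w. F x (map ((!) w) ([1..<a + 1])))"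
    by (rule unary_rename) (use assms in \<open>auto simp del: upt_Suc\<close>)
  show "F x (map ((!) w) ([1..<a + 1])) = F x (tl w)" if "length w = a + 1" for x w
    using map_nth_upt[OF that] by (simp add: drop_Suc del: upt_Suc)
qed

text \<open>A computable bound \<open>B\<close> is enough, because computable functions are
  polynomially bounded.\<close>

lemma unary_bounded_rec:
  assumes "unary_computable a F" "unary_computable a G" "unary_computable (a + 2) H"
    and "unary_computable a B"
    and "\<And>x v i. length v = a \<Longrightarrow> i \<le> G x v \<Longrightarrow> rec_nat (F x v) (\<lambda>i y. H x (i # y # v)) i \<le> B x v"
  shows "unary_computable a (\<lambda>x v. rec_nat (F x v) (\<lambda>i y. H x (i # y # v)) (G x v))"
proof -
  obtain e where "\<And>x v. length v = a \<Longrightarrow> B x v \<le> (2 + length x + sum_list v) ^ e"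
    using unary_computable_bound[OF assms(4)] by metis
  then show ?thesis
    by (intro unary_rec[OF assms(1-3), where e = e]) (auto intro: le_trans[OF assms(5)])
qed

section \<open>Arithmetic\<close>

lemma unary_add:
  assumes F: "unary_computable a F" and G: "unary_computable a G"
  shows "unary_computable a (\<lambda>x v. F x v + G x v)"
proof -
  obtain f where f: "\<And>x v. length v = a \<Longrightarrow> F x v \<le> (2 + length x + sum_list v) ^ f"
    using unary_computable_bound[OF F] by metis
  obtain g where g: "\<And>x v. length v = a \<Longrightarrow> G x v \<le> (2 + length x + sum_list v) ^ g"
    using unary_computable_bound[OF G] by metis
  have "poly_bounded (\<lambda>X. X ^ f + X ^ g)" by (intro poly_bounded_intros)
  then obtain e where e: "\<And>X :: nat. X \<ge> 2 \<Longrightarrow> X ^ f + X ^ g \<le> X ^ e"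
    unfolding poly_bounded_def by blast
  have R: "F x v + i = rec_nat (F x v) (\<lambda>i y. Suc ((i # y # v) ! 1)) i" for x v i
    by (induction i) auto
  have "unary_computable a (\<lambda>x v. (\<lambda>x v i. F x v + i) x v (G x v))"
  proof (rule unary_rec[OF F G, where H = "\<lambda>x v. Suc (v ! 1)" and e = e])
    show "unary_computable (a + 2) (\<lambda>x v. Suc (v ! 1))" by (intro unary_Suc unary_nth) simp
    show "F x v + i \<le> (2 + length x + sum_list v) ^ e" if "length v = a" "i \<le> G x v" for x v i
      using f[OF that(1), of x] g[OF that(1), of x] that(2) e[of "2 + length x + sum_list v"] by simp
  qed (rule R)
  then show ?thesis .
qed

lemma unary_pred:
  assumes "unary_computable a F" shows "unary_computable a (\<lambda>x v. F x v - 1)"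
proof -
  have R: "rec_nat 0 (\<lambda>i y. i) n = n - 1" for n :: nat
    by (cases n) auto
  have "unary_computable a (\<lambda>x v. rec_nat 0 (\<lambda>i y. (i # y # v) ! 0) (F x v))"
    by (rule unary_bounded_rec[where F = "\<lambda>x v. 0" and B = F and H = "\<lambda>x v. v ! 0"])
      (auto intro!: unary_nth unary_0 assms simp: R)
  then show ?thesis by (simp add: R)
qed

lemma unary_diff:
  assumes "unary_computable a F" "unary_computable a G"
  shows "unary_computable a (\<lambda>x v. F x v - G x v)"
proof -
  have R: "rec_nat m (\<lambda>i y. y - Suc 0) n = m - n" for m n :: nat
    by (induction n) auto
  have "unary_computable a (\<lambda>x v. rec_nat (F x v) (\<lambda>i y. (i # y # v) ! 1 - 1) (G x v))"
    by (rule unary_bounded_rec[where B = F and H = "\<lambda>x v. v ! 1 - 1"])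
      (auto intro!: unary_nth unary_pred[unfolded One_nat_def] assms simp: R)
  then show ?thesis by (simp add: R)
qed

lemma unary_sum_list_arg:
  assumes G: "unary_computable a G" and F: "unary_computable (a + 1) F"
  shows "unary_computable a (\<lambda>x v. \<Sum>i<G x v. F x (i # v))"
proof -
  obtain f where f: "\<And>x v. length v = a + 1 \<Longrightarrow> F x v \<le> (2 + length x + sum_list v) ^ f"
    using unary_computable_bound[OF F] by metis
  obtain g where g: "\<And>x v. length v = a \<Longrightarrow> G x v \<le> (2 + length x + sum_list v) ^ g"
    using unary_computable_bound[OF G] by metis
  have "poly_bounded (\<lambda>X. X ^ g * (X + X ^ g) ^ f)" by (intro poly_bounded_intros)
  then obtain e where e: "\<And>X :: nat. X \<ge> 2 \<Longrightarrow> X ^ g * (X + X ^ g) ^ f \<le> X ^ e"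
    unfolding poly_bounded_def by blast
  have R: "(\<Sum>j<i. F x (j # v)) = rec_nat 0 (\<lambda>i y. (\<lambda>w. w ! 1 + F x (w ! 0 # drop 2 w)) (i # y # v)) i" for x v i
    by (induction i) auto
  have "unary_computable a (\<lambda>x v. (\<lambda>x v i. \<Sum>j<i. F x (j # v)) x v (G x v))"
  proof (rule unary_rec[OF unary_0 G, where H = "\<lambda>x w. w ! 1 + F x (w ! 0 # drop 2 w)" and e = e])
    show "unary_computable (a + 2) (\<lambda>x w. w ! 1 + F x (w ! 0 # drop 2 w))"
      by (intro unary_add unary_nth unary_skip F) simp
    show "(\<Sum>j<i. F x (j # v)) \<le> (2 + length x + sum_list v) ^ e" if v: "length v = a" and i: "i \<le> G x v" for x v i
    proof -
      let ?X = "2 + length x + sum_list v"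
      have "F x (j # v) \<le> (?X + ?X ^ g) ^ f" if "j < i" for j
        by (rule le_trans[OF f], use v in simp, rule power_mono) (use g[OF v, of x] that i in auto)
      then have "(\<Sum>j<i. F x (j # v)) \<le> (\<Sum>j<i. (?X + ?X ^ g) ^ f)"
        by (intro sum_mono) auto
      also have "\<dots> \<le> ?X ^ g * (?X + ?X ^ g) ^ f" using g[OF v, of x] i by simp
      also have "\<dots> \<le> ?X ^ e" by (rule e) simp
      finally show ?thesis .
    qed
  qed (simp add: R)
  then show ?thesis .
qed

lemma unary_sum:
  assumes "unary_computable a G" and "unary_computable (a + 1) (\<lambda>x w. F x (w ! 0) (tl w))"
  shows "unary_computable a (\<lambda>x v. \<Sum>i<G x v. F x i v)"
  using unary_sum_list_arg[OF assms] by simp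

lemma unary_mult:
  assumes "unary_computable a F" "unary_computable a G"
  shows "unary_computable a (\<lambda>x v. F x v * G x v)"
  using unary_sum[OF assms(1) unary_tl[OF assms(2)]] by simp

lemma unary_const: "unary_computable a (\<lambda>x v. c)"
  by (induction c) (auto intro: unary_0 unary_Suc)

section \<open>Decidable predicates and number theory\<close>

abbreviation unary_decidable :: "nat \<Rightarrow> (bool list \<Rightarrow> nat list \<Rightarrow> bool) \<Rightarrow> bool" where
  "unary_decidable a P \<equiv> unary_computable a (\<lambda>x v. of_bool (P x v))"

lemma unary_less:
  assumes "unary_computable a F" "unary_computable a G"
  shows "unary_decidable a (\<lambda>x v. F x v < G x v)"
proof -
  have "unary_computable a (\<lambda>x v. 1 - (1 - (G x v - F x v)))"
    by (intro unary_diff unary_const assms)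
  moreover have "1 - (1 - (m - n)) = of_bool (n < m)" for m n :: nat by auto
  ultimately show ?thesis by simp
qed

lemma unary_not:
  assumes "unary_decidable a P"
  shows "unary_decidable a (\<lambda>x v. \<not> P x v)"
proof -
  have "of_bool (\<not> p) = 1 - (of_bool p :: nat)" for p by simp
  then show ?thesis using unary_diff[OF unary_const[of a 1] assms] by simp
qed

lemma unary_conj:
  assumes "unary_decidable a P" "unary_decidable a Q"
  shows "unary_decidable a (\<lambda>x v. P x v \<and> Q x v)"
  using unary_mult[OF assms] by (simp add: of_bool_conj)

lemma unary_imp:
  assumes "unary_decidable a P" "unary_decidable a Q"
  shows "unary_decidable a (\<lambda>x v. P x v \<longrightarrow> Q x v)"
  using unary_not[OF unary_conj[OF assms(1) unary_not[OF assms(2)]]] by simp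

lemma unary_le:
  assumes "unary_computable a F" "unary_computable a G"
  shows "unary_decidable a (\<lambda>x v. F x v \<le> G x v)"
  using unary_not[OF unary_less[OF assms(2,1)]] by (simp add: not_less)

lemma unary_eq:
  assumes "unary_computable a F" "unary_computable a G"
  shows "unary_decidable a (\<lambda>x v. F x v = G x v)"
  using unary_conj[OF unary_le[OF assms] unary_le[OF assms(2,1)]] by (simp add: eq_iff)

lemma unary_if:
  assumes "unary_decidable a P" "unary_computable a F" "unary_computable a G"
  shows "unary_computable a (\<lambda>x v. if P x v then F x v else G x v)"
proof -
  have "unary_computable a (\<lambda>x v. of_bool (P x v) * F x v + (1 - of_bool (P x v)) * G x v)"
    by (intro unary_add unary_mult unary_diff unary_const assms)
  moreover have "(if P x v then F x v else G x v) = of_bool (P x v) * F x v + (1 - of_bool (P x v)) * G x v" for x v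
    by simp
  ultimately show ?thesis by simp
qed

lemma unary_ball:
  assumes "unary_computable a G" and "unary_decidable (a + 1) (\<lambda>x w. P x (w ! 0) (tl w))"
  shows "unary_decidable a (\<lambda>x v. \<forall>i<G x v. P x i v)"
proof -
  have "unary_decidable a (\<lambda>x v. (\<Sum>i<G x v. of_bool (\<not> P x i v)) = (0 :: nat))"
    by (intro unary_eq unary_const unary_sum unary_not assms)
  moreover have "((\<Sum>i<n. of_bool (\<not> Q i)) = (0::nat)) \<longleftrightarrow> (\<forall>i<n. Q i)" for n :: nat and Q
    by auto
  ultimately show ?thesis by simp
qed

text \<open>A counter that is reset when it reaches the divisor. For divisor 0 it is never reset, in
  agreement with \<open>n mod 0 = n\<close>.\<close>

lemma unary_mod:
  assumes F: "unary_computable a F" and D: "unary_computable a D"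
  shows "unary_computable a (\<lambda>x v. F x v mod D x v)"
proof -
  have R: "rec_nat 0 (\<lambda>i y. if Suc y = d then 0 else Suc y) n = n mod d" for n d :: nat
    by (induction n) (auto simp: mod_Suc)
  have "unary_computable a (\<lambda>x v. rec_nat 0 (\<lambda>i y. (\<lambda>w. if Suc (w ! 1) = D x (drop 2 w) then 0 else Suc (w ! 1)) (i # y # v)) (F x v))"
  proof (rule unary_bounded_rec[where F = "\<lambda>x v. 0" and B = F and H = "\<lambda>x w. if Suc (w ! 1) = D x (drop 2 w) then 0 else Suc (w ! 1)"])
    show "unary_computable (a + 2) (\<lambda>x w. if Suc (w ! 1) = D x (drop 2 w) then 0 else Suc (w ! 1))"
      by (intro unary_if unary_eq unary_Suc unary_nth unary_drop2 D unary_const) auto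
  qed (auto intro!: unary_0 F simp: R intro: le_trans[OF mod_less_eq_dividend] cong: if_cong)
  then show ?thesis by (simp add: R cong: if_cong)
qed

text \<open>The quotient is the number of positive multiples of the divisor that do not exceed the
  dividend.\<close>

lemma unary_div:
  assumes "unary_computable a F" and "unary_computable a D" and "\<And>x v. D x v > 0"
  shows "unary_computable a (\<lambda>x v. F x v div D x v)"
proof -
  have "unary_computable a (\<lambda>x v. \<Sum>i<F x v. of_bool (Suc i * D x v \<le> F x v))"
    by (intro unary_sum unary_le unary_mult unary_Suc unary_nth unary_tl assms) auto
  moreover have "(\<Sum>i<m. of_bool (Suc i * d \<le> m)) = m div d" if "d > 0" for m d :: nat
  proof -
    have "{..<m} \<inter> {i. Suc i * d \<le> m} = {..<m div d}"
      using that by (auto simp: less_eq_div_iff_mult_less_eq[symmetric] Suc_le_eq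
          simp del: mult_Suc intro: less_le_trans[OF _ div_le_dividend])
    then show ?thesis by (simp add: of_bool_def sum.If_cases del: mult_Suc)
  qed
  ultimately show ?thesis using assms(3) by simp
qed

lemma unary_prime:
  assumes "unary_computable a F" shows "unary_decidable a (\<lambda>x v. prime (F x v))"
proof -
  have "prime q \<longleftrightarrow> 1 < q \<and> (\<forall>d<q. 1 < d \<longrightarrow> \<not> q mod d = 0)" for q :: nat
  proof
    assume q: "prime q"
    have "\<not> q mod d = 0" if "d < q" "1 < d" for d
      using q that unfolding prime_nat_iff by (auto simp: mod_eq_0_iff_dvd)
    then show "1 < q \<and> (\<forall>d<q. 1 < d \<longrightarrow> \<not> q mod d = 0)"
      using q prime_gt_1_nat by blast
  next
    assume *: "1 < q \<and> (\<forall>d<q. 1 < d \<longrightarrow> \<not> q mod d = 0)"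
    have "m = 1 \<or> m = q" if "m dvd q" for m
    proof (rule ccontr)
      assume m: "\<not> (m = 1 \<or> m = q)"
      have "m \<noteq> 0" using that * by auto
      moreover have "m \<le> q" using that * by (intro dvd_imp_le) auto
      ultimately show False using * m that by (auto simp: mod_eq_0_iff_dvd)
    qed
    then show "prime q" using * unfolding prime_nat_iff by auto
  qed
  moreover have "unary_decidable a (\<lambda>x v. 1 < F x v \<and> (\<forall>d<F x v. 1 < d \<longrightarrow> \<not> F x v mod d = 0))"
    by (intro unary_conj unary_ball unary_imp unary_not unary_eq unary_mod unary_less unary_const unary_nth unary_tl assms) auto
  ultimately show ?thesis by simp
qed

definition primes_below :: "nat \<Rightarrow> nat" where
  "primes_below q = card {p. prime p \<and> p < q}"

lemma unary_primes_below:
  assumes "unary_computable a F" shows "unary_computable a (\<lambda>x v. primes_below (F x v))"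
proof -
  have "unary_computable a (\<lambda>x v. \<Sum>p<F x v. of_bool (prime p))"
    by (intro unary_sum unary_prime unary_nth assms) auto
  moreover have "(\<Sum>p<n. of_bool (prime p)) = primes_below n" for n :: nat
  proof -
    have "{..<n} \<inter> {p. prime p} = {p. prime p \<and> p < n}" by auto
    then show ?thesis by (simp add: primes_below_def of_bool_def sum.If_cases)
  qed
  ultimately show ?thesis by simp
qed

definition num :: "bool list \<Rightarrow> nat \<Rightarrow> nat \<Rightarrow> nat" where
  "num x s len = rec_nat 0 (\<lambda>i y. 2 * y + bit_at x (s + i)) len"

lemma num_0 [simp]: "num x s 0 = 0"
  by (simp add: num_def)

lemma num_Suc [simp]: "num x s (Suc len) = 2 * num x s len + bit_at x (s + len)"
  by (simp add: num_def)

lemma num_less: "num x s len < 2 ^ len"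
  by (induction len) (auto simp: bit_at_def)

text \<open>The number itself can be exponentially large, out of reach of unary counting. Only its
  residue is computed, by Horner's scheme with a reduction after every bit.\<close>

lemma unary_num_mod:
  assumes A: "unary_computable a A" and L: "unary_computable a L" and D: "unary_computable a D"
    and "\<And>x v. D x v > 0"
  shows "unary_computable a (\<lambda>x v. num x (A x v) (L x v) mod D x v)"
proof -
  have R: "rec_nat 0 (\<lambda>i y. (2 * y + bit_at x (s + i)) mod d) len = num x s len mod d" for x s d len
  proof (induction len)
    case (Suc len)
    then show ?case by simp (metis mod_add_left_eq mod_mult_right_eq)
  qed simp
  let ?H = "\<lambda>x w. (2 * w ! 1 + bit_at x (A x (drop 2 w) + w ! 0)) mod D x (drop 2 w)"
  have "unary_computable a (\<lambda>x v. rec_nat 0 (\<lambda>i y. ?H x (i # y # v)) (L x v))"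
  proof (rule unary_bounded_rec[where F = "\<lambda>x v. 0" and B = D and H = ?H])
    show "unary_computable (a + 2) ?H"
      by (intro unary_mod unary_add unary_mult unary_const unary_bit unary_nth unary_drop2 A D) auto
  qed (auto intro!: unary_0 assms mod_le_divisor simp: R)
  then show ?thesis by (simp add: R)
qed

text \<open>Doubling only while the result stays below n computes powers of two without ever leaving
  the polynomial range.\<close>

lemma floor_log_step:
  "rec_nat 1 (\<lambda>i y. if 2 * y \<le> n then 2 * y else y) i = (2::nat) ^ min i (floor_log n)"
proof (induction i)
  case (Suc i)
  have "2 * 2 ^ i \<le> n \<longleftrightarrow> Suc i \<le> floor_log n"
  proof (cases "n = 0")
    case False
    show ?thesis
    proof
      assume *: "2 * 2 ^ i \<le> n"
      show "Suc i \<le> floor_log n"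
      proof (rule ccontr)
        assume "\<not> Suc i \<le> floor_log n"
        then have "(2::nat) ^ floor_log n \<le> 2 ^ i" by (intro power_increasing) auto
        then show False using * floor_log_exp2_gt[of n] by linarith
      qed
    next
      assume "Suc i \<le> floor_log n"
      then have "(2::nat) ^ Suc i \<le> 2 ^ floor_log n" by (intro power_increasing) auto
      then show "2 * 2 ^ i \<le> n" using floor_log_exp2_le[of n] False by simp
    qed
  qed simp
  moreover have "\<not> 2 * 2 ^ floor_log n \<le> n"
    using floor_log_exp2_gt[of n] by simp
  ultimately show ?case using Suc by (auto simp: min_def split: if_splits)
qed simp

lemma floor_log_less: "n > 0 \<Longrightarrow> floor_log n < n"
  using floor_log_exp2_le[of n] less_exp[of "floor_log n"] by linarith

lemma unary_power_min:
  assumes "unary_computable a I"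
  shows "unary_computable a (\<lambda>x v. 2 ^ min (I x v) (floor_log (length x)))"
proof -
  let ?H = "\<lambda>x w. if 2 * w ! 1 \<le> length x then 2 * w ! 1 else w ! 1"
  have "unary_computable a (\<lambda>x v. rec_nat 1 (\<lambda>i y. ?H x (i # y # v)) (I x v))"
  proof (rule unary_bounded_rec[where F = "\<lambda>x v. 1" and B = "\<lambda>x v. length x + 1" and H = ?H])
    show "unary_computable (a + 2) ?H"
      by (intro unary_if unary_le unary_mult unary_const unary_nth unary_length) auto
    fix x :: "bool list" and v :: "nat list" and i
    have "(2::nat) ^ min i (floor_log (length x)) \<le> 2 ^ floor_log (length x)"
      by (intro power_increasing) auto
    also have "\<dots> \<le> length x + 1"
      using floor_log_exp2_le[of "length x"] by (cases "length x = 0") auto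
    finally show "rec_nat 1 (\<lambda>i y. ?H x (i # y # v)) i \<le> length x + 1"
      by (simp add: floor_log_step[unfolded One_nat_def] cong: if_cong)
  qed (intro unary_add unary_length unary_const assms)+
  then show ?thesis by (simp add: floor_log_step[unfolded One_nat_def] cong: if_cong)
qed

text \<open>The logarithm is the number of indices at which doubling is still possible; the range of
  the count suffices because \<open>floor_log n < n\<close> for positive n.\<close>

lemma unary_floor_log: "unary_computable a (\<lambda>x v. floor_log (length x))"
proof -
  have "(\<Sum>i<n. of_bool (2 * 2 ^ min i (floor_log n) \<le> n)) = floor_log n" for n
  proof (cases "n = 0")
    case False
    have "2 * 2 ^ min i (floor_log n) \<le> n \<longleftrightarrow> i < floor_log n" for i
    proof (cases "i < floor_log n")
      case True
      then have "2 ^ Suc i \<le> (2::nat) ^ floor_log n" by (intro power_increasing) auto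
      also have "\<dots> \<le> n" using False by (simp add: floor_log_exp2_le)
      finally show ?thesis using True by simp
    next
      case False
      then show ?thesis using floor_log_exp2_gt[of n] by (simp add: min_def)
    qed
    moreover have "{..<n} \<inter> {i. i < floor_log n} = {..<floor_log n}"
      using floor_log_less[of n] False by auto
    ultimately show ?thesis by (simp add: of_bool_def sum.If_cases)
  qed simp
  moreover have "unary_computable a (\<lambda>x v. \<Sum>i<length x. of_bool (2 * 2 ^ min i (floor_log (length x)) \<le> length x))"
    by (intro unary_sum unary_le unary_mult unary_const unary_length unary_power_min unary_nth) simp
  ultimately show ?thesis by simp
qed

lemma unary_power_floor_log: "unary_computable a (\<lambda>x v. 2 ^ floor_log (length x))"
  using unary_power_min[OF unary_floor_log] by simp

section \<open>The hard function\<close>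

text \<open>For positive n, \<open>2 ^ block_len n\<close> lies between n^4 and 16 n^4. The factor 4
  leaves room for the weight \<open>w\<close> and the rate \<kappa> in
  \<open>correlation_le\<close>, which take the exponents 2 and 1 of
  \<open>2 ^ Suc (floor_log n)\<close>.\<close>

definition block_len :: "nat \<Rightarrow> nat" where
  "block_len n = 4 * Suc (floor_log n)"

definition key_len :: "nat \<Rightarrow> nat" where
  "key_len n = n div 4"

definition num_blocks :: "nat \<Rightarrow> nat" where
  "num_blocks n = key_len n div block_len n"

text \<open>At most one summand is selected, namely the prime that has exactly
  \<open>2 ^ r + z\<close> primes below it. Skipping the first \<open>2 ^ r\<close> primes makes the
  selected prime at least \<open>2 ^ r\<close>. The value is the whole residue; \<open>hard\<close>
  takes its parity.\<close>

definition hash :: "nat \<Rightarrow> nat \<Rightarrow> nat \<Rightarrow> nat" where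
  "hash r y z = (\<Sum>q<2 ^ r * 2 ^ r. of_bool (prime q \<and> primes_below q = 2 ^ r + z) * (y mod q))"

definition block :: "bool list \<Rightarrow> nat \<Rightarrow> nat" where
  "block x j = num x (key_len (length x) + j * block_len (length x)) (block_len (length x))"

text \<open>The key is the first quarter and the blocks lie in the second. Positions between the
  last block and \<open>2 * key_len\<close> have no influence.\<close>

definition hard :: "bool list \<Rightarrow> bool" where
  "hard x \<longleftrightarrow> odd ((\<Sum>i<length x. of_bool (2 * key_len (length x) \<le> i) * bit_at x i) +
     (\<Sum>j<num_blocks (length x). hash (block_len (length x)) (num x 0 (key_len (length x))) (block x j)))"

lemma poly_time_computable_hard: "poly_time_computable hard"
proof -
  have len: "unary_computable a (\<lambda>x v. block_len (length x))" for a
    unfolding block_len_def by (intro unary_mult unary_const unary_Suc unary_floor_log)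
  \<comment> \<open>General exponentiation is not polynomially bounded, but this power is a constant
    times the fourth power of \<open>2 ^ floor_log n\<close>.\<close>
  have pow: "unary_computable a (\<lambda>x v. 2 ^ block_len (length x))" for a
  proof -
    have "(2::nat) ^ block_len n = 16 * ((2 ^ floor_log n * 2 ^ floor_log n) * (2 ^ floor_log n * 2 ^ floor_log n))" for n :: nat
    proof -
      have "block_len n = 4 + ((floor_log n + floor_log n) + (floor_log n + floor_log n))"
        by (simp add: block_len_def)
      then show ?thesis by (simp only: power_add) simp
    qed
    then show ?thesis
      by (simp only:) (intro unary_mult unary_const unary_power_floor_log)
  qed
  have key: "unary_computable a (\<lambda>x v. key_len (length x))" for a
    unfolding key_len_def by (intro unary_div unary_const unary_length) auto
  have blocks: "unary_computable a (\<lambda>x v. num_blocks (length x))" for a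
    unfolding num_blocks_def by (intro unary_div key len) (simp add: block_len_def)
  have block: "unary_computable a (\<lambda>x v. block x (F x v))" if "unary_computable a F" for a F
  proof -
    \<comment> \<open>A block has a value below this modulus, so the reduction changes nothing and
      only brings the number into the form of \<open>unary_num_mod\<close>.\<close>
    have "unary_computable a (\<lambda>x v. num x (key_len (length x) + F x v * block_len (length x)) (block_len (length x))
        mod 2 ^ block_len (length x))"
      by (intro unary_num_mod unary_add unary_mult key len pow that) auto
    then show ?thesis by (simp add: block_def num_less)
  qed
  have hash: "unary_computable a (\<lambda>x v. hash (block_len (length x)) (num x 0 (key_len (length x))) (F x v))"
    if F: "unary_computable a F" for a F
  proof -
    \<comment> \<open>The modulus 0 is replaced by 1 to keep it positive; as 0 is not prime, that
      summand vanishes anyway.\<close>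
    have "unary_computable a (\<lambda>x v. \<Sum>q<2 ^ block_len (length x) * 2 ^ block_len (length x).
        of_bool (prime q \<and> primes_below q = 2 ^ block_len (length x) + F x v) *
          (num x 0 (key_len (length x)) mod (if q = 0 then 1 else q)))"
      by (intro unary_sum unary_mult unary_conj unary_eq unary_prime unary_primes_below unary_add
          unary_num_mod unary_if unary_const unary_nth unary_tl key pow F) auto
    moreover have "(\<Sum>q<m. of_bool (prime q \<and> P q) * (y mod (if q = 0 then 1 else q))) =
        (\<Sum>q<m. of_bool (prime q \<and> P q) * (y mod q))" for m y :: nat and P
      by (intro sum.cong) auto
    ultimately show ?thesis unfolding hash_def by simp
  qed
  have "unary_computable 0 (\<lambda>x v. ((\<Sum>i<length x. of_bool (2 * key_len (length x) \<le> i) * bit_at x i) +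
     (\<Sum>j<num_blocks (length x). hash (block_len (length x)) (num x 0 (key_len (length x))) (block x j))) mod 2)"
    by (intro unary_mod unary_add unary_sum unary_mult unary_le unary_const unary_bit unary_nth
        unary_length hash block key blocks) auto
  from poly_time_computable_unary[OF this] show ?thesis
    by (simp only: hard_def[abs_def] even_iff_mod_2_eq_zero)
qed

section \<open>Restricted comparator circuits\<close>

text \<open>Wires carry elements of a lattice, in the application Boolean functions ordered
  pointwise. Thus one run describes the circuit on all inputs at once, and comparability of wires
  makes sense.\<close>

fun lattice_gate :: "nat \<times> nat \<Rightarrow> (nat \<Rightarrow> 'a :: lattice) \<Rightarrow> nat \<Rightarrow> 'a" where
  "lattice_gate (i, j) F = F(i := inf (F i) (F j), j := sup (F i) (F j))"

definition incomparable :: "'a :: order \<Rightarrow> 'a \<Rightarrow> nat" where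
  "incomparable a b = of_bool (\<not> a \<le> b \<and> \<not> b \<le> a)"

definition num_incomparable :: "nat set \<Rightarrow> (nat \<Rightarrow> 'a :: order) \<Rightarrow> nat" where
  "num_incomparable U F = (\<Sum>a\<in>U. \<Sum>b\<in>U. incomparable (F a) (F b))"

lemma incomparable_sym: "incomparable a b = incomparable b a"
  by (auto simp: incomparable_def)

text \<open>If w is incomparable to the infimum, then neither u nor v is below w, and w is not below
  both; so w is incomparable to one of them. The dual holds for the supremum. If w is incomparable
  to both, then none of u, v is below or above w, so both terms on the right are 1.\<close>

lemma incomparable_inf_sup:
  fixes u v w :: "'a :: lattice"
  shows "incomparable (inf u v) w + incomparable (sup u v) w \<le> incomparable u w + incomparable v w"
proof -
  have "inf u v \<le> w" if "u \<le> w \<or> v \<le> w" using that by (auto intro: le_infI1 le_infI2)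
  moreover have "w \<le> sup u v" if "w \<le> u \<or> w \<le> v" using that by (auto intro: le_supI1 le_supI2)
  ultimately show ?thesis
    by (auto simp: incomparable_def of_bool_def)
qed

lemma sum_sum_remove2:
  fixes I :: "'b \<Rightarrow> 'b \<Rightarrow> nat"
  assumes "finite U" "i \<in> U" "j \<in> U" "i \<noteq> j"
  shows "(\<Sum>a\<in>U. \<Sum>b\<in>U. I a b) = I i i + I i j + I j i + I j j +
    (\<Sum>w\<in>U - {i, j}. I i w + I j w) + (\<Sum>w\<in>U - {i, j}. I w i + I w j) +
    (\<Sum>a\<in>U - {i, j}. \<Sum>b\<in>U - {i, j}. I a b)"
proof -
  have U: "U = insert i (insert j (U - {i, j}))" using assms by auto
  have *: "sum f U = f i + f j + sum f (U - {i, j})" for f :: "'b \<Rightarrow> nat"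
    by (subst U) (use assms in auto)
  show ?thesis unfolding * by (simp add: sum.distrib)
qed

text \<open>The pair \<open>i\<close>, \<open>j\<close> becomes comparable. Against a third wire the
  two new values are counted together, since only their sum is controlled by
  \<open>incomparable_inf_sup\<close>.\<close>

lemma num_incomparable_gate:
  fixes F :: "nat \<Rightarrow> 'a :: lattice"
  assumes "finite U" "i \<in> U" "j \<in> U" and inc: "\<not> F i \<le> F j" "\<not> F j \<le> F i"
  shows "num_incomparable U (lattice_gate (i, j) F) < num_incomparable U F"
proof -
  have ij: "i \<noteq> j" using inc by auto
  let ?F = "lattice_gate (i, j) F"
  have F: "?F i = inf (F i) (F j)" "?F j = sup (F i) (F j)" "w \<notin> {i, j} \<Longrightarrow> ?F w = F w" for w
    using ij by auto
  have 1: "incomparable (?F i) (?F w) + incomparable (?F j) (?F w) \<le>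
      incomparable (F i) (F w) + incomparable (F j) (F w)" if "w \<in> U - {i, j}" for w
    unfolding F(1,2) using that F(3)[of w] by (simp add: incomparable_inf_sup del: lattice_gate.simps)
  then have 2: "incomparable (?F w) (?F i) + incomparable (?F w) (?F j) \<le>
      incomparable (F w) (F i) + incomparable (F w) (F j)" if "w \<in> U - {i, j}" for w
    using that incomparable_sym by metis
  have 3: "incomparable (?F i) (?F j) = 0" "incomparable (?F j) (?F i) = 0" "incomparable (?F i) (?F i) = 0"
      "incomparable (?F j) (?F j) = 0" "incomparable (F i) (F j) = 1"
    unfolding F(1,2) using inc by (auto simp: incomparable_def le_infI1)
  let ?U = "U - {i, j}"
  have "(\<Sum>w\<in>?U. incomparable (?F i) (?F w) + incomparable (?F j) (?F w)) \<le>
      (\<Sum>w\<in>?U. incomparable (F i) (F w) + incomparable (F j) (F w))"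
    by (rule sum_mono[OF 1])
  moreover have "(\<Sum>w\<in>?U. incomparable (?F w) (?F i) + incomparable (?F w) (?F j)) \<le>
      (\<Sum>w\<in>?U. incomparable (F w) (F i) + incomparable (F w) (F j))"
    by (rule sum_mono[OF 2])
  moreover have "(\<Sum>a\<in>?U. \<Sum>b\<in>?U. incomparable (?F a) (?F b)) = (\<Sum>a\<in>?U. \<Sum>b\<in>?U. incomparable (F a) (F b))"
    using F(3) by (intro sum.cong refl) (simp del: lattice_gate.simps)
  ultimately show ?thesis
    unfolding num_incomparable_def sum_sum_remove2[OF assms(1-3) ij] 3 by linarith
qed

lemma fold_gate_outside:
  "set gs \<subseteq> W \<times> W \<Longrightarrow> w \<notin> W \<Longrightarrow> fold lattice_gate gs F w = F w"
  by (induction gs arbitrary: F) auto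

lemma fold_gate_agree:
  "set gs \<subseteq> W \<times> W \<Longrightarrow> (\<And>w. w \<in> W \<Longrightarrow> F w = G w) \<Longrightarrow> w \<in> W \<Longrightarrow>
    fold lattice_gate gs F w = fold lattice_gate gs G w"
proof (induction gs arbitrary: F G)
  case (Cons g gs)
  obtain i j where g: "g = (i, j)" by fastforce
  have "lattice_gate g F w = lattice_gate g G w" if "w \<in> W" for w
    using Cons.prems that g by auto
  then show ?case using Cons.IH[of "lattice_gate g F" "lattice_gate g G"] Cons.prems by simp
qed simp

text \<open>A gate between comparable wires either does nothing or swaps two wires, so it can be
  absorbed into a permutation of the wires. Every other gate makes two wires comparable and
  does not increase the number of incomparable pairs elsewhere.\<close>

lemma useful_gates:
  fixes F :: "nat \<Rightarrow> 'a :: bounded_lattice"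
  assumes "finite U" "W \<subseteq> U" and const: "\<And>w. w \<in> U - W \<Longrightarrow> F w = bot \<or> F w = top"
    and "\<And>i j. (i, j) \<in> set gs \<Longrightarrow> i \<in> U \<and> j \<in> U \<and> i \<noteq> j"
  shows "\<exists>hs p. bij_betw p U U \<and> set hs \<subseteq> W \<times> W \<and>
    length hs + num_incomparable U (fold lattice_gate hs F) \<le> num_incomparable U F \<and>
    (\<forall>w\<in>U. fold lattice_gate gs F w = fold lattice_gate hs F (p w))"
  using assms(4)
proof (induction gs rule: rev_induct)
  case Nil
  then show ?case by (intro exI[of _ "[]"] exI[of _ id]) (auto simp: bij_betw_def)
next
  case (snoc g gs)
  then obtain hs p where p: "bij_betw p U U" and hs: "set hs \<subseteq> W \<times> W"
    and len: "length hs + num_incomparable U (fold lattice_gate hs F) \<le> num_incomparable U F"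
    and eq: "\<And>w. w \<in> U \<Longrightarrow> fold lattice_gate gs F w = fold lattice_gate hs F (p w)"
    by (metis UnCI set_append)
  obtain i j where g: "g = (i, j)" by fastforce
  have ij: "i \<in> U" "j \<in> U" "i \<noteq> j" using snoc.prems g by auto
  have pU: "p i \<in> U" "p j \<in> U" using p ij by (auto simp: bij_betw_def)
  have inj: "p w = p w' \<longleftrightarrow> w = w'" if "w \<in> U" "w' \<in> U" for w w'
    using p that by (auto simp: bij_betw_def inj_on_def)
  let ?H = "fold lattice_gate hs F"
  have G: "fold lattice_gate (gs @ [g]) F w =
      (if w = j then sup (?H (p i)) (?H (p j)) else if w = i then inf (?H (p i)) (?H (p j)) else ?H (p w))"
    if "w \<in> U" for w
    using g ij that eq by auto
  consider "?H (p i) \<le> ?H (p j)" | "?H (p j) \<le> ?H (p i)" | "\<not> ?H (p i) \<le> ?H (p j)" "\<not> ?H (p j) \<le> ?H (p i)"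
    by blast
  then show ?case
  proof cases
    case 1
    then have "\<forall>w\<in>U. fold lattice_gate (gs @ [g]) F w = ?H (p w)"
      using G by (auto simp: inf_absorb1 sup_absorb2)
    then show ?thesis using p hs len by blast
  next
    case 2
    \<comment> \<open>Minimum and maximum arrive in exchanged places, so the gate is a mere swap of
      names.\<close>
    define q where "q = p \<circ> Transposition.transpose i j"
    have "bij_betw (Transposition.transpose i j) U U"
      by (rule bij_betw_byWitness[where f' = "Transposition.transpose i j"])
        (use ij in \<open>auto simp: Transposition.transpose_def\<close>)
    then have "bij_betw q U U" unfolding q_def using p by (rule bij_betw_trans)
    moreover have "\<forall>w\<in>U. fold lattice_gate (gs @ [g]) F w = ?H (q w)"
      using G 2 ij by (auto simp: inf_absorb2 sup_absorb1 q_def Transposition.transpose_def)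
    ultimately show ?thesis using hs len by blast
  next
    case 3
    \<comment> \<open>Wires outside \<open>W\<close> stay \<open>bot\<close> or \<open>top\<close>,
      which are comparable to everything, so a gate that counts has both ends in
      \<open>W\<close>.\<close>
    have "w \<in> W" if "w \<in> U" "\<not> ?H w \<le> ?H w'" "\<not> ?H w' \<le> ?H w" for w w'
    proof (rule ccontr)
      assume "w \<notin> W"
      then have "?H w = bot \<or> ?H w = top" using const[of w] that(1) fold_gate_outside[OF hs, of w F] by simp
      then show False using that by auto
    qed
    then have W: "p i \<in> W" "p j \<in> W" using 3 pU by auto
    let ?hs = "hs @ [(p i, p j)]"
    have "set ?hs \<subseteq> W \<times> W" using hs W by auto
    moreover have "length ?hs + num_incomparable U (fold lattice_gate ?hs F) \<le> num_incomparable U F"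
      using num_incomparable_gate[OF \<open>finite U\<close> pU 3] len by (simp del: lattice_gate.simps)
    moreover have "\<forall>w\<in>U. fold lattice_gate (gs @ [g]) F w = fold lattice_gate ?hs F (p w)"
      using G ij inj by auto
    ultimately show ?thesis using p by blast
  qed
qed

text \<open>Constants are comparable to everything, so only ordered pairs inside \<open>W\<close>
  can count.\<close>

lemma num_incomparable_le:
  fixes F :: "nat \<Rightarrow> 'a :: bounded_lattice"
  assumes "finite U" "W \<subseteq> U" and const: "\<And>w. w \<in> U - W \<Longrightarrow> F w = bot \<or> F w = top"
  shows "num_incomparable U F \<le> card W ^ 2"
proof -
  have 0: "incomparable (F a) (F b) = 0" if "a \<in> U - W \<or> b \<in> U - W" for a b
    using const[of a] const[of b] that by (auto simp: incomparable_def)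
  have "num_incomparable U F = (\<Sum>a\<in>W. \<Sum>b\<in>U. incomparable (F a) (F b))"
    unfolding num_incomparable_def using assms 0 by (intro sum.mono_neutral_right) auto
  also have "\<dots> = (\<Sum>a\<in>W. \<Sum>b\<in>W. incomparable (F a) (F b))"
    using assms 0 by (intro sum.cong sum.mono_neutral_right) auto
  also have "\<dots> \<le> (\<Sum>a\<in>W. \<Sum>b\<in>W. 1)"
    by (intro sum_mono) (auto simp: incomparable_def)
  finally show ?thesis by (simp add: power2_eq_square)
qed

text \<open>Infimum and supremum of functions are pointwise, so evaluation at \<open>x\<close>
  commutes with every gate.\<close>

lemma fold_apply_gate: "fold apply_gate gs (\<lambda>w. F w x) w = fold lattice_gate gs F w x"
proof (induction gs arbitrary: F)
  case (Cons g gs)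
  obtain i j where g: "g = (i, j)" by fastforce
  have "apply_gate g (\<lambda>w. F w x) = (\<lambda>w. lattice_gate g F w x)"
    by (auto simp: g fun_eq_iff)
  then show ?case using Cons[of "lattice_gate g F"] by simp
qed simp

text \<open>The size counts gates only and leaves the number of wires unbounded. Just these wires
  can influence the output, and their number is at most twice the size plus one.\<close>

definition live_wires :: "comparator_circuit \<Rightarrow> nat set" where
  "live_wires C = insert (out_wire C) (fst ` set (gates C) \<union> snd ` set (gates C))"

lemma finite_live_wires [simp]: "finite (live_wires C)"
  by (simp add: live_wires_def)

lemma card_live_wires: "card (live_wires C) \<le> 2 * circuit_size C + 1"
proof -
  have "card (fst ` set (gates C) \<union> snd ` set (gates C)) \<le> length (gates C) + length (gates C)"
    by (intro order_trans[OF card_Un_le] add_mono order_trans[OF card_image_le] card_length) auto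
  then show ?thesis
    unfolding live_wires_def circuit_size_def using card_insert_le_m1 by (simp add: card_insert_if)
qed

lemma gates_live: "(i, j) \<in> set (gates C) \<Longrightarrow> i \<in> live_wires C \<and> j \<in> live_wires C"
  unfolding live_wires_def by force

lemma circuit_output_cong:
  assumes "\<And>w. w \<in> live_wires C \<Longrightarrow> x ! lit_var (labels C ! w) = y ! lit_var (labels C ! w)"
  shows "circuit_output C x = circuit_output C y"
proof -
  have lit: "lit_val x l = lit_val y l" if "x ! lit_var l = y ! lit_var l" for l
    using that by (cases l) auto
  have "fold lattice_gate (gates C) (\<lambda>w _. lit_val x (labels C ! w)) (out_wire C) =
      fold lattice_gate (gates C) (\<lambda>w (_::unit). lit_val y (labels C ! w)) (out_wire C)"
    by (rule fold_gate_agree[where W = "live_wires C"])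
      (use gates_live in \<open>auto simp: live_wires_def[of C, THEN equalityD2, THEN subsetD] intro!: lit assms\<close>)
  then show ?thesis
    unfolding circuit_output_def
    using fold_apply_gate[of "gates C" "\<lambda>w (_::unit). lit_val x (labels C ! w)" "()"]
      fold_apply_gate[of "gates C" "\<lambda>w (_::unit). lit_val y (labels C ! w)" "()"] by simp
qed

definition mix :: "nat set \<Rightarrow> bool list \<Rightarrow> bool list \<Rightarrow> bool list" where
  "mix S u v = map (\<lambda>i. if i \<in> S then u ! i else v ! i) [0..<length v]"

lemma length_mix [simp]: "length (mix S u v) = length v"
  by (simp add: mix_def)

lemma nth_mix [simp]: "i < length v \<Longrightarrow> mix S u v ! i = (if i \<in> S then u ! i else v ! i)"
  by (simp add: mix_def)

lemma sum_power_le: "(\<Sum>i\<le>n. B ^ i) \<le> (B + 1 :: nat) ^ n"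
proof (induction n)
  case (Suc n)
  have "B ^ n \<le> (B + 1) ^ n" by (intro power_mono) auto
  then have "B ^ Suc n \<le> B * (B + 1) ^ n" by simp
  then have "(\<Sum>i\<le>Suc n. B ^ i) \<le> (B + 1) ^ n + B * (B + 1) ^ n"
    unfolding sum.atMost_Suc by (rule add_mono[OF Suc])
  then show ?case by simp
qed simp

text \<open>The order of the quantifiers is the point: \<open>G\<close> is fixed before the values
  \<open>v\<close> outside \<open>S\<close>. Gate list and permutation may depend on
  \<open>v\<close>, but the result is a constant or one of \<open>a\<close> wires after at most a^2
  gates among those wires. There are at most (a^2 + 1)^(a^2) such gate lists.\<close>

lemma restricted_circuits:
  assumes C: "comparator_circuit_on n C"
    and a: "a = card {w \<in> live_wires C. lit_var (labels C ! w) \<in> S}"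
  shows "\<exists>G. finite G \<and> card G \<le> 2 + a * (a\<^sup>2 + 1) ^ a\<^sup>2 \<and>
    (\<forall>v. length v = n \<longrightarrow> (\<exists>g\<in>G. \<forall>u. circuit_output C (mix S u v) = g u))"
proof -
  define U where "U = live_wires C"
  define W where "W = {w \<in> U. lit_var (labels C ! w) \<in> S}"
  define F0 where "F0 = (\<lambda>w u. lit_val u (labels C ! w))"
  define HS where "HS = {hs. set hs \<subseteq> W \<times> W \<and> length hs \<le> a\<^sup>2}"
  define G where "G = {\<lambda>u. False, \<lambda>u. True} \<union> (\<lambda>(hs, w). fold lattice_gate hs F0 w) ` (HS \<times> W)"
  have U: "finite U" "W \<subseteq> U" by (auto simp: U_def W_def)
  then have W: "finite W" "card W = a" using finite_subset by (auto simp: a W_def U_def)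
  have HS: "finite HS" unfolding HS_def using W by (intro finite_lists_length_le) auto
  have "card HS = (\<Sum>i\<le>a\<^sup>2. (a\<^sup>2) ^ i)"
    unfolding HS_def using W by (subst card_lists_length_le) (auto simp: card_cartesian_product power2_eq_square)
  then have cHS: "card HS \<le> (a\<^sup>2 + 1) ^ a\<^sup>2" using sum_power_le by simp
  have "card G \<le> card {\<lambda>u :: bool list. False, \<lambda>u. True} + card ((\<lambda>(hs, w). fold lattice_gate hs F0 w) ` (HS \<times> W))"
    unfolding G_def by (rule card_Un_le)
  also have "\<dots> \<le> 2 + card (HS \<times> W)"
    using HS W by (intro add_mono card_image_le) (auto simp: card_insert_if)
  also have "\<dots> \<le> 2 + a * (a\<^sup>2 + 1) ^ a\<^sup>2"
    using cHS W by (simp add: card_cartesian_product mult.commute)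
  finally have "card G \<le> 2 + a * (a\<^sup>2 + 1) ^ a\<^sup>2" .
  moreover have "\<exists>g\<in>G. \<forall>u. circuit_output C (mix S u v) = g u" if v: "length v = n" for v
  proof -
    define F where "F = (\<lambda>w u. lit_val (mix S u v) (labels C ! w))"
    have out: "circuit_output C (mix S u v) = fold lattice_gate (gates C) F (out_wire C) u" for u
      unfolding circuit_output_def F_def by (rule fold_apply_gate)
    have lab: "lit_var (labels C ! w) < n" if "w \<in> U" for w
    proof -
      have "w < length (labels C)"
        using that C unfolding U_def live_wires_def comparator_circuit_on_def by auto
      then show ?thesis using C unfolding comparator_circuit_on_def by auto
    qed
    have const: "F w = bot \<or> F w = top" if "w \<in> U - W" for w
      using that lab[of w] v unfolding F_def W_def
      by (cases "labels C ! w") (auto simp: fun_eq_iff)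
    have F0: "F w = F0 w" if "w \<in> W" for w
      using that lab[of w] v U unfolding F_def F0_def W_def
      by (cases "labels C ! w") (auto simp: fun_eq_iff)
    have gates: "i \<in> U \<and> j \<in> U \<and> i \<noteq> j" if "(i, j) \<in> set (gates C)" for i j
      using gates_live[OF that] that C unfolding comparator_circuit_on_def U_def by auto
    obtain hs p where p: "bij_betw p U U" and hs: "set hs \<subseteq> W \<times> W"
      and len: "length hs + num_incomparable U (fold lattice_gate hs F) \<le> num_incomparable U F"
      and eq: "\<And>w. w \<in> U \<Longrightarrow> fold lattice_gate (gates C) F w = fold lattice_gate hs F (p w)"
      using useful_gates[where gs = "gates C" and F = F, OF U const gates] by blast
    have o: "out_wire C \<in> U" by (simp add: U_def live_wires_def)
    let ?w = "p (out_wire C)"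
    have w: "?w \<in> U" using p o by (auto simp: bij_betw_def)
    show ?thesis
    proof (cases "?w \<in> W")
      case True
      have "hs \<in> HS" using hs len num_incomparable_le[where F = F, OF U const] W unfolding HS_def by simp
      \<comment> \<open>All gates of \<open>hs\<close> stay inside \<open>W\<close>, where the
        initial literals do not involve \<open>v\<close>; this removes the dependence on
        \<open>v\<close>.\<close>
      moreover have "fold lattice_gate hs F ?w = fold lattice_gate hs F0 ?w"
        by (rule fold_gate_agree[OF hs F0 True])
      ultimately have "fold lattice_gate hs F ?w \<in> G" using True unfolding G_def by force
      then show ?thesis using out eq[OF o] by auto
    next
      case False
      then have "fold lattice_gate hs F ?w = bot \<or> fold lattice_gate hs F ?w = top"
        using const[of ?w] w fold_gate_outside[OF hs, of ?w F] by simp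
      then have "fold lattice_gate hs F ?w \<in> G" unfolding G_def by (auto simp: fun_eq_iff)
      then show ?thesis using out eq[OF o] by auto
    qed
  qed
  moreover have "finite G" unfolding G_def using HS W by simp
  ultimately show ?thesis by blast
qed

text \<open>Starting from \<open>B\<close>, the heaviest remaining element is discarded repeatedly.
  Its weight is at least the average, so the mean weight never increases.\<close>

lemma light_subset:
  fixes wt :: "'b \<Rightarrow> nat"
  assumes "finite B" "m \<le> card B"
  shows "\<exists>J\<subseteq>B. card J = m \<and> card B * sum wt J \<le> m * sum wt B"
  using assms(2)
proof (induction "card B - m" arbitrary: m)
  case 0
  then show ?case by (intro exI[of _ B]) auto
next
  case (Suc d)
  have "d = card B - Suc m" "Suc m \<le> card B" using Suc.hyps(2) by linarith+
  from Suc.hyps(1)[OF this]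
  obtain J where J: "J \<subseteq> B" "card J = Suc m" "card B * sum wt J \<le> Suc m * sum wt B"
    by blast
  have fin: "finite J" "J \<noteq> {}" using J assms(1) finite_subset by auto
  have "Max (wt ` J) \<in> wt ` J" using fin by (intro Max_in) auto
  then obtain x where "x \<in> J" "wt x = Max (wt ` J)" by auto
  then have x: "x \<in> J" "\<And>y. y \<in> J \<Longrightarrow> wt y \<le> wt x" using fin by auto
  have eq: "sum wt J = wt x + sum wt (J - {x})" using fin x by (simp add: sum.remove)
  have "sum wt (J - {x}) \<le> (\<Sum>y\<in>J - {x}. wt x)" using x by (intro sum_mono) auto
  also have "\<dots> = m * wt x" using J x fin by simp
  finally have "Suc m * sum wt (J - {x}) \<le> m * sum wt J" unfolding eq by (simp add: algebra_simps)
  then have "card B * (Suc m * sum wt (J - {x})) \<le> m * (card B * sum wt J)"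
    by (metis mult.left_commute mult_le_mono2)
  also have "\<dots> \<le> m * (Suc m * sum wt B)" using J by (intro mult_left_mono) auto
  finally have "Suc m * (card B * sum wt (J - {x})) \<le> Suc m * (m * sum wt B)"
    by (simp only: mult.left_commute)
  then have "card B * sum wt (J - {x}) \<le> m * sum wt B"
    by (rule mult_le_cancel1[THEN iffD1, rule_format]) simp
  moreover have "card (J - {x}) = m" using J x fin by simp
  ultimately show ?case using J by blast
qed

section \<open>Enough primes\<close>

text \<open>Leibniz' harmonic triangle: \<open>1 / ((n + 1) (n choose m))\<close> is a difference of entries of the
  triangle, so it is an integer combination of the reciprocals of \<open>1, \<dots>, n + 1\<close>.\<close>

lemma Suc_times_binomial_dvd:
  assumes "\<And>i. 1 \<le> i \<Longrightarrow> i \<le> n + 1 \<Longrightarrow> i dvd K" and "m \<le> n"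
  shows "(n + 1) * (n choose m) dvd (K :: nat)"
  using assms
proof (induction m arbitrary: n)
  case 0
  then show ?case by simp
next
  case (Suc m)
  then obtain n' where n: "n = Suc n'" "m \<le> n'" by (cases n) auto
  define a where "a = (n + 1) * (n choose m)"
  define b where "b = n * (n' choose m)"
  define c where "c = (n + 1) * (n choose Suc m)"
  have "a dvd K" unfolding a_def using Suc by auto
  moreover have "b dvd K" unfolding b_def using Suc.IH[of n'] Suc.prems n by simp
  ultimately obtain s t where st: "K = a * s" "K = b * t" unfolding dvd_def by blast
  have pos: "a > 0" "b > 0" "c > 0" using Suc.prems n by (auto simp: a_def b_def c_def zero_less_binomial_iff)
  have 1: "(n - m) * (n choose m) = n * (n' choose m)"
    using binomial_absorb_comp[of n m] n by simp
  have 2: "Suc m * (n choose Suc m) = (n - m) * (n choose m)"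
    using binomial_absorption[of m n] n 1 by simp
  have nm: "real (n - m) = real n - real m" using n by simp
  have b: "real b = (real n - real m) * real (n choose m)"
    unfolding b_def 1[symmetric] of_nat_mult nm ..
  have "real (Suc m) * real (n choose Suc m) = real b"
    unfolding b_def 1[symmetric] 2[symmetric] of_nat_mult ..
  then have c: "real c = (real n + 1) * real b / (real m + 1)"
    unfolding c_def by (simp add: field_simps)
  have a: "real a = (real n + 1) * real (n choose m)" by (simp add: a_def algebra_simps)
  have B: "real (n choose m) > 0" using n by (simp add: zero_less_binomial_iff)
  have nm': "real n - real m > 0" using n by simp
  \<comment> \<open>The recurrence of the harmonic triangle. Multiplied by \<open>K\<close>, its
    right side is a difference of integers, which exhibits \<open>c\<close> as a divisor of
    \<open>K\<close>.\<close>
  have inv: "1 / real c = 1 / real b - 1 / real a"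
  proof -
    have "1 / ((x + d) * (d * y) / x) = 1 / (d * y) - 1 / ((x + d) * y)"
      if "x > 0" "d > 0" "y > 0" for x d y :: real
      using that by (simp add: divide_simps)
    from this[of "real m + 1" "real n - real m" "real (n choose m)"] show ?thesis
      unfolding a c b using B nm' by (simp add: add.commute)
  qed
  have "real K / real c = real K / real b - real K / real a"
    using arg_cong[OF inv, of "\<lambda>y. real K * y"] by (simp add: algebra_simps)
  also have "real K / real b = real t" using pos st(2) by simp
  also have "real K / real a = real s" using pos st(1) by simp
  finally have "real K = real c * (real t - real s)" using pos by (simp add: field_simps)
  then have "of_int (int K) = (of_int (int c * (int t - int s)) :: real)" by simp
  then have "int K = int c * (int t - int s)" by (simp only: of_int_eq_iff)
  then have "int c dvd int K" by simp
  then show ?case unfolding c_def by (simp only: of_nat_dvd_iff)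
qed

text \<open>A Chebyshev bound through the least common multiple of 1, ..., n + 1. It is a multiple
  of n + 1 times the central binomial coefficient, hence at least 2^n; on the other hand each prime
  contributes a power of at most n + 1.\<close>

lemma power_le_power_primes_below: "2 ^ n \<le> (n + 1) ^ primes_below (n + 2)"
proof -
  define N where "N = n + 1"
  define P where "P = {p. prime p \<and> p < n + 2}"
  have P: "finite P" "\<And>p. p \<in> P \<Longrightarrow> prime p" by (auto simp: P_def)
  \<comment> \<open>The largest exponent with \<open>p ^ e p \<le> N\<close>, so that
    \<open>K\<close> is the least common multiple.\<close>
  define e where "e = (\<lambda>p::nat. GREATEST e. p ^ e \<le> N)"
  define K where "K = (\<Prod>p\<in>P. p ^ e p)"
  have bounded: "y \<le> N" if "p ^ y \<le> N" "prime p" for p y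
  proof -
    have "y < 2 ^ y" by (rule less_exp)
    also have "\<dots> \<le> p ^ y" using prime_ge_2_nat[OF that(2)] by (intro power_mono) auto
    finally show ?thesis using that by simp
  qed
  have e: "p ^ e p \<le> N" if "prime p" for p
    unfolding e_def by (rule GreatestI_nat[where k = 0 and b = N]) (use that bounded in \<open>auto simp: N_def\<close>)
  have e_ge: "y \<le> e p" if "prime p" "p ^ y \<le> N" for p y
    unfolding e_def by (rule Greatest_le_nat[where b = N]) (use that bounded in auto)
  have "i dvd K" if "1 \<le> i" "i \<le> n + 1" for i
  proof (rule multiplicity_le_imp_dvd)
    fix p :: nat assume p: "prime p"
    have "p ^ multiplicity p i \<le> i"
      by (rule dvd_imp_le[OF multiplicity_dvd]) (use that in simp)
    then have *: "p ^ multiplicity p i \<le> N" using that unfolding N_def by simp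
    show "multiplicity p i \<le> multiplicity p K"
    proof (cases "p \<in> P")
      case True
      then show ?thesis
        unfolding K_def using multiplicity_prod_prime_powers[OF P p] e_ge[OF p *] by simp
    next
      case False
      then have "\<not> p dvd i" using that p dvd_imp_le[of p i] unfolding P_def by auto
      then show ?thesis by (simp add: not_dvd_imp_multiplicity_0)
    qed
  qed (use that in simp)
  then have "(n + 1) * (n choose (n div 2)) dvd K"
    by (intro Suc_times_binomial_dvd) auto
  moreover have "K > 0" unfolding K_def using P by (auto intro!: prod_pos intro: prime_gt_0_nat)
  ultimately have "(n + 1) * (n choose (n div 2)) \<le> K" by (intro dvd_imp_le)
  moreover have "2 ^ n \<le> (n + 1) * (n choose (n div 2))"
  proof -
    have "(\<Sum>k\<le>n. n choose k) \<le> (\<Sum>k\<le>n. n choose (n div 2))"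
      by (intro sum_mono binomial_maximum)
    then show ?thesis by (simp add: choose_row_sum)
  qed
  moreover have "K \<le> (\<Prod>p\<in>P. N)"
    unfolding K_def using P e by (intro prod_mono) auto
  ultimately show ?thesis by (simp add: N_def primes_below_def P_def)
qed

text \<open>Otherwise the Chebyshev bound at Q = 4^r gives Q \<le> 4 r 2^r + 2, which contradicts 4
  r + 2 \<le> 2^r. The latter inequality is where r \<ge> 5 enters.\<close>

lemma primes_below_ge:
  assumes "r \<ge> 5" shows "primes_below (2 ^ r * 2 ^ r) \<ge> 2 * 2 ^ r"
proof (rule ccontr)
  let ?M = "2 ^ r :: nat" and ?Q = "2 ^ r * 2 ^ r :: nat"
  assume "\<not> ?thesis"
  then have less: "primes_below ?Q < 2 * ?M" by simp
  have M: "4 * r + 2 \<le> ?M"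
    using assms
  proof (induction r rule: nat_induct_at_least)
    case (Suc r)
    then show ?case by simp
  qed simp
  have "1 * 2 \<le> ?M * ?M" using M by (intro mult_le_mono) linarith+
  then have Q: "?Q \<ge> 2" by simp
  have "(2::nat) ^ (?Q - 2) \<le> (?Q - 2 + 1) ^ primes_below (?Q - 2 + 2)"
    by (rule power_le_power_primes_below)
  also have "?Q - 2 + 2 = ?Q" using Q by simp
  also have "(?Q - 2 + 1) ^ primes_below ?Q \<le> ?Q ^ primes_below ?Q"
    using Q by (intro power_mono) auto
  also have "\<dots> = 2 ^ (2 * r * primes_below ?Q)"
    by (simp add: power_add[symmetric] power_mult[symmetric] mult_2[symmetric])
  finally have "?Q - 2 \<le> 2 * r * primes_below ?Q" by simp
  also have "\<dots> \<le> 2 * r * (2 * ?M)" using less by (intro mult_left_mono) auto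
  finally have "?Q \<le> 4 * r * ?M + 2" by simp
  also have "\<dots> < 4 * r * ?M + 2 * ?M" using M assms by (intro add_strict_left_mono) simp
  also have "\<dots> = (4 * r + 2) * ?M" by (simp add: algebra_simps)
  also have "\<dots> \<le> ?Q" using M by (intro mult_right_mono) auto
  finally show False by simp
qed

section \<open>Indexing the primes\<close>

lemma primes_below_Suc: "primes_below (Suc q) = primes_below q + of_bool (prime q)"
proof -
  have "{p. prime p \<and> p < Suc q} = (if prime q then insert q else id) {p. prime p \<and> p < q}"
    by (auto simp: less_Suc_eq)
  then show ?thesis by (simp add: primes_below_def)
qed

lemma primes_below_mono: "q \<le> q' \<Longrightarrow> primes_below q \<le> primes_below q'"
  unfolding primes_below_def by (intro card_mono) auto

lemma primes_below_le: "primes_below q \<le> q"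
  unfolding primes_below_def using card_mono[of "{..<q}" "{p. prime p \<and> p < q}"] by auto

lemma ex_nth_prime: "i < primes_below q \<Longrightarrow> \<exists>p<q. prime p \<and> primes_below p = i"
proof (induction q)
  case 0
  then show ?case by (simp add: primes_below_def)
next
  case (Suc q)
  show ?case
  proof (cases "i < primes_below q")
    case True
    then show ?thesis using Suc.IH less_Suc_eq by blast
  next
    case False
    then have "prime q \<and> primes_below q = i"
      using Suc.prems by (cases "prime q") (auto simp: primes_below_Suc)
    then show ?thesis by blast
  qed
qed

lemma primes_below_inj:
  assumes "prime p" "prime q" "primes_below p = primes_below q" shows "p = q"
proof (rule ccontr)
  have less: "primes_below a < primes_below b" if "prime a" "a < b" for a b
    using primes_below_mono[of "Suc a" b] that by (simp add: primes_below_Suc)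
  assume "p \<noteq> q"
  then show False using less[of p q] less[of q p] assms by (metis linorder_neqE_nat less_irrefl)
qed

text \<open>\<open>p z\<close> is the prime of index \<open>2 ^ r + z\<close>, counted from 0. It
  exists below 4^r by \<open>primes_below_ge\<close>, and it is at least \<open>2 ^ r\<close>
  because an index never exceeds its prime.\<close>

lemma hash_eq_mod_prime:
  assumes "r \<ge> 5"
  obtains p where "\<And>z. z < 2 ^ r \<Longrightarrow> prime (p z)" "\<And>z. z < 2 ^ r \<Longrightarrow> 2 ^ r \<le> p z"
    "\<And>z. z < 2 ^ r \<Longrightarrow> p z < 2 ^ r * 2 ^ r" "inj_on p {..<2 ^ r}"
    "\<And>y z. z < 2 ^ r \<Longrightarrow> hash r y z = y mod p z"
proof -
  have "\<exists>p<2 ^ r * 2 ^ r. prime p \<and> primes_below p = 2 ^ r + z" if "z < 2 ^ r" for z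
    using ex_nth_prime[of "2 ^ r + z" "2 ^ r * 2 ^ r"] primes_below_ge[OF assms] that by simp
  then obtain p where p: "\<And>z. z < 2 ^ r \<Longrightarrow> p z < 2 ^ r * 2 ^ r \<and> prime (p z) \<and> primes_below (p z) = 2 ^ r + z"
    by metis
  have "hash r y z = y mod p z" if z: "z < 2 ^ r" for y z
  proof -
    have "hash r y z = (\<Sum>q<2 ^ r * 2 ^ r. if q = p z then y mod q else 0)"
      unfolding hash_def using p[OF z] primes_below_inj[of _ "p z"]
      by (intro sum.cong) auto
    then show ?thesis using p[OF z] by simp
  qed
  moreover have "2 ^ r \<le> p z" if "z < 2 ^ r" for z
    using p[OF that] primes_below_le[of "p z"] by simp
  moreover have "inj_on p {..<2 ^ r}"
    by (rule inj_onI) (metis p add_left_cancel lessThan_iff)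
  ultimately show ?thesis using p by (intro that[of p]) blast+
qed

section \<open>Pseudorandomness of the hash functions\<close>

definition sgn_bool :: "bool \<Rightarrow> real" where
  "sgn_bool b = (if b then -1 else 1)"

lemma abs_sgn_bool [simp]: "\<bar>sgn_bool b\<bar> = 1"
  by (simp add: sgn_bool_def)

lemma sgn_bool_mult_self [simp]: "sgn_bool b * sgn_bool b = 1"
  by (simp add: sgn_bool_def)

text \<open>The signs alternate and begin with +1, so an odd number of them leaves exactly one. The
  parity of a uniform residue thus has bias 1 / p.\<close>

lemma sum_sgn_bool_odd:
  assumes "odd (p :: nat)" shows "(\<Sum>v<p. sgn_bool (odd v)) = 1"
proof -
  have *: "(\<Sum>v<Suc (2 * k). sgn_bool (odd v)) = 1" for k :: nat
    by (induction k) (auto simp: sgn_bool_def)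
  from assms obtain k where "p = Suc (2 * k)" by (elim oddE) simp
  then show ?thesis by (simp only: *)
qed

lemma sum_crt:
  fixes f g :: "nat \<Rightarrow> real"
  assumes "coprime p q" "p > 0" "q > 0"
  shows "(\<Sum>y<p * q. f (y mod p) * g (y mod q)) = sum f {..<p} * sum g {..<q}"
proof -
  let ?h = "\<lambda>y. (y mod p, y mod q)"
  have inj: "inj_on ?h {..<p * q}"
  proof (rule inj_onI)
    fix x y assume xy: "x \<in> {..<p * q}" "y \<in> {..<p * q}" "?h x = ?h y"
    then have "[x = y] (mod p * q)"
      using assms(1) by (intro coprime_cong_mult_nat) (auto simp: cong_def)
    then show "x = y" using xy by (simp add: cong_def)
  qed
  have "?h ` {..<p * q} = {..<p} \<times> {..<q}"
    by (rule card_subset_eq) (use assms in \<open>auto simp: card_image[OF inj] card_cartesian_product\<close>)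
  then have "sum (\<lambda>(a, b). f a * g b) ({..<p} \<times> {..<q}) = (\<Sum>y<p * q. f (y mod p) * g (y mod q))"
    using sum.reindex[OF inj, of "\<lambda>(a, b). f a * g b"] by simp
  then show ?thesis by (simp add: sum_product sum.cartesian_product)
qed

lemma sum_prod_mod_primes:
  fixes g :: "nat \<Rightarrow> real"
  assumes "finite A" "inj_on p A" "\<And>z. z \<in> A \<Longrightarrow> prime (p z)"
  shows "(\<Sum>y<\<Prod>z\<in>A. p z. \<Prod>z\<in>A. g (y mod p z)) = (\<Prod>z\<in>A. sum g {..<p z :: nat})"
  using assms
proof (induction A rule: finite_induct)
  case (insert a A)
  let ?P = "\<Prod>z\<in>A. p z"
  have cop: "coprime (p a) ?P"
    using insert.prems insert.hyps by (intro prod_coprime_right primes_coprime) (auto simp: inj_on_def)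
  have pos: "p a > 0" "?P > 0" using insert.prems by (auto intro!: prod_pos intro: prime_gt_0_nat)
  have mod: "y mod ?P mod p z = y mod p z" if "z \<in> A" for y z
    using that insert.hyps by (intro mod_mod_cancel dvd_prodI) auto
  have "(\<Sum>y<p a * ?P. g (y mod p a) * (\<Prod>z\<in>A. g (y mod p z))) =
      (\<Sum>y<p a * ?P. g (y mod p a) * (\<Prod>z\<in>A. g (y mod ?P mod p z)))"
    using mod by (intro sum.cong refl arg_cong2[of _ _ _ _ "(*)"] prod.cong) auto
  also have "\<dots> = sum g {..<p a} * (\<Sum>y<?P. \<Prod>z\<in>A. g (y mod p z))"
    by (rule sum_crt[OF cop pos])
  finally show ?case using insert by simp
qed simp

text \<open>Full periods contribute equally; the incomplete one has fewer than \<open>P\<close>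
  terms.\<close>

lemma sum_periodic_le:
  fixes f :: "nat \<Rightarrow> real"
  assumes "P > 0" and per: "\<And>y. f (y + P) = f y" and f: "\<And>y. \<bar>f y\<bar> \<le> 1"
  shows "\<bar>\<Sum>y<K. f y\<bar> \<le> real (K div P) * \<bar>\<Sum>y<P. f y\<bar> + real P"
proof (induction K rule: less_induct)
  case (less K)
  show ?case
  proof (cases "K < P")
    case True
    have "\<bar>\<Sum>y<K. f y\<bar> \<le> (\<Sum>y<K. 1)" using f by (intro order_trans[OF sum_abs] sum_mono)
    then show ?thesis using True by simp
  next
    case False
    define L where "L = K - P"
    have K: "K = P + L" "L < K" using False assms(1) by (auto simp: L_def)
    have "(\<Sum>y<K. f y) = (\<Sum>y<P. f y) + (\<Sum>y<L. f (y + P))"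
      unfolding K by (induction L) (auto simp: add.commute)
    then have "\<bar>\<Sum>y<K. f y\<bar> \<le> \<bar>\<Sum>y<P. f y\<bar> + \<bar>\<Sum>y<L. f y\<bar>"
      unfolding per by linarith
    moreover have "K div P = Suc (L div P)" using K assms(1) by simp
    ultimately show ?thesis using less[OF K(2)] by (simp add: algebra_simps)
  qed
qed

text \<open>Over a full period, the product P of the primes, the sum is exactly 1 by the Chinese
  remainder theorem. The complete periods therefore contribute at most 2^N / P, where P is at least
  2^r to the \<open>card A\<close>. The incomplete period costs at most P \<le> 2^h, which is at
  most 2^N / 2^h because 2 h \<le> N.\<close>

lemma sum_hash_le:
  assumes r: "r \<ge> 5" and A: "A \<subseteq> {..<2 ^ r}" and h: "2 * r * card A \<le> h" "2 * h \<le> N"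
  shows "\<bar>\<Sum>y<2 ^ N. \<Prod>z\<in>A. sgn_bool (odd (hash r y z))\<bar> \<le> 2 ^ N * ((1 / 2 ^ r) ^ card A + 1 / 2 ^ h)"
proof -
  obtain p where p: "\<And>z. z < 2 ^ r \<Longrightarrow> prime (p z)" "\<And>z. z < 2 ^ r \<Longrightarrow> 2 ^ r \<le> p z"
    "\<And>z. z < 2 ^ r \<Longrightarrow> p z < 2 ^ r * 2 ^ r" "inj_on p {..<2 ^ r}"
    "\<And>y z. z < 2 ^ r \<Longrightarrow> hash r y z = y mod p z"
    using hash_eq_mod_prime[OF r] by metis
  have zA: "z < 2 ^ r" if "z \<in> A" for z using that A by auto
  have fin: "finite A" using A finite_subset by blast
  define P where "P = (\<Prod>z\<in>A. p z)"
  define f where "f = (\<lambda>y. \<Prod>z\<in>A. sgn_bool (odd (y mod p z)))"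
  have odd: "odd (p z)" if "z \<in> A" for z
  proof -
    have "(2::nat) ^ 2 \<le> 2 ^ r" using r by (intro power_increasing) auto
    then have "p z > 2" using p(2)[OF zA[OF that]] by simp
    then show ?thesis using p(1)[OF zA[OF that]] prime_odd_nat by blast
  qed
  have "sum f {..<P} = (\<Prod>z\<in>A. \<Sum>v<p z. sgn_bool (odd v))"
    unfolding f_def P_def
    by (rule sum_prod_mod_primes) (use fin p zA inj_on_subset[OF p(4) A] in auto)
  also have "\<dots> = 1" using odd by (simp add: sum_sgn_bool_odd)
  finally have S: "sum f {..<P} = 1" .
  have "P > 0" unfolding P_def using p zA by (auto intro!: prod_pos intro: prime_gt_0_nat)
  moreover have "f (y + P) = f y" for y
  proof -
    have "(y + P) mod p z = y mod p z" if "z \<in> A" for z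
    proof -
      have "p z dvd P" unfolding P_def using fin that by (intro dvd_prodI)
      then show ?thesis by (simp add: mod_add_right_eq[symmetric] mod_eq_0_iff_dvd[THEN iffD2] del: mod_add_right_eq)
    qed
    then show ?thesis unfolding f_def by (intro prod.cong) auto
  qed
  moreover have "\<bar>f y\<bar> \<le> 1" for y unfolding f_def by (simp add: abs_prod)
  ultimately have "\<bar>\<Sum>y<2 ^ N. f y\<bar> \<le> real (2 ^ N div P) * \<bar>sum f {..<P}\<bar> + real P"
    by (rule sum_periodic_le)
  also have "\<dots> \<le> 2 ^ N * (1 / real P) + real P"
  proof -
    have "real (2 ^ N div P * P) \<le> real (2 ^ N)"
      by (simp only: of_nat_le_iff div_times_less_eq_dividend)
    then show ?thesis unfolding S using \<open>P > 0\<close> by (simp add: field_simps)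
  qed
  also have "\<dots> \<le> 2 ^ N * ((1 / 2 ^ r) ^ card A) + 2 ^ N * (1 / 2 ^ h)"
  proof (rule add_mono)
    have "(\<Prod>z\<in>A. 2 ^ r) \<le> P" unfolding P_def using p zA by (intro prod_mono) auto
    then have "(2 ^ r) ^ card A \<le> real P" using of_nat_mono[of "\<Prod>z\<in>A. 2 ^ r" P] by simp
    then have "1 / real P \<le> 1 / (2 ^ r) ^ card A" by (intro divide_left_mono) (use \<open>P > 0\<close> in auto)
    then show "2 ^ N * (1 / real P) \<le> 2 ^ N * ((1 / 2 ^ r) ^ card A)"
      by (intro mult_left_mono) (auto simp: power_one_over)
    have "P \<le> (\<Prod>z\<in>A. 2 ^ r * 2 ^ r)" unfolding P_def using p zA by (intro prod_mono) (auto intro: less_imp_le)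
    also have "\<dots> = 2 ^ (2 * r * card A)"
      by (simp add: power_add[symmetric] power_mult[symmetric] mult_2[symmetric])
    also have "\<dots> \<le> 2 ^ h" using h by (intro power_increasing) auto
    finally have "real P \<le> real (2 ^ h)" by (simp only: of_nat_le_iff)
    then have "real P \<le> 2 ^ h" by simp
    also have "\<dots> = 2 ^ (2 * h) / 2 ^ h" by (simp add: mult_2 power_add)
    also have "\<dots> \<le> 2 ^ N / 2 ^ h" using h by (intro divide_right_mono power_increasing) auto
    finally show "real P \<le> 2 ^ N * (1 / 2 ^ h)" by simp
  qed
  finally show ?thesis
    unfolding f_def using p(5) zA by (simp add: distrib_left cong: prod.cong)
qed

section \<open>Averages over the cube\<close>

definition cube_avg :: "nat \<Rightarrow> (bool list \<Rightarrow> real) \<Rightarrow> real" where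
  "cube_avg n f = sum f (cube n) / 2 ^ n"

lemma cube_eq: "cube n = {x. set x \<subseteq> UNIV \<and> length x = n}"
  by (simp add: cube_def)

lemma finite_cube [simp]: "finite (cube n)"
  unfolding cube_eq by (rule finite_lists_length_eq) simp

lemma card_cube [simp]: "card (cube n) = 2 ^ n"
  unfolding cube_eq by (subst card_lists_length_eq) (auto simp: card_UNIV_bool)

lemma cube_avg_cong: "(\<And>x. length x = n \<Longrightarrow> f x = g x) \<Longrightarrow> cube_avg n f = cube_avg n g"
  unfolding cube_avg_def by (simp add: cube_def)

lemma cube_avg_mono: "(\<And>x. length x = n \<Longrightarrow> f x \<le> g x) \<Longrightarrow> cube_avg n f \<le> cube_avg n g"
  unfolding cube_avg_def by (intro divide_right_mono sum_mono) (auto simp: cube_def)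

lemma cube_avg_const [simp]: "cube_avg n (\<lambda>_. c) = c"
  by (simp add: cube_avg_def)

lemma cube_avg_add: "cube_avg n (\<lambda>x. f x + g x) = cube_avg n f + cube_avg n g"
  by (simp add: cube_avg_def sum.distrib add_divide_distrib)

lemma cube_avg_cmult: "cube_avg n (\<lambda>x. c * f x) = c * cube_avg n f"
  by (simp add: cube_avg_def sum_distrib_left)

lemma cube_avg_sum: "cube_avg n (\<lambda>x. \<Sum>i\<in>I. f i x) = (\<Sum>i\<in>I. cube_avg n (f i))"
  unfolding cube_avg_def by (subst sum.swap) (simp add: sum_divide_distrib)

lemma cube_avg_swap: "cube_avg n (\<lambda>x. cube_avg m (f x)) = cube_avg m (\<lambda>y. cube_avg n (\<lambda>x. f x y))"
  unfolding cube_avg_def sum_divide_distrib[symmetric]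
  by (subst sum.swap) (simp add: field_simps)

lemma abs_cube_avg_le: "\<bar>cube_avg n f\<bar> \<le> cube_avg n (\<lambda>x. \<bar>f x\<bar>)"
  unfolding cube_avg_def by (simp add: divide_right_mono sum_abs)

lemma cube_avg_bij:
  assumes "bij_betw h (cube n) (cube n)"
  shows "cube_avg n (\<lambda>x. f (h x)) = cube_avg n f"
  unfolding cube_avg_def using sum.reindex_bij_betw[OF assms] by simp

lemma mix_mix: "length u = length v \<Longrightarrow> mix S (mix S v u) (mix S u v) = v"
  by (rule nth_equalityI) auto

text \<open>Exchanging the coordinates in \<open>S\<close> of two inputs is an involution on pairs,
  so \<open>mix S u v\<close> is uniform when \<open>u\<close> and \<open>v\<close> are.\<close>

lemma cube_avg_mix: "cube_avg n f = cube_avg n (\<lambda>v. cube_avg n (\<lambda>u. f (mix S u v)))"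
proof -
  let ?h = "\<lambda>(v, u). (mix S u v, mix S v u)"
  have inv: "?h (?h x) = x" if "x \<in> cube n \<times> cube n" for x
    using that by (auto simp: cube_def mix_mix)
  have cl: "?h x \<in> cube n \<times> cube n" if "x \<in> cube n \<times> cube n" for x
    using that by (auto simp: cube_def)
  have bij: "bij_betw ?h (cube n \<times> cube n) (cube n \<times> cube n)"
    by (rule bij_betw_byWitness[where f' = ?h]) (use inv cl in blast)+
  have "(\<Sum>v\<in>cube n. \<Sum>u\<in>cube n. f (mix S u v)) = (\<Sum>x\<in>cube n \<times> cube n. f (fst (?h x)))"
    by (simp add: sum.cartesian_product split_def)
  also have "\<dots> = (\<Sum>x\<in>cube n \<times> cube n. f (fst x))"
    by (rule sum.reindex_bij_betw[OF bij])
  also have "\<dots> = (\<Sum>v\<in>cube n. \<Sum>u\<in>cube n. f v)"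
    unfolding sum.cartesian_product by (simp add: split_def)
  also have "\<dots> = 2 ^ n * sum f (cube n)"
    by (simp add: sum_distrib_left)
  finally show ?thesis
    unfolding cube_avg_def sum_divide_distrib[symmetric] by simp
qed

lemma bij_flip: "i < n \<Longrightarrow> bij_betw (\<lambda>x. x[i := \<not> x ! i]) (cube n) (cube n)"
  by (rule bij_betw_byWitness[where f' = "\<lambda>x. x[i := \<not> x ! i]"]) (auto simp: cube_def)

lemma num_cong:
  "(\<And>i. s \<le> i \<Longrightarrow> i < s + len \<Longrightarrow> bit_at x i = bit_at y i) \<Longrightarrow> num x s len = num y s len"
  by (induction len) auto

lemma sum_even_odd: "(\<Sum>z<2 * k. f z) = (\<Sum>z<k. f (2 * z) + f (Suc (2 * z)))" for f :: "nat \<Rightarrow> real"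
  by (induction k) auto

text \<open>Pairing each input with the one whose last bit of the segment is flipped splits a value
  of the prefix into its two extensions.\<close>

lemma cube_avg_num:
  "s + len \<le> n \<Longrightarrow> cube_avg n (\<lambda>u. f (num u s len)) = (\<Sum>z<2 ^ len. f z) / 2 ^ len"
proof (induction len arbitrary: f)
  case (Suc len)
  let ?i = "s + len"
  let ?F = "\<lambda>u. f (num u s (Suc len))"
  have i: "?i < n" using Suc.prems by simp
  have sum: "?F u + ?F (u[?i := \<not> u ! ?i]) = f (2 * num u s len) + f (Suc (2 * num u s len))"
    if "length u = n" for u
  proof -
    have "num (u[?i := \<not> u ! ?i]) s len = num u s len"
      by (rule num_cong) (auto simp: bit_at_def)
    then show ?thesis using i that by (simp add: bit_at_def)
  qed
  have "2 * cube_avg n ?F = cube_avg n (\<lambda>u. ?F u + ?F (u[?i := \<not> u ! ?i]))"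
    unfolding cube_avg_add cube_avg_bij[OF bij_flip[OF i], of ?F] by simp
  also have "\<dots> = cube_avg n (\<lambda>u. f (2 * num u s len) + f (Suc (2 * num u s len)))"
    by (rule cube_avg_cong) (rule sum)
  also have "\<dots> = (\<Sum>z<2 ^ len. f (2 * z) + f (Suc (2 * z))) / 2 ^ len"
    using Suc.IH[of "\<lambda>m. f (2 * m) + f (Suc (2 * m))"] Suc.prems by simp
  also have "\<dots> = (\<Sum>z<2 ^ Suc len. f z) / 2 ^ len"
    by (simp add: sum_even_odd)
  finally show ?case by simp
qed simp

lemma cube_avg_power_le:
  assumes "even k" shows "cube_avg n f ^ k \<le> cube_avg n (\<lambda>x. f x ^ k)"
proof -
  have "(\<Sum>x\<in>cube n. (1 / 2 ^ n) *\<^sub>R f x) ^ k \<le> (\<Sum>x\<in>cube n. (1 / 2 ^ n) * f x ^ k)"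
  proof (rule convex_on_sum)
    show "cube n \<noteq> {}" using card_cube[of n] by (metis card.empty power_eq_0_iff zero_neq_numeral)
    show "convex_on UNIV (\<lambda>x::real. x ^ k)" using assms by (rule convex_power_even)
  qed auto
  then show ?thesis by (simp add: cube_avg_def sum_divide_distrib)
qed

section \<open>Moments of the restricted correlation\<close>

text \<open>Symmetric difference with \<open>{z}\<close>. Signs square to 1, so a product of signs
  along a list depends only on the elements of odd multiplicity, and these are what repeated
  toggling collects.\<close>

definition toggle :: "nat \<Rightarrow> nat set \<Rightarrow> nat set" where
  "toggle z A = (if z \<in> A then A - {z} else insert z A)"

lemma finite_toggle [simp]: "finite (toggle z A) \<longleftrightarrow> finite A"
  by (simp add: toggle_def)

lemma toggle_subset: "A \<subseteq> B \<Longrightarrow> z \<in> B \<Longrightarrow> toggle z A \<subseteq> B"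
  by (auto simp: toggle_def)

lemma card_toggle_le: "finite A \<Longrightarrow> card (toggle z A) \<le> Suc (card A)"
  unfolding toggle_def using card_Diff1_le[of A z] by (auto simp: card_insert_if)

lemma fold_toggle:
  "finite A \<Longrightarrow> A \<subseteq> B \<Longrightarrow> set zs \<subseteq> B \<Longrightarrow>
    fold toggle zs A \<subseteq> B \<and> card (fold toggle zs A) \<le> card A + length zs"
proof (induction zs arbitrary: A)
  case (Cons z zs)
  have "fold toggle zs (toggle z A) \<subseteq> B \<and> card (fold toggle zs (toggle z A)) \<le> card (toggle z A) + length zs"
    by (rule Cons.IH) (use Cons.prems toggle_subset in auto)
  then show ?case using card_toggle_le[of A z] Cons.prems(1) by simp
qed simp

lemma prod_toggle:
  fixes g :: "nat \<Rightarrow> real"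
  assumes "finite A" "g z * g z = 1" shows "prod g (toggle z A) = prod g A * g z"
proof (cases "z \<in> A")
  case True
  then have "prod g A = g z * prod g (A - {z})" using assms(1) by (simp add: prod.remove)
  then show ?thesis using True assms(2) by (simp add: toggle_def algebra_simps)
qed (use assms in \<open>simp add: toggle_def\<close>)

lemma prod_fold_toggle:
  fixes g :: "nat \<Rightarrow> real"
  assumes "\<And>z. g z * g z = 1" "finite A"
  shows "prod g (fold toggle zs A) = prod g A * prod_list (map g zs)"
  using assms(2)
proof (induction zs arbitrary: A)
  case (Cons z zs)
  then show ?case using prod_toggle[of A g z] assms(1) by simp
qed simp

text \<open>The weight \<open>w ^ card A\<close> is a supermartingale, up to the factor \<open>\<kappa>\<close> per step, when random
  elements are toggled: an element of \<open>A\<close> is hit only with the small probability \<open>card A / M\<close>.\<close>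

lemma sum_toggle_le:
  assumes A: "A \<subseteq> {..<M}" and w: "w > 0" and \<kappa>: "real (card A) / w + real M * w \<le> real M * \<kappa>"
  shows "(\<Sum>z<M. w ^ card (toggle z A)) \<le> real M * (w ^ card A * \<kappa>)"
proof -
  have fin: "finite A" using A finite_subset by blast
  have 1: "w ^ card (toggle z A) = w ^ card A / w" if "z \<in> A" for z
  proof -
    have "w ^ card A = w ^ card (A - {z}) * w"
      by (simp only: card.remove[OF fin that] power_Suc2)
    moreover have "toggle z A = A - {z}" using that by (simp add: toggle_def)
    moreover have "w \<noteq> 0" using w by simp
    ultimately show ?thesis by (metis nonzero_mult_div_cancel_right)
  qed
  have 2: "w ^ card (toggle z A) = w ^ card A * w" if "z \<notin> A" for z
    using that fin by (simp add: toggle_def)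
  have "(\<Sum>z<M. w ^ card (toggle z A)) =
      (\<Sum>z\<in>A. w ^ card (toggle z A)) + (\<Sum>z\<in>{..<M} - A. w ^ card (toggle z A))"
    using sum.subset_diff[OF A, of "\<lambda>z. w ^ card (toggle z A)"] by simp
  also have "(\<Sum>z\<in>A. w ^ card (toggle z A)) = real (card A) * (w ^ card A / w)"
    using 1 by simp
  also have "(\<Sum>z\<in>{..<M} - A. w ^ card (toggle z A)) = real (card ({..<M} - A)) * (w ^ card A * w)"
    using 2 by simp
  also have "\<dots> \<le> real M * (w ^ card A * w)"
    using w card_mono[of "{..<M}" "{..<M} - A"] by (intro mult_right_mono) auto
  also have "real (card A) * (w ^ card A / w) + real M * (w ^ card A * w) =
      w ^ card A * (real (card A) / w + real M * w)"
    by (simp add: algebra_simps)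
  also have "\<dots> \<le> w ^ card A * (real M * \<kappa>)"
    using \<kappa> w by (intro mult_left_mono) auto
  finally show ?thesis by (simp add: algebra_simps)
qed

section \<open>Blocks of the input and their independence\<close>

definition block_pos :: "nat \<Rightarrow> nat \<Rightarrow> nat set" where
  "block_pos n j = {key_len n + j * block_len n..<key_len n + j * block_len n + block_len n}"

lemma block_end_le:
  assumes "j < num_blocks n" shows "key_len n + j * block_len n + block_len n \<le> 2 * key_len n"
proof -
  have "Suc j * block_len n \<le> num_blocks n * block_len n" using assms by (intro mult_right_mono) auto
  also have "\<dots> \<le> key_len n" unfolding num_blocks_def by (rule div_times_less_eq_dividend)
  finally show ?thesis by simp
qed

lemma key_len_le: "2 * key_len n \<le> n"
  by (simp add: key_len_def)

lemma block_pos_subset: "j < num_blocks n \<Longrightarrow> block_pos n j \<subseteq> {key_len n..<2 * key_len n}"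
  using block_end_le[of j n] by (auto simp: block_pos_def)

lemma block_pos_disjoint: "i \<noteq> j \<Longrightarrow> block_pos n i \<inter> block_pos n j = {}"
proof (induction i j rule: linorder_wlog)
  case (le i j)
  then have "Suc i * block_len n \<le> j * block_len n" by (intro mult_right_mono) auto
  then show ?case by (auto simp: block_pos_def)
qed (auto simp: Int_commute)

lemma block_less: "length u = n \<Longrightarrow> block u j < 2 ^ block_len n"
  by (simp add: block_def num_less)

lemma block_mix_in:
  assumes "length u = n" "length v = n" "block_pos n j \<subseteq> S"
  shows "block (mix S u v) j = block u j"
  unfolding block_def length_mix assms(1,2)
  by (rule num_cong) (use assms in \<open>auto simp: bit_at_def block_pos_def subset_iff\<close>)

lemma block_mix_out:
  assumes "length v = n" "block_pos n j \<inter> S = {}"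
  shows "block (mix S u v) j = block v j"
proof -
  have "i \<notin> S" if "key_len n + j * block_len n \<le> i" "i < key_len n + j * block_len n + block_len n" for i
    using that assms(2) by (auto simp: block_pos_def)
  then show ?thesis
    unfolding block_def length_mix assms(1)
    by (intro num_cong) (use assms(1) in \<open>auto simp: bit_at_def\<close>)
qed

lemma cube_avg_block:
  assumes "j < num_blocks n"
  shows "cube_avg n (\<lambda>u. f (block u j)) = (\<Sum>z<2 ^ block_len n. f z) / 2 ^ block_len n"
proof -
  have "cube_avg n (\<lambda>u. f (block u j)) =
      cube_avg n (\<lambda>u. f (num u (key_len n + j * block_len n) (block_len n)))"
    by (rule cube_avg_cong) (simp add: block_def)
  then show ?thesis using block_end_le[OF assms] key_len_le[of n] by (simp add: cube_avg_num)
qed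

text \<open>Distinct blocks are disjoint and hence independent, so each toggle costs one factor
  \<kappa>. The number \<open>T\<close> caps the size of every set that can occur, so that the
  condition on \<kappa> is available at each step.\<close>

lemma cube_avg_toggle_blocks:
  assumes w: "w > 0" and \<kappa>: "\<kappa> \<ge> 0" "\<And>a. a \<le> T \<Longrightarrow> real a / w + 2 ^ block_len n * w \<le> 2 ^ block_len n * \<kappa>"
    and "distinct js" "set js \<subseteq> {..<num_blocks n}" "A \<subseteq> {..<2 ^ block_len n}" "card A + length js \<le> T"
  shows "cube_avg n (\<lambda>u. w ^ card (fold toggle (map (block u) js) A)) \<le> w ^ card A * \<kappa> ^ length js"
  using assms(4-7)
proof (induction js arbitrary: A)
  case Nil
  then show ?case by simp
next
  case (Cons j js)
  let ?M = "2 ^ block_len n :: nat"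
  let ?S = "block_pos n j"
  have fin: "finite A" using Cons.prems finite_subset by blast
  have j: "j < num_blocks n" using Cons.prems by simp
  have mix: "map (block (mix ?S u' u)) js = map (block u) js" if u: "length u = n" for u u'
  proof -
    have "block (mix ?S u' u) i = block u i" if "i \<in> set js" for i
      by (rule block_mix_out[OF u block_pos_disjoint]) (use that Cons.prems in auto)
    then show ?thesis by simp
  qed
  \<comment> \<open>Only block \<open>j\<close> is resampled, which leaves the blocks in
    \<open>js\<close> as they are.\<close>
  have "cube_avg n (\<lambda>u. w ^ card (fold toggle (map (block u) (j # js)) A)) =
      cube_avg n (\<lambda>u. cube_avg n (\<lambda>u'. w ^ card (fold toggle (map (block (mix ?S u' u)) (j # js)) A)))"
    by (rule cube_avg_mix)
  also have "\<dots> = cube_avg n (\<lambda>u. cube_avg n (\<lambda>u'. w ^ card (fold toggle (map (block u) js) (toggle (block u' j) A))))"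
    using mix by (intro cube_avg_cong) (simp add: block_mix_in del: map_eq_conv)
  also have "\<dots> = cube_avg n (\<lambda>u'. cube_avg n (\<lambda>u. w ^ card (fold toggle (map (block u) js) (toggle (block u' j) A))))"
    by (rule cube_avg_swap)
  also have "\<dots> \<le> cube_avg n (\<lambda>u'. w ^ card (toggle (block u' j) A) * \<kappa> ^ length js)"
  proof (rule cube_avg_mono)
    fix u' :: "bool list" assume u': "length u' = n"
    show "cube_avg n (\<lambda>u. w ^ card (fold toggle (map (block u) js) (toggle (block u' j) A)))
        \<le> w ^ card (toggle (block u' j) A) * \<kappa> ^ length js"
    proof (rule Cons.IH)
      show "toggle (block u' j) A \<subseteq> {..<?M}"
        using Cons.prems u' by (intro toggle_subset) (auto simp: block_less)
      show "card (toggle (block u' j) A) + length js \<le> T"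
        using Cons.prems card_toggle_le[OF fin, of "block u' j"] by simp
    qed (use Cons.prems in auto)
  qed
  also have "\<dots> = (\<Sum>z<?M. w ^ card (toggle z A) * \<kappa> ^ length js) / 2 ^ block_len n"
    by (rule cube_avg_block[OF j])
  also have "\<dots> = (\<Sum>z<?M. w ^ card (toggle z A)) * (\<kappa> ^ length js / 2 ^ block_len n)"
    by (simp add: sum_distrib_right)
  also have "\<dots> \<le> (real ?M * (w ^ card A * \<kappa>)) * (\<kappa> ^ length js / 2 ^ block_len n)"
  proof (rule mult_right_mono)
    show "(\<Sum>z<?M. w ^ card (toggle z A)) \<le> real ?M * (w ^ card A * \<kappa>)"
      by (rule sum_toggle_le) (use Cons.prems w \<kappa>(2)[of "card A"] in auto)
  qed (use \<kappa> in simp)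
  finally show ?case by simp
qed

text \<open>The moment is never expanded into a multiple average. An arbitrary set \<open>A\<close>
  is carried along instead: one factor \<open>b y\<close> is written as an average over
  \<open>u\<close>, its hash values are toggled into \<open>A\<close>, and the induction continues
  with one factor less. It ends at \<open>sum_hash_le\<close>, whose bias is dominated by the
  weight. The case of interest is empty \<open>A\<close>.\<close>

lemma moment_bound:
  fixes n js g
  defines "r \<equiv> block_len n" and "N \<equiv> key_len n"
  defines "b \<equiv> \<lambda>y. cube_avg n (\<lambda>u. sgn_bool (g u) * prod_list (map (\<lambda>j. sgn_bool (odd (hash r y (block u j)))) js))"
  assumes w: "w > 0" "1 / 2 ^ r \<le> w" and \<kappa>: "\<kappa> \<ge> 0" "\<And>a. a \<le> T \<Longrightarrow> real a / w + 2 ^ r * w \<le> 2 ^ r * \<kappa>"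
    and js: "distinct js" "set js \<subseteq> {..<num_blocks n}"
    and r: "r \<ge> 5" and h: "2 * r * T \<le> h" "2 * h \<le> N"
    and A: "A \<subseteq> {..<2 ^ r}" "card A + i * length js \<le> T"
  shows "\<bar>\<Sum>y<2 ^ N. (\<Prod>z\<in>A. sgn_bool (odd (hash r y z))) * b y ^ i\<bar> \<le>
    2 ^ N * (w ^ card A * \<kappa> ^ (i * length js) + 1 / 2 ^ h)"
  using A
proof (induction i arbitrary: A)
  case 0
  have "2 * r * card A \<le> 2 * r * T" using 0 by (intro mult_left_mono) auto
  then have "2 * r * card A \<le> h" using h(1) by (rule le_trans)
  then have "\<bar>\<Sum>y<2 ^ N. \<Prod>z\<in>A. sgn_bool (odd (hash r y z))\<bar> \<le> 2 ^ N * ((1 / 2 ^ r) ^ card A + 1 / 2 ^ h)"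
    using 0 h r by (intro sum_hash_le) auto
  also have "\<dots> \<le> 2 ^ N * (w ^ card A + 1 / 2 ^ h)"
    using w by (intro mult_left_mono add_right_mono power_mono) auto
  finally show ?case by simp
next
  case (Suc i)
  let ?m = "length js"
  let ?hs = "\<lambda>y z. sgn_bool (odd (hash r y z))"
  let ?Z = "\<lambda>u. fold toggle (map (block u) js) A"
  have fin: "finite A" using Suc.prems finite_subset by blast
  have Z: "?Z u \<subseteq> {..<2 ^ r} \<and> card (?Z u) \<le> card A + ?m" if "length u = n" for u
    using fold_toggle[OF fin Suc.prems(1), of "map (block u) js"] block_less[OF that] by (auto simp: r_def)
  have prod: "prod (?hs y) (?Z u) = prod (?hs y) A * prod_list (map (\<lambda>j. ?hs y (block u j)) js)" for y u
    using prod_fold_toggle[of "?hs y" A "map (block u) js"] fin by (simp add: comp_def)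
  have "(\<Sum>y<2 ^ N. prod (?hs y) A * b y ^ Suc i) =
      (\<Sum>y<2 ^ N. cube_avg n (\<lambda>u. sgn_bool (g u) * (prod (?hs y) (?Z u) * b y ^ i)))"
  proof (rule sum.cong)
    fix y
    have "prod (?hs y) A * b y ^ Suc i = (prod (?hs y) A * b y ^ i) * b y" by simp
    also have "\<dots> = cube_avg n (\<lambda>u. (prod (?hs y) A * b y ^ i) *
        (sgn_bool (g u) * prod_list (map (\<lambda>j. ?hs y (block u j)) js)))"
      unfolding cube_avg_cmult b_def ..
    also have "\<dots> = cube_avg n (\<lambda>u. sgn_bool (g u) * (prod (?hs y) (?Z u) * b y ^ i))"
      unfolding prod by (simp add: algebra_simps)
    finally show "prod (?hs y) A * b y ^ Suc i = cube_avg n (\<lambda>u. sgn_bool (g u) * (prod (?hs y) (?Z u) * b y ^ i))" .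
  qed simp
  \<comment> \<open>Since \<open>g\<close> does not depend on the key, the sum over keys moves
    inside, and the sign of \<open>g u\<close> is lost in the absolute value.\<close>
  also have "\<dots> = cube_avg n (\<lambda>u. sgn_bool (g u) * (\<Sum>y<2 ^ N. prod (?hs y) (?Z u) * b y ^ i))"
    unfolding sum_distrib_left by (rule cube_avg_sum[symmetric])
  finally have "\<bar>\<Sum>y<2 ^ N. prod (?hs y) A * b y ^ Suc i\<bar> \<le>
      cube_avg n (\<lambda>u. \<bar>\<Sum>y<2 ^ N. prod (?hs y) (?Z u) * b y ^ i\<bar>)"
    using abs_cube_avg_le[of n "\<lambda>u. sgn_bool (g u) * (\<Sum>y<2 ^ N. prod (?hs y) (?Z u) * b y ^ i)"]
    by (simp add: abs_mult)
  also have "\<dots> \<le> cube_avg n (\<lambda>u. 2 ^ N * (w ^ card (?Z u) * \<kappa> ^ (i * ?m) + 1 / 2 ^ h))"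
  proof (rule cube_avg_mono)
    fix u :: "bool list" assume "length u = n"
    then show "\<bar>\<Sum>y<2 ^ N. prod (?hs y) (?Z u) * b y ^ i\<bar> \<le> 2 ^ N * (w ^ card (?Z u) * \<kappa> ^ (i * ?m) + 1 / 2 ^ h)"
      using Z[of u] Suc.prems by (intro Suc.IH) auto
  qed
  also have "\<dots> = 2 ^ N * (\<kappa> ^ (i * ?m) * cube_avg n (\<lambda>u. w ^ card (?Z u)) + 1 / 2 ^ h)"
    unfolding cube_avg_cmult cube_avg_add by (simp add: mult.commute[of _ "\<kappa> ^ _"] cube_avg_cmult)
  also have "\<dots> \<le> 2 ^ N * (\<kappa> ^ (i * ?m) * (w ^ card A * \<kappa> ^ ?m) + 1 / 2 ^ h)"
    using w \<kappa> js Suc.prems unfolding r_def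
    by (intro mult_left_mono add_right_mono cube_avg_toggle_blocks[where T = T]) auto
  finally show ?case by (simp add: power_add algebra_simps)
qed

section \<open>Correlation of small circuits with the hard function\<close>

lemma sgn_bool_odd_add: "sgn_bool (odd (a + b)) = sgn_bool (odd a) * sgn_bool (odd b)"
  by (simp add: sgn_bool_def)

lemma sgn_bool_odd_sum: "finite I \<Longrightarrow> sgn_bool (odd (sum f I)) = (\<Prod>i\<in>I. sgn_bool (odd (f i)))"
proof (induction I rule: finite_induct)
  case empty
  then show ?case by (simp add: sgn_bool_def)
next
  case (insert i I)
  show ?case
    unfolding sum.insert[OF insert.hyps] prod.insert[OF insert.hyps] sgn_bool_odd_add insert.IH ..
qed

lemma sgn_bool_hard:
  assumes "length x = n"
  shows "sgn_bool (hard x) = sgn_bool (odd (\<Sum>i<n. of_bool (2 * key_len n \<le> i) * bit_at x i)) *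
    (\<Prod>j<num_blocks n. sgn_bool (odd (hash (block_len n) (num x 0 (key_len n)) (block x j))))"
  unfolding hard_def assms sgn_bool_odd_add by (simp add: sgn_bool_odd_sum)

text \<open>The chosen blocks avoid the key and the rest. Once \<open>v\<close> is fixed, these two
  and the other blocks contribute a constant sign, and the hash function is the one given by the key
  of \<open>v\<close>.\<close>

lemma sgn_bool_hard_mix:
  assumes js: "distinct js" "set js \<subseteq> {..<num_blocks n}" and S: "S = (\<Union>j\<in>set js. block_pos n j)"
    and v: "length v = n"
  obtains s where "s * s = 1" "\<And>u. length u = n \<Longrightarrow> sgn_bool (hard (mix S u v)) =
    s * prod_list (map (\<lambda>j. sgn_bool (odd (hash (block_len n) (num v 0 (key_len n)) (block u j)))) js)"
proof -
  let ?H = "\<lambda>z. sgn_bool (odd (hash (block_len n) (num v 0 (key_len n)) z))"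
  let ?I = "{..<num_blocks n} - set js"
  define s where "s = sgn_bool (odd (\<Sum>i<n. of_bool (2 * key_len n \<le> i) * bit_at v i)) * (\<Prod>j\<in>?I. ?H (block v j))"
  have SI: "S \<subseteq> {key_len n..<2 * key_len n}"
    unfolding S using js block_pos_subset by blast
  have "sgn_bool (hard (mix S u v)) = s * prod_list (map (\<lambda>j. ?H (block u j)) js)" if u: "length u = n" for u
  proof -
    have bit: "bit_at (mix S u v) i = bit_at v i" if "i < key_len n \<or> 2 * key_len n \<le> i" for i
    proof -
      have "i \<notin> S" using SI that by auto
      then show ?thesis by (auto simp: bit_at_def)
    qed
    have 1: "(\<Sum>i<n. of_bool (2 * key_len n \<le> i) * bit_at (mix S u v) i) =
        (\<Sum>i<n. of_bool (2 * key_len n \<le> i) * bit_at v i)"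
      by (intro sum.cong) (auto simp: bit)
    have 2: "num (mix S u v) 0 (key_len n) = num v 0 (key_len n)"
      by (intro num_cong) (simp add: bit)
    have 3: "block (mix S u v) j = block u j" if "j \<in> set js" for j
      by (rule block_mix_in[OF u v]) (use that S in auto)
    have 4: "block (mix S u v) j = block v j" if "j \<in> ?I" for j
    proof (rule block_mix_out[OF v])
      have "block_pos n j \<inter> block_pos n i = {}" if "i \<in> set js" for i
        by (rule block_pos_disjoint) (use that \<open>j \<in> ?I\<close> in auto)
      then show "block_pos n j \<inter> S = {}" unfolding S by blast
    qed
    have "(\<Prod>j<num_blocks n. ?H (block (mix S u v) j)) =
        (\<Prod>j\<in>?I. ?H (block (mix S u v) j)) * (\<Prod>j\<in>set js. ?H (block (mix S u v) j))"
      by (rule prod.subset_diff) (use js in auto)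
    also have "\<dots> = (\<Prod>j\<in>?I. ?H (block v j)) * (\<Prod>j\<in>set js. ?H (block u j))"
      using 3 4 by simp
    also have "(\<Prod>j\<in>set js. ?H (block u j)) = prod_list (map (\<lambda>j. ?H (block u j)) js)"
      by (rule prod.distinct_set_conv_list[OF js(1)])
    finally show ?thesis
      unfolding sgn_bool_hard[OF length_mix[of S u v, unfolded v]] 1 2 s_def by simp
  qed
  moreover have "s * s = 1"
  proof -
    have "(\<Prod>j\<in>?I. ?H (block v j)) * (\<Prod>j\<in>?I. ?H (block v j)) = 1"
      unfolding prod.distrib[symmetric] by simp
    moreover have "s * s = (sgn_bool (odd (\<Sum>i<n. of_bool (2 * key_len n \<le> i) * bit_at v i)) *
        sgn_bool (odd (\<Sum>i<n. of_bool (2 * key_len n \<le> i) * bit_at v i))) *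
        ((\<Prod>j\<in>?I. ?H (block v j)) * (\<Prod>j\<in>?I. ?H (block v j)))"
      unfolding s_def by (simp only: mult_ac)
    ultimately show ?thesis by simp
  qed
  ultimately show ?thesis by (rule that[rotated])
qed

section \<open>From moments to correlation\<close>

definition correlation :: "nat \<Rightarrow> comparator_circuit \<Rightarrow> real" where
  "correlation n C = cube_avg n (\<lambda>x. sgn_bool (hard x) * sgn_bool (circuit_output C x))"

lemma agreement_eq_correlation: "agreement n hard (circuit_output C) = 1 / 2 + correlation n C / 2"
proof -
  have ne: "cube n \<noteq> {}" using card_cube[of n] by (metis card.empty power_eq_0_iff zero_neq_numeral)
  have "(\<Sum>x\<in>cube n. sgn_bool (hard x) * sgn_bool (circuit_output C x)) =
      (\<Sum>x\<in>cube n. 2 * of_bool (hard x = circuit_output C x) - 1)"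
    by (intro sum.cong) (auto simp: sgn_bool_def)
  also have "\<dots> = 2 * real (card (cube n \<inter> {x. hard x = circuit_output C x})) - 2 ^ n"
    by (simp add: sum_subtractf sum_distrib_left[symmetric] of_bool_def sum.If_cases)
  finally show ?thesis
    unfolding agreement_def measure_pmf_of_set[OF ne finite_cube] correlation_def cube_avg_def
    by (simp add: field_simps)
qed

text \<open>Jensen's inequality brings the even power inside the average over \<open>v\<close>.
  There it removes the sign \<open>s\<close> and makes all terms nonnegative, which permits the sum
  over \<open>G\<close>.\<close>

lemma correlation_power_le:
  fixes n js
  defines "r \<equiv> block_len n"
  assumes C: "comparator_circuit_on n C"
    and js: "distinct js" "set js \<subseteq> {..<num_blocks n}" and S: "S = (\<Union>j\<in>set js. block_pos n j)"
    and G: "finite G" "\<And>v. length v = n \<Longrightarrow> \<exists>g\<in>G. \<forall>u. circuit_output C (mix S u v) = g u"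
    and w: "w > 0" "1 / 2 ^ r \<le> w" and \<kappa>: "\<kappa> \<ge> 0" "\<And>a. a \<le> T \<Longrightarrow> real a / w + 2 ^ r * w \<le> 2 ^ r * \<kappa>"
    and r: "r \<ge> 5" and h: "2 * r * T \<le> h" "2 * h \<le> key_len n" and T: "2 * q * length js \<le> T"
  shows "correlation n C ^ (2 * q) \<le> real (card G) * (\<kappa> ^ (2 * q * length js) + 1 / 2 ^ h)"
proof -
  define b where "b = (\<lambda>g y. cube_avg n (\<lambda>u. sgn_bool (g u) *
    prod_list (map (\<lambda>j. sgn_bool (odd (hash r y (block u j)))) js)))"
  define a where "a = (\<lambda>v. cube_avg n (\<lambda>u. sgn_bool (hard (mix S u v)) * sgn_bool (circuit_output C (mix S u v))))"
  have "correlation n C = cube_avg n a"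
    unfolding correlation_def a_def by (rule cube_avg_mix)
  then have "correlation n C ^ (2 * q) \<le> cube_avg n (\<lambda>v. a v ^ (2 * q))"
    using cube_avg_power_le[of "2 * q" n a] by simp
  also have "\<dots> \<le> cube_avg n (\<lambda>v. \<Sum>g\<in>G. b g (num v 0 (key_len n)) ^ (2 * q))"
  proof (rule cube_avg_mono)
    fix v :: "bool list" assume v: "length v = n"
    let ?y = "num v 0 (key_len n)"
    obtain g where g: "g \<in> G" "\<And>u. circuit_output C (mix S u v) = g u" using G(2)[OF v] by blast
    obtain s where s: "s * s = 1" "\<And>u. length u = n \<Longrightarrow> sgn_bool (hard (mix S u v)) =
        s * prod_list (map (\<lambda>j. sgn_bool (odd (hash (block_len n) ?y (block u j)))) js)"
      using sgn_bool_hard_mix[OF js S v] by metis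
    have "a v = cube_avg n (\<lambda>u. s * (sgn_bool (g u) *
        prod_list (map (\<lambda>j. sgn_bool (odd (hash r ?y (block u j)))) js)))"
      unfolding a_def r_def by (rule cube_avg_cong) (simp add: g s)
    also have "\<dots> = s * b g ?y" unfolding b_def by (rule cube_avg_cmult)
    finally have "a v ^ (2 * q) = (s * s) ^ q * b g ?y ^ (2 * q)"
      by (simp add: power_mult_distrib power_mult power2_eq_square)
    then have "a v ^ (2 * q) = b g ?y ^ (2 * q)" using s(1) by simp
    \<comment> \<open>The function that belongs to \<open>v\<close> may depend on the key, so it is
      bounded by the sum over all candidates: the union bound in terms of moments.\<close>
    also have "\<dots> \<le> (\<Sum>g\<in>G. b g ?y ^ (2 * q))"
      by (rule member_le_sum[OF g(1) _ G(1)]) (simp add: power_mult)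
    finally show "a v ^ (2 * q) \<le> (\<Sum>g\<in>G. b g ?y ^ (2 * q))" .
  qed
  also have "\<dots> = (\<Sum>g\<in>G. cube_avg n (\<lambda>v. b g (num v 0 (key_len n)) ^ (2 * q)))"
    by (rule cube_avg_sum)
  \<comment> \<open>The key of a uniform \<open>v\<close> is uniform, so the average becomes one
    over all keys.\<close>
  also have "\<dots> = (\<Sum>g\<in>G. (\<Sum>y<2 ^ key_len n. b g y ^ (2 * q)) / 2 ^ key_len n)"
    using key_len_le[of n] by (intro sum.cong refl cube_avg_num) simp
  also have "\<dots> \<le> (\<Sum>g\<in>G. \<kappa> ^ (2 * q * length js) + 1 / 2 ^ h)"
  proof (rule sum_mono)
    fix g
    have "\<bar>\<Sum>y<2 ^ key_len n. (\<Prod>z\<in>{}. sgn_bool (odd (hash r y z))) * b g y ^ (2 * q)\<bar> \<le>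
        2 ^ key_len n * (w ^ card ({} :: nat set) * \<kappa> ^ (2 * q * length js) + 1 / 2 ^ h)"
      unfolding b_def r_def
      by (rule moment_bound[where T = T]) (use w \<kappa> js r h T in \<open>auto simp: r_def\<close>)
    then have "(\<Sum>y<2 ^ key_len n. b g y ^ (2 * q)) \<le> 2 ^ key_len n * (\<kappa> ^ (2 * q * length js) + 1 / 2 ^ h)"
      by simp
    then show "(\<Sum>y<2 ^ key_len n. b g y ^ (2 * q)) / 2 ^ key_len n \<le> \<kappa> ^ (2 * q * length js) + 1 / 2 ^ h"
      by (simp add: divide_le_eq mult.commute)
  qed
  finally show ?thesis by simp
qed

text \<open>The rest has more positions than there are live wires. Flipping a position that labels
  none of them negates \<open>hard\<close> and preserves the output.\<close>

lemma correlation_eq_0: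
  assumes C: "comparator_circuit_on n C" and small: "2 * circuit_size C + 1 < n - 2 * key_len n"
  shows "correlation n C = 0"
proof -
  define V where "V = (\<lambda>w. lit_var (labels C ! w)) ` live_wires C"
  have "card V \<le> 2 * circuit_size C + 1"
    unfolding V_def using card_live_wires[of C] card_image_le[OF finite_live_wires] le_trans by blast
  then have "card V < card {2 * key_len n..<n}" using small by simp
  moreover have "finite V" unfolding V_def by simp
  ultimately have "\<not> {2 * key_len n..<n} \<subseteq> V" using card_mono leD by blast
  then obtain i where "i \<in> {2 * key_len n..<n}" "i \<notin> V" by blast
  then have i: "2 * key_len n \<le> i" "i < n" "i \<notin> V" by simp_all
  let ?f = "\<lambda>x. x[i := \<not> x ! i]"
  have circ: "circuit_output C (?f x) = circuit_output C x" for x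
  proof (rule circuit_output_cong)
    fix w assume "w \<in> live_wires C"
    then have "i \<noteq> lit_var (labels C ! w)" using i(3) unfolding V_def by auto
    then show "?f x ! lit_var (labels C ! w) = x ! lit_var (labels C ! w)" by simp
  qed
  have hard: "sgn_bool (hard (?f x)) = - sgn_bool (hard x)" if x: "length x = n" for x
  proof -
    have blocks: "block (?f x) j = block x j" if "j < num_blocks n" for j
      unfolding block_def length_list_update x
      by (rule num_cong) (use block_end_le[OF that] i in \<open>auto simp: bit_at_def nth_list_update\<close>)
    have key: "num (?f x) 0 (key_len n) = num x 0 (key_len n)"
      by (rule num_cong) (use i in \<open>auto simp: bit_at_def nth_list_update\<close>)
    let ?P = "\<lambda>x. \<Sum>i<n. of_bool (2 * key_len n \<le> i) * bit_at x i"
    have P: "?P y = bit_at y i + (\<Sum>i\<in>{..<n} - {i}. of_bool (2 * key_len n \<le> i) * bit_at y i)" for y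
      using i by (subst sum.remove[of _ i]) auto
    have "(\<Sum>i\<in>{..<n} - {i}. of_bool (2 * key_len n \<le> i) * bit_at (?f x) i) =
        (\<Sum>i\<in>{..<n} - {i}. of_bool (2 * key_len n \<le> i) * bit_at x i)"
      by (intro sum.cong) (auto simp: bit_at_def)
    moreover have "odd (bit_at (?f x) i) \<longleftrightarrow> even (bit_at x i)"
      using i x by (auto simp: bit_at_def)
    ultimately have "odd (?P (?f x)) \<longleftrightarrow> even (?P x)"
      unfolding P by auto
    then have "sgn_bool (odd (?P (?f x))) = - sgn_bool (odd (?P x))" by (auto simp: sgn_bool_def)
    then show ?thesis
      using x blocks by (simp add: sgn_bool_hard[of _ n] key)
  qed
  have "correlation n C = cube_avg n (\<lambda>x. sgn_bool (hard (?f x)) * sgn_bool (circuit_output C (?f x)))"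
    unfolding correlation_def by (rule cube_avg_bij[OF bij_flip[OF i(2)], symmetric])
  also have "\<dots> = cube_avg n (\<lambda>x. -1 * (sgn_bool (hard x) * sgn_bool (circuit_output C x)))"
    by (rule cube_avg_cong) (simp add: hard circ)
  also have "\<dots> = - correlation n C" unfolding cube_avg_cmult correlation_def by simp
  finally show ?thesis by simp
qed

text \<open>Each live wire is labelled from at most one block, so the weights of the blocks add up
  to at most the number of live wires and averaging applies.\<close>

lemma restricted_circuits_light_blocks:
  assumes C: "comparator_circuit_on n C" and m: "m \<le> num_blocks n"
  obtains js a G where "distinct js" "set js \<subseteq> {..<num_blocks n}" "length js = m"
    "num_blocks n * a \<le> m * (2 * circuit_size C + 1)"
    "finite G" "card G \<le> 2 + a * (a\<^sup>2 + 1) ^ a\<^sup>2"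
    "\<And>v. length v = n \<Longrightarrow> \<exists>g\<in>G. \<forall>u. circuit_output C (mix (\<Union>j\<in>set js. block_pos n j) u v) = g u"
proof -
  define W where "W = (\<lambda>j. {w \<in> live_wires C. lit_var (labels C ! w) \<in> block_pos n j})"
  have disj: "W i \<inter> W j = {}" if "i \<noteq> j" for i j
    using block_pos_disjoint[OF that, of n] by (auto simp: W_def)
  have sum: "(\<Sum>j\<in>J. card (W j)) = card (\<Union>j\<in>J. W j)" if "finite J" for J
    using that disj by (intro card_UN_disjoint[symmetric]) (auto simp: W_def)
  obtain J where J: "J \<subseteq> {..<num_blocks n}" "card J = m"
      "num_blocks n * (\<Sum>j\<in>J. card (W j)) \<le> m * (\<Sum>j<num_blocks n. card (W j))"
    using light_subset[of "{..<num_blocks n}" m "\<lambda>j. card (W j)"] m by auto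
  have fin: "finite J" using J(1) finite_subset by blast
  then obtain js where js: "set js = J" "distinct js" using finite_distinct_list by blast
  define a where "a = card (\<Union>j\<in>J. W j)"
  have "(\<Sum>j<num_blocks n. card (W j)) \<le> card (live_wires C)"
    unfolding sum[OF finite_lessThan] by (intro card_mono) (auto simp: W_def)
  then have "(\<Sum>j<num_blocks n. card (W j)) \<le> 2 * circuit_size C + 1"
    using card_live_wires[of C] by simp
  then have "m * (\<Sum>j<num_blocks n. card (W j)) \<le> m * (2 * circuit_size C + 1)"
    by (rule mult_le_mono2)
  then have a: "num_blocks n * a \<le> m * (2 * circuit_size C + 1)"
    using J(3) unfolding a_def sum[OF fin, symmetric] by (rule le_trans[rotated])
  have "a = card {w \<in> live_wires C. lit_var (labels C ! w) \<in> (\<Union>j\<in>set js. block_pos n j)}"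
    unfolding a_def js(1) by (rule arg_cong[where f = card]) (auto simp: W_def)
  from restricted_circuits[OF C this] obtain G where "finite G" "card G \<le> 2 + a * (a\<^sup>2 + 1) ^ a\<^sup>2"
    "\<And>v. length v = n \<Longrightarrow> \<exists>g\<in>G. \<forall>u. circuit_output C (mix (\<Union>j\<in>set js. block_pos n j) u v) = g u"
    by blast
  moreover have "length js = m" using js J distinct_card by metis
  ultimately show ?thesis using that[of js a G] js J a by blast
qed

section \<open>Choice of parameters\<close>

lemma card_restricted_le:
  fixes a n :: nat
  assumes "n \<ge> 2" "a\<^sup>2 + 1 \<le> n" shows "2 + a * (a\<^sup>2 + 1) ^ a\<^sup>2 \<le> n ^ (a\<^sup>2 + 2)"
proof -
  have "a \<le> a\<^sup>2" by (simp add: power2_eq_square)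
  then have "a * (a\<^sup>2 + 1) ^ a\<^sup>2 \<le> (n - 1) * n ^ a\<^sup>2"
    using assms by (intro mult_le_mono power_mono) auto
  moreover have "2 \<le> n * n ^ a\<^sup>2" using assms by (metis le_trans mult_le_mono nat_mult_1_right one_le_power le_refl one_le_numeral)
  ultimately have "2 + a * (a\<^sup>2 + 1) ^ a\<^sup>2 \<le> n * n ^ a\<^sup>2 + (n - 1) * n ^ a\<^sup>2" by linarith
  also have "\<dots> \<le> n * n ^ a\<^sup>2 + n * (n - 1) * n ^ a\<^sup>2" using assms by simp
  also have "\<dots> = n ^ (a\<^sup>2 + 2)"
    using assms by (cases n) (auto simp: algebra_simps power2_eq_square)
  finally show ?thesis .
qed

lemma power_eq_2_powr:
  assumes "n > 0" shows "real (n ^ k) = 2 powr (log 2 (real n) * real k)"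
proof -
  have "real (n ^ k) = (2 powr log 2 (real n)) ^ k" using assms by simp
  also have "\<dots> = (2 powr log 2 (real n)) powr real k" by (rule powr_realpow[symmetric]) simp
  finally show ?thesis by (simp only: powr_powr)
qed

text \<open>Let E = l m q. The moment is at most a sum of two terms, each at most 2^(-2E). By the
  assumption on \<open>a\<close>, the size of \<open>G\<close> together with the factor 2 costs at
  most 2^E. The root of order 2q of the remaining 2^(-E) has the exponent -l m / 2.\<close>

lemma correlation_le:
  fixes n js
  defines "l \<equiv> Suc (floor_log n)"
  assumes C: "comparator_circuit_on n C" and n: "n \<ge> 2"
    and m: "m \<le> num_blocks n" "m \<ge> 1"
    and q: "q \<ge> 1" "32 * l * m * q \<le> key_len n"
    and a: "\<And>a. num_blocks n * a \<le> m * (2 * circuit_size C + 1) \<Longrightarrow> a\<^sup>2 + 1 \<le> n \<and>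
      log 2 n * real (a\<^sup>2 + 2) + 1 \<le> real (l * m * q)"
  shows "correlation n C \<le> 2 powr (- (real l * real m / 2))"
proof -
  obtain js a G where js: "distinct js" "set js \<subseteq> {..<num_blocks n}" "length js = m"
    and wires: "num_blocks n * a \<le> m * (2 * circuit_size C + 1)"
    and G: "finite G" "card G \<le> 2 + a * (a\<^sup>2 + 1) ^ a\<^sup>2"
      "\<And>v. length v = n \<Longrightarrow> \<exists>g\<in>G. \<forall>u. circuit_output C (mix (\<Union>j\<in>set js. block_pos n j) u v) = g u"
    using restricted_circuits_light_blocks[OF C m(1)] by metis
  have a': "a\<^sup>2 + 1 \<le> n" "log 2 n * real (a\<^sup>2 + 2) + 1 \<le> real (l * m * q)" using a[OF wires] by blast+
  have r: "block_len n = 4 * l" by (simp add: block_len_def l_def)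
  have l2: "l \<ge> 2"
  proof -
    have "floor_log n \<noteq> 0" using n floor_log_exp2_gt[of n] by (metis less_le_not_le mult.right_neutral power_0)
    then show ?thesis by (simp add: l_def)
  qed
  have pow: "n < 2 ^ l" using floor_log_exp2_gt[of n] by (simp add: l_def)
  define E where "E = l * m * q"
  let ?T = "2 * q * m"
  have "?T \<le> 32 * l * m * q" using l2 by simp
  then have "?T \<le> n" using q(2) key_len_le[of n] by linarith
  then have T: "?T + 1 \<le> 2 ^ l" using pow by simp
  have "correlation n C ^ (2 * q) \<le> real (card G) * ((1 / 2 ^ l) ^ (2 * q * length js) + 1 / 2 ^ (16 * E))"
  \<comment> \<open>With blocks of length 4 l, weight 2^(-2l) and \<kappa> = 2^(-l), the condition
    on \<kappa> reads (t + 1) 2^(2l) \<le> 2^(3l), which holds as t \<le> 2 q m < 2^l. The value h =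
    16 E is exactly 2 r T.\<close>
  proof (rule correlation_power_le[OF C js(1,2) refl G(1,3), where w = "1 / 2 ^ (2 * l)" and T = ?T])
    show "1 / 2 ^ block_len n \<le> 1 / (2 ^ (2 * l) :: real)"
      unfolding r by (intro divide_left_mono power_increasing) auto
    fix t assume "t \<le> ?T"
    then have "t + 1 \<le> 2 ^ l" using T by simp
    then have "real (t + 1) \<le> real (2 ^ l)" by (simp only: of_nat_le_iff)
    then have "real t + 1 \<le> 2 ^ l" by (simp add: add.commute)
    then have "(real t + 1) * 2 ^ (2 * l) \<le> 2 ^ l * 2 ^ (2 * l)" by (intro mult_right_mono) auto
    moreover have "(2::real) ^ (4 * l) / 2 ^ (2 * l) = 2 ^ (2 * l)" "(2::real) ^ (4 * l) / 2 ^ l = 2 ^ l * 2 ^ (2 * l)"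
      by (simp_all add: power_diff[symmetric] flip: power_add)
    ultimately show "real t / (1 / 2 ^ (2 * l)) + 2 ^ block_len n * (1 / 2 ^ (2 * l)) \<le> 2 ^ block_len n * (1 / 2 ^ l)"
      unfolding r by (simp add: algebra_simps)
  next
    show "2 * (16 * E) \<le> key_len n" using q(2) unfolding E_def by (simp add: mult_ac)
  qed (use r l2 js in \<open>auto simp: E_def\<close>)
  also have "\<dots> \<le> 2 powr (log 2 n * real (a\<^sup>2 + 2)) * (2 * 2 powr (- (2 * E)))"
  proof (rule mult_mono)
    have "real (card G) \<le> real (n ^ (a\<^sup>2 + 2))"
      using G(2) card_restricted_le[OF n a'(1)] by (simp only: of_nat_le_iff)
    also have "\<dots> = 2 powr (log 2 n * real (a\<^sup>2 + 2))"
      using n by (intro power_eq_2_powr) simp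
    finally show "real (card G) \<le> 2 powr (log 2 n * real (a\<^sup>2 + 2))" .
    have 1: "(1 / 2 ^ l) ^ (2 * q * length js) = (2 :: real) powr (- (2 * E))"
      unfolding js(3) E_def
      by (simp add: powr_minus powr_realpow[symmetric] powr_powr power_one_over field_simps flip: power_mult)
    have "(1 :: real) / 2 ^ (16 * E) \<le> 1 / 2 ^ (2 * E)"
      by (intro divide_left_mono power_increasing) auto
    also have "1 / 2 ^ (2 * E) = (2 :: real) powr (- (2 * E))"
      by (simp add: powr_minus powr_realpow[symmetric] field_simps)
    finally show "(1 / 2 ^ l) ^ (2 * q * length js) + 1 / 2 ^ (16 * E) \<le> 2 * (2 :: real) powr (- (2 * E))"
      unfolding 1 by simp
  qed auto
  also have "\<dots> = 2 powr (log 2 n * real (a\<^sup>2 + 2) + 1 - 2 * E)"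
    by (simp add: powr_add powr_diff powr_minus field_simps)
  also have "\<dots> \<le> 2 powr (- E)"
    using a'(2) unfolding E_def by (intro powr_mono) auto
  also have "\<dots> = (2 powr (- (real l * real m / 2))) ^ (2 * q)"
    by (simp add: powr_realpow[symmetric] powr_powr E_def mult.assoc)
  finally have "correlation n C ^ (2 * q) \<le> (2 powr (- (real l * real m / 2))) ^ (2 * q)" .
  then have *: "\<not> (2 powr (- (real l * real m / 2))) ^ (2 * q) < correlation n C ^ (2 * q)"
    by simp
  show ?thesis
  proof (rule ccontr)
    assume "\<not> ?thesis"
    then have "(2 powr (- (real l * real m / 2))) ^ (2 * q) < correlation n C ^ (2 * q)"
      using q by (intro power_strict_mono) auto
    then show False using * by blast
  qed
qed

lemma floor_log_le_log: "n > 0 \<Longrightarrow> real (floor_log n) \<le> log 2 (real n)"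
  using of_nat_mono[OF floor_log_exp2_le[of n], where 'a = real]
  by (simp add: le_log_iff powr_realpow)

text \<open>Below about n / 4 gates the correlation vanishes. Otherwise the size bound itself limits
  k, so n is large compared with k and explicit inequalities replace asymptotics.\<close>

lemma correlation_small_circuits:
  fixes k :: real
  assumes C: "comparator_circuit_on n C" and n: "n \<ge> 2" and k: "k \<ge> 1000 * log 2 n"
    and size: "real (circuit_size C) \<le> real n powr 1.5 / (1000 * k * sqrt (log 2 n))"
  shows "correlation n C \<le> 2 powr (- (k / 16))"
proof (cases "2 * circuit_size C + 1 < n - 2 * key_len n")
  case True
  then show ?thesis using correlation_eq_0[OF C] by simp
next
  case False
  define L where "L = log 2 (real n)"
  define x where "x = sqrt (real n)"
  define s where "s = circuit_size C"
  define N where "N = key_len n"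
  define l where "l = Suc (floor_log n)"
  define K where "K = nat \<lfloor>k\<rfloor>"
  define r where "r = 4 * l"
  \<comment> \<open>This keeps m r between k / 2 and k, while \<open>q\<close> below is as large as
    the key length permits.\<close>
  define m where "m = K div r"
  define b where "b = num_blocks n"
  define q where "q = N div (32 * l * m)"
  have L: "L \<ge> 1" unfolding L_def using n by simp
  then have sL: "sqrt L \<ge> 1" by simp
  have x: "x * x = real n" "x > 0" unfolding x_def using n by simp_all
  have kL: "1000 * L \<le> k" using k by (simp add: L_def)
  then have kpos: "k \<ge> 1000" using L by simp
  \<comment> \<open>Together with the size bound this forces 125 k \<le> sqrt n. As k \<ge> 1000, it
    follows that sqrt n \<ge> 125000, which absorbs all rounding errors and lower-order
    terms.\<close>
  have ns: "n \<le> 8 * s"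
  proof -
    have "n \<le> 2 * s + 1 + 2 * (n div 4)" using False unfolding s_def key_len_def by linarith
    moreover have "4 * (n div 4) \<le> n" by simp
    ultimately have "n \<le> 4 * s + 2" by linarith
    moreover have "s \<noteq> 0"
    proof
      assume "s = 0"
      then have "n = 2" using \<open>n \<le> 4 * s + 2\<close> n by simp
      then show False using \<open>n \<le> 2 * s + 1 + 2 * (n div 4)\<close> \<open>s = 0\<close> by simp
    qed
    ultimately show ?thesis by linarith
  qed
  have "real n powr 1.5 = real n powr (1 + 1 / 2)" by simp
  also have "\<dots> = real n * x"
    unfolding powr_add x_def using n by (simp add: powr_half_sqrt)
  finally have "real s \<le> real n * x / (1000 * k * sqrt L)"
    using size by (simp add: s_def L_def)
  then have s: "real s * (1000 * k * sqrt L) \<le> real n * x"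
    using kpos sL by (simp add: le_divide_eq)
  have "real n / 8 * (1000 * k * sqrt L) \<le> real s * (1000 * k * sqrt L)"
    by (rule mult_right_mono) (use ns kpos sL in auto)
  moreover have "real n * (125 * (k * sqrt L)) = real n / 8 * (1000 * k * sqrt L)" by simp
  ultimately have "real n * (125 * (k * sqrt L)) \<le> real n * x" using s by linarith
  then have "125 * (k * sqrt L) \<le> x" using n by simp
  moreover have "k * 1 \<le> k * sqrt L" using kpos sL by (intro mult_left_mono) auto
  ultimately have xk: "125 * k \<le> x" by simp
  then have x_large: "x \<ge> 125000" using kpos by simp
  have "125000 * x \<le> x * x" using x_large by (intro mult_right_mono) auto
  then have xn: "125000 * x \<le> real n" using x by simp
  have "real (floor_log n) \<le> L" unfolding L_def using n by (intro floor_log_le_log) simp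
  then have r: "real r \<le> 8 * L" using L by (simp add: r_def l_def)
  have K: "real K \<le> k" "k < real K + 1"
    using kpos unfolding K_def by linarith+
  have r_pos: "r > 0" by (simp add: r_def l_def)
  have N: "4 * real N \<le> real n" "real n \<le> 4 * real N + 4"
    unfolding N_def key_len_def by linarith+
  have mr: "real m * real r \<le> k" "k / 2 \<le> real m * real r"
  proof -
    have "m * r \<le> K" unfolding m_def by (rule div_times_less_eq_dividend)
    then have "real (m * r) \<le> real K" by (simp only: of_nat_le_iff)
    then show "real m * real r \<le> k" using K by simp
    have "K < (m + 1) * r" unfolding m_def using r_pos by (simp add: dividend_less_div_times add.commute)
    then have "K + 1 \<le> (m + 1) * r" by simp
    then have "real (K + 1) \<le> real ((m + 1) * r)" by (simp only: of_nat_le_iff)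
    then have "k \<le> real m * real r + real r" using K by (simp add: algebra_simps)
    then show "k / 2 \<le> real m * real r" using r kL L by linarith
  qed
  have m1: "m \<ge> 1"
  proof (rule ccontr)
    assume "\<not> m \<ge> 1"
    then have "m = 0" by simp
    then show False using mr kpos by simp
  qed
  have b_eq: "b = N div r" by (simp add: b_def num_blocks_def N_def r_def l_def block_len_def)
  have "K \<le> N"
  proof -
    have "real K \<le> real N" using K xk xn N x_large by linarith
    then show ?thesis by simp
  qed
  then have mb: "m \<le> b" unfolding m_def b_eq by (rule div_le_mono)
  have br: "real n / 10 \<le> real b * real r"
  proof -
    have "N < (b + 1) * r" unfolding b_eq using r_pos by (simp add: dividend_less_div_times add.commute)
    then have "real N \<le> real ((b + 1) * r)" by (simp only: of_nat_le_iff less_imp_le)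
    then have "real N \<le> real b * real r + real r" by (simp add: algebra_simps)
    then show ?thesis using r kL xk xn N x_large L by linarith
  qed
  have lm: "4 * (real l * real m) = real m * real r" by (simp add: r_def)
  have lmq: "32 * l * m * q \<le> N" unfolding q_def by (rule times_div_less_eq_dividend)
  have E: "real n / 200 \<le> real (l * m * q)"
  proof -
    have "N < (q + 1) * (32 * l * m)"
      unfolding q_def using m1 by (simp add: dividend_less_div_times add.commute l_def)
    then have "real N \<le> real ((q + 1) * (32 * l * m))" by (simp only: of_nat_le_iff less_imp_le)
    then have "real N \<le> 32 * real (l * m * q) + 32 * (real l * real m)" by (simp add: algebra_simps)
    then show ?thesis using lm mr xk xn N x_large by linarith
  qed
  have q1: "q \<ge> 1"
  proof (rule ccontr)
    assume "\<not> q \<ge> 1"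
    then have "q = 0" by simp
    then show False using E n by simp
  qed
  have "correlation n C \<le> 2 powr (- (real l * real m / 2))"
    unfolding l_def
  proof (rule correlation_le[OF C n, where q = q])
    show "m \<le> num_blocks n" using mb by (simp add: b_def)
    show "32 * Suc (floor_log n) * m * q \<le> key_len n" using lmq by (simp add: l_def N_def)
    fix a assume a: "num_blocks n * a \<le> m * (2 * circuit_size C + 1)"
    \<comment> \<open>Multiplication by r allows m r \<le> k and b r \<ge> n / 10 to be used, so a n
      / 10 \<le> 3 k s. The size bound turns this into a sqrt L \<le> 3/100 sqrt n. Squared, a^2 L
      is at most 9/10000 n, well below the available n / 200.\<close>
    have "b * a \<le> m * (2 * s + 1)" using a by (simp add: b_def s_def)
    also have "\<dots> \<le> m * (3 * s)" using ns n by (intro mult_left_mono) auto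
    finally have "real (b * a) \<le> real (m * (3 * s))" by (simp only: of_nat_le_iff)
    then have "(real b * real a) * real r \<le> (real m * (3 * real s)) * real r"
      by (intro mult_right_mono) auto
    then have "(real b * real r) * real a \<le> (real m * real r) * (3 * real s)" by (simp add: mult_ac)
    also have "\<dots> \<le> k * (3 * real s)" using mr by (intro mult_right_mono) auto
    finally have "(real n / 10) * real a \<le> k * (3 * real s)"
      using mult_right_mono[OF br, of "real a"] by simp
    then have "(real n / 10 * real a) * (1000 * sqrt L) \<le> (k * (3 * real s)) * (1000 * sqrt L)"
      using sL by (intro mult_right_mono) auto
    also have "\<dots> = 3 * (real s * (1000 * k * sqrt L))" by simp
    also have "\<dots> \<le> 3 * (real n * x)" using s by (intro mult_left_mono) auto
    finally have "real n * (100 * (real a * sqrt L)) \<le> real n * (3 * x)" by (simp add: mult_ac)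
    then have "real a * sqrt L \<le> 3 / 100 * x" using n by simp
    then have "(real a * sqrt L)\<^sup>2 \<le> (3 / 100 * x)\<^sup>2" using sL by (intro power_mono) auto
    moreover have "(real a * sqrt L)\<^sup>2 = (real a)\<^sup>2 * L" using L by (simp add: power_mult_distrib)
    moreover have "(3 / 100 * x)\<^sup>2 = 9 / 10000 * real n"
      unfolding power_mult_distrib using x by (simp add: power2_eq_square)
    ultimately have aL: "(real a)\<^sup>2 * L \<le> 9 / 10000 * real n" by simp
    have "(real a)\<^sup>2 * 1 \<le> (real a)\<^sup>2 * L" using L by (intro mult_left_mono) auto
    then have "(real a)\<^sup>2 + 1 \<le> real n" using aL xn x_large by linarith
    then have "real (a\<^sup>2 + 1) \<le> real n" by simp
    then have "a\<^sup>2 + 1 \<le> n" by (simp only: of_nat_le_iff)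
    moreover have "L * real (a\<^sup>2 + 2) + 1 \<le> real (l * m * q)"
    proof -
      have "L * real (a\<^sup>2 + 2) + 1 = (real a)\<^sup>2 * L + 2 * L + 1" by (simp add: algebra_simps)
      also have "\<dots> \<le> real n / 200" using aL kL xk xn x_large by linarith
      finally show ?thesis using E by linarith
    qed
    ultimately show "a\<^sup>2 + 1 \<le> n \<and> log 2 (real n) * real (a\<^sup>2 + 2) + 1 \<le> real (Suc (floor_log n) * m * q)"
      by (simp only: L_def l_def)
  qed (use m1 q1 in auto)
  also have "\<dots> \<le> 2 powr (- (k / 16))"
  proof (rule powr_mono)
    \<comment> \<open>From 4 l m = m r \<ge> k / 2; halving gives the final constant 1/16.\<close>
    have "k / 8 \<le> real l * real m" using lm mr(2) by linarith
    then show "- (real l * real m / 2) \<le> - (k / 16)" by simp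
  qed simp
  finally show ?thesis .
qed

theorem theorem1:
  shows "\<exists>c d \<gamma> :: real. c \<ge> 1 \<and> d \<ge> 1 \<and> \<gamma> > 0 \<and>
    (\<forall>k :: nat \<Rightarrow> real. (\<forall>n\<ge>2. k n \<ge> c * log 2 (real n)) \<longrightarrow>
      (\<exists>f :: bool list \<Rightarrow> bool. poly_time_computable f \<and>
        (\<forall>n\<ge>2. \<forall>C. comparator_circuit_on n C \<and>
            real (circuit_size C) \<le> real n powr 1.5 / (d * k n * sqrt (log 2 (real n))) \<longrightarrow>
            agreement n f (circuit_output C) \<le> 1 / 2 + 1 / 2 powr (\<gamma> * k n))))"
proof -
  \<comment> \<open>The agreement exceeds 1/2 by half the correlation, so the constants c = d = 1000
    and \<gamma> = 1/16 carry over unchanged.\<close>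
  have "agreement n hard (circuit_output C) \<le> 1 / 2 + 1 / 2 powr (1 / 16 * k n)"
    if "\<forall>n\<ge>2. k n \<ge> 1000 * log 2 (real n)" "n \<ge> 2" "comparator_circuit_on n C"
      "real (circuit_size C) \<le> real n powr 1.5 / (1000 * k n * sqrt (log 2 (real n)))"
    for k :: "nat \<Rightarrow> real" and n C
  proof -
    have "correlation n C \<le> 2 powr (- (k n / 16))"
      using that by (intro correlation_small_circuits) auto
    moreover have "0 \<le> 2 powr (- (k n / 16))" by simp
    ultimately have "correlation n C / 2 \<le> 2 powr (- (k n / 16))" by linarith
    then show ?thesis by (simp add: agreement_eq_correlation powr_minus_divide)
  qed
  then show ?thesis
    by (intro exI[of _ 1000] exI[of _ "1 / 16"] conjI allI impI exI[of _ hard] poly_time_computable_hard) auto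
qed

end
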